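(* For each topological space $X$ and each abelian group $G$ there is an isomorphism $$\bar{H}^N_*(X;G)\simeq \bar{H}^{\infty}_*(X;G),$$ where $\bar{H}^N_*(X;G)$ is the Alexander-Spanier normal homology of $X$ and $\bar{H}^\infty_*(X;G)$ is the homology of the total complex of the inverse system of Alexander-Spanier normal chain complexes of the terms of a polyhedral resolution of $X$.
   Context: **Cone construction.** Let $G$ be an abelian group and $0\to G\to I^0\xrightarrow{\beta} I^1\to 0$ an injective resolution of $G$. For a cochain complex $C^*=(C^n,\delta)$ of abelian groups let $C_*(\beta_\#)$ be the chain complex with $C_n(\beta_\#)=\mathrm{Hom}(C^n,I^0)\oplus \mathrm{Hom}(C^{n+1},I^1)$ and $\partial(\varphi',\varphi'')=(\varphi'\circ\delta,\ \beta\circ\varphi'-\varphi''\circ\delta)$. A cochain map $f^\#:C^*\to C'^*$ induces a chain map $C'_*(\beta_\#)\to C_*(\beta_\#)$, $(\varphi',\varphi'')\mapsto(\varphi'\circ f^n,\varphi''\circ f^{n+1})$. **Alexander-Spanier normal cochains, chains and homology.** An open covering of a space is normal if it admits a subordinate partition of unity. For a space $X$ let $C^n(X)$ be the group of all functions $X^{n+1}\to\mathbb{Z}$, with $(\delta\varphi)(x_0,\dots,x_{n+1})=\sum_i(-1)^i\varphi(x_0,\dots,\hat{x}_i,\dots,x_{n+1})$. Let $C^n_0(X)$ be the subgroup of those $\varphi$ for which there is a normal covering $\mathcal{U}$ of $X$ with $\varphi(x_0,\dots,x_n)=0$ whenever $x_0,\dots,x_n$ lie in a common member of $\mathcal{U}$.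 Put $\bar{C}^*_N(X)=C^*(X)/C^*_0(X)$; it is contravariantly functorial in $X$. Let $\bar{C}_*^N(X;G)$ be the chain complex $C_*(\beta_\#)$ obtained by applying the cone construction to $C^*=\bar{C}^*_N(X)$. The Alexander-Spanier normal homology of $X$ is $\bar{H}^N_n(X;G)=H_n(\bar{C}_*^N(X;G))$. **Total complex.** Let $\mathbf{C}_*=\{C_*^\lambda,p_{\lambda\lambda'},\Lambda\}$ be an inverse system of chain complexes over a directed set $\Lambda$ ($p_{\lambda\lambda'}:C_*^{\lambda'}\to C_*^{\lambda}$ for $\lambda\le\lambda'$). Let $\Lambda_s$ be the set of multiindices $\boldsymbol{\lambda}=(\lambda_0,\dots,\lambda_s)$, $\lambda_0\le\dots\le\lambda_s$, and $d^j\boldsymbol{\lambda}$ the result of omitting $\lambda_j$. The total complex is $T_n(\mathbf{C}_* )=\prod_{s\ge0}\prod_{\boldsymbol{\lambda}\in\Lambda_s}C^{\lambda_0}_{n+s}$; its elements are functions $c$ with $c(\boldsymbol{\lambda})\in C^{\lambda_0}_{n+s}$. The boundary is $d_n(c)=\partial(c)+(-1)^n\delta(c)$, where $(\partial c)(\boldsymbol{\lambda})=\partial^{\lambda_0}(c(\boldsymbol{\lambda}))$ and, for $\boldsymbol{\lambda}\in\Lambda_s$, $(\delta c)(\boldsymbol{\lambda})=p_{\lambda_0\lambda_1}(c(d^0\boldsymbol{\lambda}))+\sum_{j=1}^s(-1)^jc(d^j\boldsymbol{\lambda})$ for $s\ge1$, and $(\delta c)(\boldsymbol{\lambda})=0$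 for $s=0$. Put $\bar{H}^\infty_*(\mathbf{C}_* )=H_*(T_*(\mathbf{C}_* ))$. **Polyhedral resolutions.** Let $\mathbf{X}=\{X_\lambda,p_{\lambda\lambda'},\Lambda\}$ be an inverse system of spaces over a directed set and $\mathbf{p}=(p_\lambda):X\to\mathbf{X}$ maps with $p_\lambda=p_{\lambda\lambda'}p_{\lambda'}$. Two maps $h,h'$ into $P$ are $\mathcal{V}$-near, for an open covering $\mathcal{V}$ of $P$, if each pair $h(x),h'(x)$ lies in a member of $\mathcal{V}$. $\mathbf{p}$ is a resolution of $X$ if for every polyhedron $P$ and open covering $\mathcal{V}$ of $P$: (R1) for every map $h:X\to P$ there are $\lambda$ and a map $h':X_\lambda\to P$ with $h'p_\lambda$ and $h$ $\mathcal{V}$-near; (R2) there is an open covering $\mathcal{V}'$ of $P$ such that whenever $h,h':X_\lambda\to P$ are maps with $hp_\lambda,h'p_\lambda$ $\mathcal{V}'$-near, then $hp_{\lambda\lambda'},h'p_{\lambda\lambda'}$ are $\mathcal{V}$-near for some $\lambda'\ge\lambda$. It is polyhedral if all $X_\lambda$ are polyhedra (with the CW topology). Every space has a polyhedral resolution. **The groups $\bar{H}^\infty_*(X;G)$.** For a polyhedral resolution $\mathbf{p}:X\to\mathbf{X}$ put $\mathbf{C}_*^N=\{\bar{C}_*^N(X_\lambda;G),p_{\lambda\lambda'},\Lambda\}$ and $\bar{H}^\infty_*(X;G)=\bar{H}^\infty_*(\mathbf{C}_*^N)=H_*(T_*(\mathbf{C}_*^N))$. *)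

theory Defs
  imports
    "HOL-Analysis.Analysis"
    "HOL-Algebra.FiniteProduct"
    "HOL-Algebra.Product_Groups"
    "HOL-Algebra.Elementary_Groups"
begin

text \<open>
  Abelian groups are multiplicative records (\<open>comm_group\<close>), so sums of the mathematical
  text appear as products.  All complexes are graded by \<^typ>\<open>int\<close>; cochain groups vanish in
  negative degrees, but the groups of the cone construction need not vanish in degree -1.

  Two notions below, injectivity and resolution, quantify over all abelian groups and over all
  polyhedra respectively.  As a formula cannot quantify over types, these test objects range over
  all those whose elements have type \<open>'u\<close>, and \<open>'u\<close> is an explicit type parameter.
  The notions do not depend on \<open>'u\<close> once it is large enough.  For injectivity, infinite
  suffices (Baer's criterion).  For polyhedral resolutions of a space \<open>X\<close> on a type \<open>'a\<close> it
  suffices that \<open>'a \<times> real\<close> injects into \<open>'u\<close>.  Indeed, (R1) for polyhedra with at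
  most \<open>max |'a| \<aleph>\<^sub>0\<close> vertices (nerves of partitions of unity on \<open>X\<close>) gives that each
  normal covering of \<open>X\<close> is refined by the preimage of a normal covering of some term, and
  (R2) for the unit interval gives that, for each normal covering of a term, the image of some
  later term lies in the star of the image of \<open>X\<close>.  These two properties imply (R1) and (R2)
  for all polyhedra.
\<close>

section \<open>Algebra\<close>

text \<open>A graded group with maps between consecutive degrees: \<open>diff C n\<close> is defined on
  \<open>grp C n\<close> and takes values in degree \<open>n - 1\<close> for a chain complex, and in
  degree \<open>n + 1\<close> for a cochain complex.\<close>

record 'a graded_complex =
  grp :: "int \<Rightarrow> 'a monoid"
  diff :: "int \<Rightarrow> 'a \<Rightarrow> 'a"

definition homology :: "'a graded_complex \<Rightarrow> int \<Rightarrow> 'a set monoid" where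
  "homology C n =
     (grp C n)\<lparr>carrier := kernel (grp C n) (grp C (n - 1)) (diff C n)\<rparr>
       Mod (diff C (n + 1) ` carrier (grp C (n + 1)))"

definition hom_group :: "'a monoid \<Rightarrow> 'b monoid \<Rightarrow> ('a \<Rightarrow> 'b) monoid" where
  "hom_group A B =
     \<lparr>carrier = hom A B \<inter> extensional (carrier A),
      monoid.mult = (\<lambda>f g. \<lambda>a\<in>carrier A. f a \<otimes>\<^bsub>B\<^esub> g a),
      one = (\<lambda>a\<in>carrier A. \<one>\<^bsub>B\<^esub>)\<rparr>"

definition injective_group :: "'u itself \<Rightarrow> 'i monoid \<Rightarrow> bool" where
  "injective_group _ I \<longleftrightarrow> comm_group I \<and>
     (\<forall>(A :: 'u monoid) (B :: 'u monoid) j f.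
        comm_group A \<and> comm_group B \<and> j \<in> mon A B \<and> f \<in> hom A I \<longrightarrow>
          (\<exists>g\<in>hom B I. \<forall>a\<in>carrier A. g (j a) = f a))"

definition injective_resolution ::
    "'u itself \<Rightarrow> 'g monoid \<Rightarrow> ('g \<Rightarrow> 'i) \<Rightarrow> 'i monoid \<Rightarrow> ('i \<Rightarrow> 'j) \<Rightarrow> 'j monoid \<Rightarrow> bool" where
  "injective_resolution U G \<iota> I0 \<beta> I1 \<longleftrightarrow>
     comm_group G \<and> injective_group U I0 \<and> injective_group U I1 \<and>
     \<iota> \<in> mon G I0 \<and> \<beta> \<in> epi I0 I1 \<and> \<iota> ` carrier G = kernel I0 I1 \<beta>"

definition cone_complex ::
    "'i monoid \<Rightarrow> 'j monoid \<Rightarrow> ('i \<Rightarrow> 'j) \<Rightarrow> 'c graded_complex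
       \<Rightarrow> (('c \<Rightarrow> 'i) \<times> ('c \<Rightarrow> 'j)) graded_complex" where
  "cone_complex I0 I1 \<beta> C =
     \<lparr>grp = (\<lambda>n. hom_group (grp C n) I0 \<times>\<times> hom_group (grp C (n + 1)) I1),
      diff = (\<lambda>n (\<phi>', \<phi>'').
        (\<lambda>x\<in>carrier (grp C (n - 1)). \<phi>' (diff C (n - 1) x),
         \<lambda>x\<in>carrier (grp C n). \<beta> (\<phi>' x) \<otimes>\<^bsub>I1\<^esub> inv\<^bsub>I1\<^esub> (\<phi>'' (diff C n x))))\<rparr>"

text \<open>The chain map from the cone of \<open>C'\<close> to the cone of \<open>C\<close> induced by a cochain map
  \<open>f\<close> from \<open>C\<close> to \<open>C'\<close>.\<close>

definition cone_map ::
    "'c graded_complex \<Rightarrow> (int \<Rightarrow> 'c \<Rightarrow> 'd) \<Rightarrow> int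
       \<Rightarrow> ('d \<Rightarrow> 'i) \<times> ('d \<Rightarrow> 'j) \<Rightarrow> ('c \<Rightarrow> 'i) \<times> ('c \<Rightarrow> 'j)" where
  "cone_map C f n = (\<lambda>(\<phi>', \<phi>'').
     (\<lambda>x\<in>carrier (grp C n). \<phi>' (f n x),
      \<lambda>x\<in>carrier (grp C (n + 1)). \<phi>'' (f (n + 1) x)))"

definition omit :: "nat \<Rightarrow> 'a list \<Rightarrow> 'a list" where
  "omit i xs = take i xs @ drop (Suc i) xs"

section \<open>Alexander-Spanier normal cochains\<close>

definition open_covering :: "'a topology \<Rightarrow> 'a set set \<Rightarrow> bool" where
  "open_covering X \<U> \<longleftrightarrow> (\<forall>U\<in>\<U>. openin X U) \<and> \<Union>\<U> = topspace X"

definition subordinate_partition_of_unity ::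
    "'a topology \<Rightarrow> 'a set set \<Rightarrow> ('a set \<Rightarrow> 'a \<Rightarrow> real) \<Rightarrow> bool" where
  "subordinate_partition_of_unity X \<U> \<psi> \<longleftrightarrow>
     (\<forall>U\<in>\<U>. continuous_map X euclideanreal (\<psi> U)) \<and>
     (\<forall>U\<in>\<U>. \<forall>x\<in>topspace X. 0 \<le> \<psi> U x) \<and>
     (\<forall>U\<in>\<U>. X closure_of {x \<in> topspace X. \<psi> U x \<noteq> 0} \<subseteq> U) \<and>
     (\<forall>x\<in>topspace X. \<exists>W. openin X W \<and> x \<in> W \<and> finite {U\<in>\<U>. \<exists>y\<in>W. \<psi> U y \<noteq> 0}) \<and>
     (\<forall>x\<in>topspace X. (\<Sum>U | U \<in> \<U> \<and> \<psi> U x \<noteq> 0. \<psi> U x) = 1)"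

definition normal_covering :: "'a topology \<Rightarrow> 'a set set \<Rightarrow> bool" where
  "normal_covering X \<U> \<longleftrightarrow>
     open_covering X \<U> \<and> (\<exists>\<psi>. subordinate_partition_of_unity X \<U> \<psi>)"

text \<open>There are no tuples in negative degrees; in particular the empty tuple is excluded, which
  would otherwise produce the augmented complex.\<close>

definition tuples :: "'a topology \<Rightarrow> int \<Rightarrow> 'a list set" where
  "tuples X n = {xs. xs \<noteq> [] \<and> int (length xs) = n + 1 \<and> set xs \<subseteq> topspace X}"

definition cochain_group :: "'a topology \<Rightarrow> int \<Rightarrow> ('a list \<Rightarrow> int) monoid" where
  "cochain_group X n = product_group (tuples X n) (\<lambda>_. integer_group)"

definition coboundary :: "'a topology \<Rightarrow> int \<Rightarrow> ('a list \<Rightarrow> int) \<Rightarrow> 'a list \<Rightarrow> int" where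
  "coboundary X n \<phi> =
     (\<lambda>xs\<in>tuples X (n + 1).
        if n < 0 then 0 else \<Sum>i<length xs. (-1) ^ i * \<phi> (omit i xs))"

definition locally_zero_cochains :: "'a topology \<Rightarrow> int \<Rightarrow> ('a list \<Rightarrow> int) set" where
  "locally_zero_cochains X n =
     {\<phi> \<in> carrier (cochain_group X n).
        \<exists>\<U>. normal_covering X \<U> \<and>
          (\<forall>xs\<in>tuples X n. (\<exists>U\<in>\<U>. set xs \<subseteq> U) \<longrightarrow> \<phi> xs = 0)}"

text \<open>A homomorphism \<open>h\<close> between cochain groups that preserves locally zero cochains induces on
  cosets \<open>c\<close> the map sending \<open>c\<close> to the coset that contains \<open>h ` c\<close>, that is, to the
  product of the subgroup of locally zero cochains and \<open>h ` c\<close>.\<close>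

definition normal_cochains :: "'a topology \<Rightarrow> ('a list \<Rightarrow> int) set graded_complex" where
  "normal_cochains X =
     \<lparr>grp = (\<lambda>n. cochain_group X n Mod locally_zero_cochains X n),
      diff = (\<lambda>n c. locally_zero_cochains X (n + 1)
                <#>\<^bsub>cochain_group X (n + 1)\<^esub> coboundary X n ` c)\<rparr>"

text \<open>The cochain map induced by a map \<open>f\<close> from \<open>X\<close>; it has values in the cochains of \<open>X\<close>.\<close>

definition normal_cochain_map ::
    "'a topology \<Rightarrow> ('a \<Rightarrow> 'b) \<Rightarrow> int \<Rightarrow> ('b list \<Rightarrow> int) set \<Rightarrow> ('a list \<Rightarrow> int) set" where
  "normal_cochain_map X f n c =
     locally_zero_cochains X n
       <#>\<^bsub>cochain_group X n\<^esub> (\<lambda>\<phi>. \<lambda>xs\<in>tuples X n. \<phi> (map f xs)) ` c"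

section \<open>Alexander-Spanier normal chains and homology\<close>

type_synonym ('a, 'i, 'j) normal_chain =
  "(('a list \<Rightarrow> int) set \<Rightarrow> 'i) \<times> (('a list \<Rightarrow> int) set \<Rightarrow> 'j)"

definition normal_chains ::
    "'i monoid \<Rightarrow> 'j monoid \<Rightarrow> ('i \<Rightarrow> 'j) \<Rightarrow> 'a topology
       \<Rightarrow> ('a, 'i, 'j) normal_chain graded_complex" where
  "normal_chains I0 I1 \<beta> X = cone_complex I0 I1 \<beta> (normal_cochains X)"

definition normal_chain_map ::
    "'a topology \<Rightarrow> 'b topology \<Rightarrow> ('a \<Rightarrow> 'b) \<Rightarrow> int
       \<Rightarrow> ('a, 'i, 'j) normal_chain \<Rightarrow> ('b, 'i, 'j) normal_chain" where
  "normal_chain_map X Y f = cone_map (normal_cochains Y) (normal_cochain_map X f)"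

definition normal_homology ::
    "'i monoid \<Rightarrow> 'j monoid \<Rightarrow> ('i \<Rightarrow> 'j) \<Rightarrow> 'a topology \<Rightarrow> int
       \<Rightarrow> ('a, 'i, 'j) normal_chain set monoid" where
  "normal_homology I0 I1 \<beta> X = homology (normal_chains I0 I1 \<beta> X)"

section \<open>Total complex of an inverse system of chain complexes\<close>

definition directed_set :: "'l set \<Rightarrow> ('l \<Rightarrow> 'l \<Rightarrow> bool) \<Rightarrow> bool" where
  "directed_set \<Lambda> leq \<longleftrightarrow> \<Lambda> \<noteq> {} \<and> reflp_on \<Lambda> leq \<and> transp_on \<Lambda> leq \<and>
     (\<forall>l\<in>\<Lambda>. \<forall>m\<in>\<Lambda>. \<exists>k\<in>\<Lambda>. leq l k \<and> leq m k)"

definition multiindices :: "'l set \<Rightarrow> ('l \<Rightarrow> 'l \<Rightarrow> bool) \<Rightarrow> 'l list set" where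
  "multiindices \<Lambda> leq = {ls. ls \<noteq> [] \<and> set ls \<subseteq> \<Lambda> \<and> successively leq ls}"

abbreviation level :: "'l list \<Rightarrow> int" where
  "level ls \<equiv> int (length ls) - 1"

definition signed :: "'c monoid \<Rightarrow> int \<Rightarrow> 'c \<Rightarrow> 'c" where
  "signed D k x = (if even k then x else inv\<^bsub>D\<^esub> x)"

definition total_group ::
    "'l set \<Rightarrow> ('l \<Rightarrow> 'l \<Rightarrow> bool) \<Rightarrow> ('l \<Rightarrow> 'c graded_complex) \<Rightarrow> int \<Rightarrow> ('l list \<Rightarrow> 'c) monoid" where
  "total_group \<Lambda> leq C n =
     product_group (multiindices \<Lambda> leq) (\<lambda>ls. grp (C (hd ls)) (n + level ls))"

text \<open>The component \<open>(\<delta> c)(ls)\<close>, for \<open>c\<close> of degree \<open>n\<close>; it lies in degree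
  \<open>n + level ls - 1\<close> of \<open>C (hd ls)\<close>.  The argument \<open>p l m\<close> is the bonding map from
  \<open>C m\<close> to \<open>C l\<close>.\<close>

definition total_delta ::
    "('l \<Rightarrow> 'c graded_complex) \<Rightarrow> ('l \<Rightarrow> 'l \<Rightarrow> int \<Rightarrow> 'c \<Rightarrow> 'c) \<Rightarrow> int
       \<Rightarrow> ('l list \<Rightarrow> 'c) \<Rightarrow> 'l list \<Rightarrow> 'c" where
  "total_delta C p n c ls =
     (let D = grp (C (hd ls)) (n + level ls - 1) in
      if level ls = 0 then \<one>\<^bsub>D\<^esub>
      else p (ls ! 0) (ls ! 1) (n + level ls - 1) (c (omit 0 ls))
             \<otimes>\<^bsub>D\<^esub> (\<Otimes>\<^bsub>D\<^esub>j\<in>{1..<length ls}. signed D (int j) (c (omit j ls))))"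

definition total_complex ::
    "'l set \<Rightarrow> ('l \<Rightarrow> 'l \<Rightarrow> bool) \<Rightarrow> ('l \<Rightarrow> 'c graded_complex)
       \<Rightarrow> ('l \<Rightarrow> 'l \<Rightarrow> int \<Rightarrow> 'c \<Rightarrow> 'c) \<Rightarrow> ('l list \<Rightarrow> 'c) graded_complex" where
  "total_complex \<Lambda> leq C p =
     \<lparr>grp = total_group \<Lambda> leq C,
      diff = (\<lambda>n c. \<lambda>ls\<in>multiindices \<Lambda> leq.
        let D = grp (C (hd ls)) (n + level ls - 1) in
        diff (C (hd ls)) (n + level ls) (c ls) \<otimes>\<^bsub>D\<^esub> signed D n (total_delta C p n c ls))\<rparr>"

section \<open>Polyhedra\<close>

definition abstract_complex :: "'v set set \<Rightarrow> bool" where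
  "abstract_complex K \<longleftrightarrow>
     (\<forall>\<sigma>\<in>K. finite \<sigma> \<and> \<sigma> \<noteq> {}) \<and> (\<forall>\<sigma>\<in>K. \<forall>\<tau>. \<tau> \<subseteq> \<sigma> \<and> \<tau> \<noteq> {} \<longrightarrow> \<tau> \<in> K)"

text \<open>The closed simplex with vertex set \<open>\<sigma>\<close>, in barycentric coordinates.\<close>

definition closed_simplex :: "'v set \<Rightarrow> ('v \<Rightarrow> real) set" where
  "closed_simplex \<sigma> = {t. (\<forall>v. 0 \<le> t v) \<and> (\<forall>v. v \<notin> \<sigma> \<longrightarrow> t v = 0) \<and> (\<Sum>v\<in>\<sigma>. t v) = 1}"

text \<open>The CW (weak) topology: a set is open iff it meets each closed simplex in a relatively open
  set.  A closed simplex has only finitely many nonzero coordinates, so the product topology of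
  \<open>'v \<Rightarrow> real\<close> induces its Euclidean topology.\<close>

definition realization_open :: "'v set set \<Rightarrow> ('v \<Rightarrow> real) set \<Rightarrow> bool" where
  "realization_open K W \<longleftrightarrow> W \<subseteq> (\<Union>\<sigma>\<in>K. closed_simplex \<sigma>) \<and>
     (\<forall>\<sigma>\<in>K. openin (top_of_set (closed_simplex \<sigma>)) (closed_simplex \<sigma> \<inter> W))"

definition realization :: "'v set set \<Rightarrow> ('v \<Rightarrow> real) topology" where
  "realization K = topology (realization_open K)"

lemma istopology_realization_open: "istopology (realization_open K)"
  unfolding istopology_def
proof (intro conjI allI impI)
  fix S T assume S: "realization_open K S" and T: "realization_open K T"
  have "closed_simplex \<sigma> \<inter> (S \<inter> T) = (closed_simplex \<sigma> \<inter> S) \<inter> (closed_simplex \<sigma> \<inter> T)" for \<sigma>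
    by blast
  then show "realization_open K (S \<inter> T)"
    using S T unfolding realization_open_def by (auto intro: openin_Int)
next
  fix \<W> assume W: "\<forall>W\<in>\<W>. realization_open K W"
  have "openin (top_of_set (closed_simplex \<sigma>)) (closed_simplex \<sigma> \<inter> \<Union>\<W>)" if "\<sigma> \<in> K" for \<sigma>
  proof -
    have "closed_simplex \<sigma> \<inter> \<Union>\<W> = \<Union>((\<lambda>W. closed_simplex \<sigma> \<inter> W) ` \<W>)"
      by blast
    moreover have "openin (top_of_set (closed_simplex \<sigma>)) (\<Union>((\<lambda>W. closed_simplex \<sigma> \<inter> W) ` \<W>))"
      using W that unfolding realization_open_def by (intro openin_Union) auto
    ultimately show ?thesis by simp
  qed
  then show "realization_open K (\<Union>\<W>)"
    using W unfolding realization_open_def by blast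
qed

lemma openin_realization: "openin (realization K) W \<longleftrightarrow> realization_open K W"
  unfolding realization_def by (simp add: istopology_realization_open topology_inverse')

lemma topspace_realization: "topspace (realization K) = (\<Union>\<sigma>\<in>K. closed_simplex \<sigma>)"
proof -
  have "realization_open K (\<Union>\<sigma>\<in>K. closed_simplex \<sigma>)"
    unfolding realization_open_def
    by (metis Int_absorb2 SUP_upper openin_subtopology_self order_refl)
  then show ?thesis
    by (metis openin_realization openin_subset openin_topspace realization_open_def
        subset_antisym)
qed

text \<open>Taking the vertices from the type of the points is no restriction, because the vertices of a
  triangulated space can be identified with points of the space.\<close>

definition polyhedral_space :: "'q topology \<Rightarrow> bool" where
  "polyhedral_space P \<longleftrightarrow>
     (\<exists>K :: 'q set set. abstract_complex K \<and> P homeomorphic_space realization K)"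

section \<open>Polyhedral resolutions\<close>

text \<open>In the following, \<open>p l m\<close> is the bonding map from \<open>Y m\<close> to \<open>Y l\<close>.\<close>

definition inverse_system_of_spaces ::
    "'l set \<Rightarrow> ('l \<Rightarrow> 'l \<Rightarrow> bool) \<Rightarrow> ('l \<Rightarrow> 'b topology) \<Rightarrow> ('l \<Rightarrow> 'l \<Rightarrow> 'b \<Rightarrow> 'b) \<Rightarrow> bool" where
  "inverse_system_of_spaces \<Lambda> leq Y p \<longleftrightarrow> directed_set \<Lambda> leq \<and>
     (\<forall>l\<in>\<Lambda>. \<forall>m\<in>\<Lambda>. leq l m \<longrightarrow> continuous_map (Y m) (Y l) (p l m)) \<and>
     (\<forall>l\<in>\<Lambda>. \<forall>y\<in>topspace (Y l). p l l y = y) \<and>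
     (\<forall>k\<in>\<Lambda>. \<forall>l\<in>\<Lambda>. \<forall>m\<in>\<Lambda>. leq k l \<and> leq l m \<longrightarrow>
        (\<forall>y\<in>topspace (Y m). p k l (p l m y) = p k m y))"

definition maps_to_system ::
    "'l set \<Rightarrow> ('l \<Rightarrow> 'l \<Rightarrow> bool) \<Rightarrow> ('l \<Rightarrow> 'b topology) \<Rightarrow> ('l \<Rightarrow> 'l \<Rightarrow> 'b \<Rightarrow> 'b)
       \<Rightarrow> 'a topology \<Rightarrow> ('l \<Rightarrow> 'a \<Rightarrow> 'b) \<Rightarrow> bool" where
  "maps_to_system \<Lambda> leq Y p X q \<longleftrightarrow>
     (\<forall>l\<in>\<Lambda>. continuous_map X (Y l) (q l)) \<and>
     (\<forall>l\<in>\<Lambda>. \<forall>m\<in>\<Lambda>. leq l m \<longrightarrow> (\<forall>x\<in>topspace X. q l x = p l m (q m x)))"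

definition near :: "'a topology \<Rightarrow> 'b set set \<Rightarrow> ('a \<Rightarrow> 'b) \<Rightarrow> ('a \<Rightarrow> 'b) \<Rightarrow> bool" where
  "near X \<V> h h' \<longleftrightarrow> (\<forall>x\<in>topspace X. \<exists>V\<in>\<V>. h x \<in> V \<and> h' x \<in> V)"

definition resolution ::
    "'u itself \<Rightarrow> 'l set \<Rightarrow> ('l \<Rightarrow> 'l \<Rightarrow> bool) \<Rightarrow> ('l \<Rightarrow> 'b topology) \<Rightarrow> ('l \<Rightarrow> 'l \<Rightarrow> 'b \<Rightarrow> 'b)
       \<Rightarrow> 'a topology \<Rightarrow> ('l \<Rightarrow> 'a \<Rightarrow> 'b) \<Rightarrow> bool" where
  "resolution _ \<Lambda> leq Y p X q \<longleftrightarrow>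
     inverse_system_of_spaces \<Lambda> leq Y p \<and> maps_to_system \<Lambda> leq Y p X q \<and>
     (\<forall>(P :: 'u topology) \<V>. polyhedral_space P \<and> open_covering P \<V> \<longrightarrow>
        (\<forall>h. continuous_map X P h \<longrightarrow>
           (\<exists>l\<in>\<Lambda>. \<exists>h'. continuous_map (Y l) P h' \<and> near X \<V> (h' \<circ> q l) h)) \<and>
        (\<exists>\<V>'. open_covering P \<V>' \<and>
           (\<forall>l\<in>\<Lambda>. \<forall>h h'. continuous_map (Y l) P h \<and> continuous_map (Y l) P h' \<and>
              near X \<V>' (h \<circ> q l) (h' \<circ> q l) \<longrightarrow>
                (\<exists>m\<in>\<Lambda>. leq l m \<and> near (Y m) \<V> (h \<circ> p l m) (h' \<circ> p l m)))))"

definition polyhedral_resolution ::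
    "'u itself \<Rightarrow> 'l set \<Rightarrow> ('l \<Rightarrow> 'l \<Rightarrow> bool) \<Rightarrow> ('l \<Rightarrow> 'b topology) \<Rightarrow> ('l \<Rightarrow> 'l \<Rightarrow> 'b \<Rightarrow> 'b)
       \<Rightarrow> 'a topology \<Rightarrow> ('l \<Rightarrow> 'a \<Rightarrow> 'b) \<Rightarrow> bool" where
  "polyhedral_resolution U \<Lambda> leq Y p X q \<longleftrightarrow>
     resolution U \<Lambda> leq Y p X q \<and> (\<forall>l\<in>\<Lambda>. polyhedral_space (Y l))"

definition resolution_homology ::
    "'i monoid \<Rightarrow> 'j monoid \<Rightarrow> ('i \<Rightarrow> 'j) \<Rightarrow> 'l set \<Rightarrow> ('l \<Rightarrow> 'l \<Rightarrow> bool) \<Rightarrow> ('l \<Rightarrow> 'b topology)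
       \<Rightarrow> ('l \<Rightarrow> 'l \<Rightarrow> 'b \<Rightarrow> 'b) \<Rightarrow> int \<Rightarrow> ('l list \<Rightarrow> ('b, 'i, 'j) normal_chain) set monoid" where
  "resolution_homology I0 I1 \<beta> \<Lambda> leq Y p =
     homology (total_complex \<Lambda> leq
       (\<lambda>l. normal_chains I0 I1 \<beta> (Y l))
       (\<lambda>l m. normal_chain_map (Y m) (Y l) (p l m)))"

end

theory Submission
  imports Defs "HOL-Library.Poly_Mapping" "HOL-Library.Function_Algebras"
begin

text \<open>
  Let \<open>A\<close> be the cochain complex of \<open>X\<close> and \<open>B\<close> the direct sum, over all multiindices \<open>ls\<close>, of the
  cochain complexes of the terms \<open>hd ls\<close>, with the simplicial differential of a homotopy colimit.  The
  total complex of the cones is the cone construction applied to \<open>B\<close>, and the maps from \<open>X\<close> to the terms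
  give a cochain map from \<open>B\<close> to \<open>A\<close>.  Its mapping cone is exact: appending an upper bound to all
  multiindices contracts \<open>B\<close> onto a single late term, and the cohomology of \<open>A\<close> is the direct limit of
  the cohomologies of the terms.  As homomorphisms into divisible groups extend, the cone construction
  preserves exactness, so the induced chain map is an isomorphism in homology.

  Continuity of the cohomology under resolutions needs no nerves.  The sets containing
  \<open>U \<times> U\<close> for all members \<open>U\<close> of a normal covering form a uniformity.  By (R1) for full simplices, each such
  set for \<open>X\<close> contains the preimage of one for some term; by (R2) for the interval, late terms lie near the image
  of \<open>X\<close>.  Choosing nearby points gives a map from a late term to \<open>X\<close>, which need not be continuous
  because cochains are arbitrary functions: composites of it with the given maps are close to the given maps, and
  the prism operator provides the chain homotopies.
\<close>

section \<open>Homotopy colimits of cochain complexes\<close>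

text \<open>The total complex is a product over all multiindices, and in general no index of
  \<open>\<Lambda>\<close> bounds all of them, so appending an upper bound makes no sense there. An
  element of the direct sum has finite support, and finitely many indices do have a common bound.
  Hence exactness is proved on the cochain side, with a bound that depends on the element, and only
  then dualized.

  Dualizing means extending homomorphisms from groups such as
  \<open>'x \<times> ('l list \<Rightarrow>\<^sub>0 'y)\<close>, whereas injectivity of
  \<open>I0\<close> and \<open>I1\<close> speaks of test groups on \<open>'u\<close>. Divisibility
  is the form of injectivity that mentions no type: it follows from a copy of the integers in
  \<open>'u\<close> and gives extensions from abelian groups of every type.

  The embedding of \<open>'a \<times> real\<close> into \<open>'u\<close> enters twice more: it
  names the members of a locally finite family on \<open>X\<close> by a point and a natural number,
  and it makes room in \<open>'u\<close> for a copy of the full simplex with vertex set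
  \<open>'u\<close>, to which both (R1) and (R2) are applied.\<close>

definition sign_pow :: "int \<Rightarrow> 'w::ab_group_add \<Rightarrow> 'w" where
  "sign_pow k w = (if even k then w else - w)"

lemma additive_sign_pow: "Modules.additive (sign_pow k)"
  by unfold_locales (simp add: sign_pow_def)

lemma additive_compose: "Modules.additive f \<Longrightarrow> Modules.additive g \<Longrightarrow> Modules.additive (\<lambda>x. f (g x))"
  by (simp add: Modules.additive_def)

lemma additive_plus: "Modules.additive f \<Longrightarrow> Modules.additive g \<Longrightarrow> Modules.additive (\<lambda>x. f x + g x)"
  by (simp add: Modules.additive_def algebra_simps)

lemma additive_zero: "Modules.additive (\<lambda>x. 0)"
  by (simp add: Modules.additive_def)

lemma additive_if: "(P \<Longrightarrow> Modules.additive f) \<Longrightarrow> (\<not> P \<Longrightarrow> Modules.additive g) \<Longrightarrow>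
    Modules.additive (\<lambda>y. if P then f y else g y)"
  by (cases P) auto

definition add_subgroup :: "'w::ab_group_add set \<Rightarrow> bool" where
  "add_subgroup S \<longleftrightarrow> 0 \<in> S \<and> (\<forall>x\<in>S. \<forall>y\<in>S. x - y \<in> S)"

lemma add_subgroup_zero: "add_subgroup S \<Longrightarrow> 0 \<in> S"
  and add_subgroup_diff: "add_subgroup S \<Longrightarrow> x \<in> S \<Longrightarrow> y \<in> S \<Longrightarrow> x - y \<in> S"
  by (auto simp: add_subgroup_def)

lemma add_subgroup_uminus: "add_subgroup S \<Longrightarrow> x \<in> S \<Longrightarrow> - x \<in> S"
  using add_subgroup_diff[of S 0 x] add_subgroup_zero by auto

lemma add_subgroup_add: "add_subgroup S \<Longrightarrow> x \<in> S \<Longrightarrow> y \<in> S \<Longrightarrow> x + y \<in> S"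
  using add_subgroup_diff[of S x "- y"] add_subgroup_uminus by auto

lemma add_subgroup_sign_pow: "add_subgroup S \<Longrightarrow> x \<in> S \<Longrightarrow> sign_pow k x \<in> S"
  by (auto simp: sign_pow_def add_subgroup_uminus)

lemma add_subgroup_sum: "add_subgroup S \<Longrightarrow> (\<And>i. i \<in> A \<Longrightarrow> f i \<in> S) \<Longrightarrow> sum f A \<in> S"
  by (induction A rule: infinite_finite_induct) (auto simp: add_subgroup_zero add_subgroup_add)

lemma add_subgroup_cong: "add_subgroup S \<Longrightarrow> x - y \<in> S \<Longrightarrow> x \<in> S \<longleftrightarrow> y \<in> S"
  using add_subgroup_diff[of S x "x - y"] add_subgroup_add[of S "x - y" y] by auto

text \<open>The simplicial coboundary, in recursive form: the face without the first entry is split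
  off, and the remaining faces keep that entry. This makes the identities below plain list
  inductions; \<open>alt_sum_eq_sum\<close> recovers the usual sum.\<close>

fun alt_sum :: "('a list \<Rightarrow> 'w::ab_group_add) \<Rightarrow> 'a list \<Rightarrow> 'w" where
  "alt_sum \<phi> [] = 0"
| "alt_sum \<phi> (x # xs) = \<phi> xs - alt_sum (\<lambda>ys. \<phi> (x # ys)) xs"

lemma omit_0_Cons [simp]: "omit 0 (x # xs) = xs"
  and omit_Suc_Cons [simp]: "omit (Suc i) (x # xs) = x # omit i xs"
  by (simp_all add: omit_def)

lemma length_omit [simp]: "i < length xs \<Longrightarrow> length (omit i xs) = length xs - 1"
  by (simp add: omit_def)

lemma set_omit: "set (omit i xs) \<subseteq> set xs"
  unfolding omit_def by (auto dest: in_set_takeD in_set_dropD)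

lemma alt_sum_eq_sum: "alt_sum \<phi> xs = (\<Sum>i<length xs. sign_pow (int i) (\<phi> (omit i xs)))"
proof (induction \<phi> xs rule: alt_sum.induct)
  case (2 \<phi> x xs)
  have "(\<Sum>i<length (x # xs). sign_pow (int i) (\<phi> (omit i (x # xs))))
     = sign_pow 0 (\<phi> xs) + (\<Sum>i<length xs. sign_pow (int i + 1) (\<phi> (x # omit i xs)))"
    by (simp add: sum.lessThan_Suc_shift add.commute del: sum.lessThan_Suc)
  also have "(\<Sum>i<length xs. sign_pow (int i + 1) (\<phi> (x # omit i xs))) = - (\<Sum>i<length xs. sign_pow (int i) (\<phi> (x # omit i xs)))"
    unfolding sum_negf[symmetric] by (rule sum.cong) (auto simp: sign_pow_def)
  finally show ?case using 2 by (simp add: sign_pow_def)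
qed simp

lemma alt_sum_cong:
  "(\<And>i. i < length xs \<Longrightarrow> \<phi> (omit i xs) = \<psi> (omit i xs)) \<Longrightarrow> alt_sum \<phi> xs = alt_sum \<psi> xs"
  unfolding alt_sum_eq_sum by (auto intro!: sum.cong)

lemma alt_sum_in_subgroup:
  "add_subgroup S \<Longrightarrow> (\<And>i. i < length xs \<Longrightarrow> \<phi> (omit i xs) \<in> S) \<Longrightarrow> alt_sum \<phi> xs \<in> S"
  unfolding alt_sum_eq_sum by (auto intro!: add_subgroup_sum add_subgroup_sign_pow)

lemma alt_sum_additive: "Modules.additive h \<Longrightarrow> alt_sum (\<lambda>u. h (\<phi> u)) xs = h (alt_sum \<phi> xs)"
  by (induction \<phi> xs rule: alt_sum.induct) (auto simp: additive.zero additive.diff)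

lemma alt_sum_zero: "alt_sum (\<lambda>u. 0) xs = 0"
  by (induction xs) auto

lemma alt_sum_add: "alt_sum (\<lambda>u. \<phi> u + \<psi> u) xs = alt_sum \<phi> xs + alt_sum \<psi> xs"
  by (simp add: alt_sum_eq_sum sum.distrib additive.add[OF additive_sign_pow])

lemma alt_sum_diff: "alt_sum (\<lambda>u. \<phi> u - \<psi> u) xs = alt_sum \<phi> xs - alt_sum \<psi> xs"
  by (simp add: alt_sum_eq_sum sum_subtractf additive.diff[OF additive_sign_pow])

text \<open>On \<open>x # xs\<close> the two copies of \<open>alt_sum \<phi> xs\<close> cancel, and
  what is left is the induction hypothesis for \<open>\<lambda>ys. \<phi> (x # ys)\<close>.\<close>

lemma alt_sum_alt: "alt_sum (alt_sum \<phi>) xs = 0"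
  by (induction \<phi> xs rule: alt_sum.induct) (auto simp: alt_sum_diff)

text \<open>Only the last face is not of the form \<open>u @ [m]\<close>. This is the source of the
  contraction that appends an index.\<close>

lemma alt_sum_snoc: "alt_sum \<phi> (xs @ [m]) = alt_sum (\<lambda>u. \<phi> (u @ [m])) xs + sign_pow (int (length xs)) (\<phi> xs)"
  by (induction \<phi> xs rule: alt_sum.induct) (auto simp: sign_pow_def)

section \<open>Direct sums as groups of finitely supported functions\<close>

abbreviation single :: "'k \<Rightarrow> 'v \<Rightarrow> ('k \<Rightarrow>\<^sub>0 'v::zero)" where
  "single \<equiv> Poly_Mapping.single"

text \<open>The universal property of the direct sum: a family of additive maps \<open>f k\<close>
  on the summands induces one map on the sum.\<close>

definition lin_ext :: "('k \<Rightarrow> 'v \<Rightarrow> 'w) \<Rightarrow> ('k \<Rightarrow>\<^sub>0 'v::zero) \<Rightarrow> 'w::comm_monoid_add" where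
  "lin_ext f b = (\<Sum>k\<in>Poly_Mapping.keys b. f k (Poly_Mapping.lookup b k))"

lemma lin_ext_superset:
  assumes "finite K" "Poly_Mapping.keys b \<subseteq> K" "\<And>k. Modules.additive (f k)"
  shows "lin_ext f b = (\<Sum>k\<in>K. f k (Poly_Mapping.lookup b k))"
  unfolding lin_ext_def using assms
  by (intro sum.mono_neutral_left) (auto simp: in_keys_iff additive.zero)

lemma additive_lin_ext:
  assumes "\<And>k. Modules.additive (f k)"
  shows "Modules.additive (lin_ext f)"
proof
  fix a b :: "'a \<Rightarrow>\<^sub>0 'b"
  let ?K = "Poly_Mapping.keys a \<union> Poly_Mapping.keys b"
  have "lin_ext f (a + b) = (\<Sum>k\<in>?K. f k (Poly_Mapping.lookup (a + b) k))"
    by (rule lin_ext_superset) (use assms Poly_Mapping.keys_add[of a b] in auto)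
  also have "\<dots> = (\<Sum>k\<in>?K. f k (Poly_Mapping.lookup a k)) + (\<Sum>k\<in>?K. f k (Poly_Mapping.lookup b k))"
    by (simp add: lookup_add additive.add[OF assms] sum.distrib)
  also have "\<dots> = lin_ext f a + lin_ext f b"
    by (subst (1 2) lin_ext_superset[where K = ?K]) (use assms in auto)
  finally show "lin_ext f (a + b) = lin_ext f a + lin_ext f b" .
qed

lemma lin_ext_single: "Modules.additive (f k) \<Longrightarrow> lin_ext f (single k v) = f k v"
  by (cases "v = 0") (simp_all add: lin_ext_def additive.zero)

lemma poly_mapping_eq_sum_single: "b = (\<Sum>k\<in>Poly_Mapping.keys b. single k (Poly_Mapping.lookup b k))"
proof (rule poly_mapping_eqI)
  fix k
  have "Poly_Mapping.lookup (\<Sum>k\<in>Poly_Mapping.keys b. single k (Poly_Mapping.lookup b k)) k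
    = (\<Sum>j\<in>Poly_Mapping.keys b. if j = k then Poly_Mapping.lookup b j else 0)"
    unfolding lookup_sum by (rule sum.cong) (auto simp: lookup_single)
  also have "\<dots> = Poly_Mapping.lookup b k"
    by (auto simp: in_keys_iff)
  finally show "Poly_Mapping.lookup b k = Poly_Mapping.lookup (\<Sum>k\<in>Poly_Mapping.keys b. single k (Poly_Mapping.lookup b k)) k"
    by simp
qed

lemma additive_apply_keys:
  assumes "Modules.additive F"
  shows "F b = (\<Sum>k\<in>Poly_Mapping.keys b. F (single k (Poly_Mapping.lookup b k)))"
  by (subst poly_mapping_eq_sum_single[of b], subst additive.sum[OF assms]) simp

text \<open>Comparison on the keys of \<open>b\<close> alone matters for the contraction, where the
  appended index bounds only the multiindices that occur in \<open>b\<close>.\<close>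

lemma additive_eq_on_keys:
  assumes "Modules.additive F" "Modules.additive G"
    and "\<And>k v. k \<in> Poly_Mapping.keys b \<Longrightarrow> F (single k v) = G (single k v)"
  shows "F b = G b"
  unfolding additive_apply_keys[OF assms(1), of b] additive_apply_keys[OF assms(2), of b]
  by (rule sum.cong) (use assms(3) in auto)

lemma additive_single: "Modules.additive (single k)"
  by unfold_locales (simp add: single_add)

text \<open>Dual of the operator \<delta> of the total complex. Omitting entry 0 changes the term in
  which the value lives, so the value is transported to the new head; all other faces keep the head.
  The value 0 on singletons excludes the augmentation.\<close>

definition twisted_alt_sum :: "('l \<Rightarrow> 'l \<Rightarrow> 'y \<Rightarrow> 'y) \<Rightarrow> ('l list \<Rightarrow> 'y \<Rightarrow> 'w::ab_group_add) \<Rightarrow> 'l list \<Rightarrow> 'y \<Rightarrow> 'w" where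
  "twisted_alt_sum p c ls y = (if length ls \<le> 1 then 0
     else c (tl ls) (p (hd ls) (hd (tl ls)) y) - alt_sum (\<lambda>u. c (hd ls # u) y) (tl ls))"

lemma twisted_alt_sum_Nil [simp]: "twisted_alt_sum p c [] y = 0"
  and twisted_alt_sum_single [simp]: "twisted_alt_sum p c [l] y = 0"
  and twisted_alt_sum_Cons [simp]: "twisted_alt_sum p c (l # m # t) y = c (m # t) (p l m y) - alt_sum (\<lambda>u. c (l # u) y) (m # t)"
  by (simp_all add: twisted_alt_sum_def del: alt_sum.simps)

text \<open>For a singleton \<open>ls\<close> the convention that the twisted sum vanishes loses the
  face \<open>[m]\<close> of \<open>ls @ [m]\<close>, which the last summand restores. This
  correction is what later survives of the contraction: the transport to the term
  \<open>m\<close>.\<close>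

lemma twisted_alt_sum_snoc:
  assumes "ls \<noteq> []"
  shows "twisted_alt_sum p c (ls @ [m]) y = twisted_alt_sum p (\<lambda>u. c (u @ [m])) ls y + sign_pow (int (length ls)) (c ls y)
     + (if length ls = 1 then c [m] (p (hd ls) m y) else 0)"
proof -
  obtain l t where ls: "ls = l # t" using assms by (cases ls) auto
  show ?thesis
  proof (cases t)
    case Nil then show ?thesis by (simp add: ls sign_pow_def)
  next
    case (Cons k t')
    have "alt_sum (\<lambda>u. c (l # u) y) ((k # t') @ [m]) = alt_sum (\<lambda>u. c (l # u @ [m]) y) (k # t') + sign_pow (int (length (k # t'))) (c (l # k # t') y)"
      by (rule alt_sum_snoc)
    then show ?thesis unfolding ls Cons
      by (simp del: alt_sum.simps add: algebra_simps) (simp add: sign_pow_def)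
  qed
qed

lemma twisted_alt_sum_additive: "Modules.additive h \<Longrightarrow> twisted_alt_sum p (\<lambda>u v. h (c u v)) ls y = h (twisted_alt_sum p c ls y)"
  unfolding twisted_alt_sum_def by (auto simp: additive.zero additive.diff alt_sum_additive[of h "\<lambda>u. c (hd ls # u) y"])

text \<open>By transitivity, comparing neighbours compares all pairs. The sorted form is stable
  under omitting an inner entry.\<close>

lemma multiindices_eq:
  assumes "directed_set \<Lambda> leq"
  shows "multiindices \<Lambda> leq = {ls. ls \<noteq> [] \<and> set ls \<subseteq> \<Lambda> \<and> sorted_wrt leq ls}"
proof -
  have tr: "transp_on \<Lambda> leq" using assms by (simp add: directed_set_def)
  have "successively leq ls \<longleftrightarrow> sorted_wrt leq ls" if "set ls \<subseteq> \<Lambda>" for ls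
    using that tr by (intro successively_iff_sorted_wrt_strong) (auto dest: transp_onD)
  then show ?thesis unfolding multiindices_def by blast
qed

lemma omit_multiindices:
  assumes "directed_set \<Lambda> leq" "ls \<in> multiindices \<Lambda> leq" "length ls \<ge> 2" "i < length ls"
  shows "omit i ls \<in> multiindices \<Lambda> leq"
proof -
  have "sorted_wrt leq (take i ls @ drop i ls)" using assms by (simp add: multiindices_eq)
  then have 1: "sorted_wrt leq (take i ls)" "sorted_wrt leq (drop i ls)"
     "\<forall>x\<in>set (take i ls). \<forall>y\<in>set (drop i ls). leq x y"
    unfolding sorted_wrt_append by auto
  have "drop (Suc i) ls = drop 1 (drop i ls)" by simp
  then have "sorted_wrt leq (drop (Suc i) ls)" "set (drop (Suc i) ls) \<subseteq> set (drop i ls)"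
    using 1(2) sorted_wrt_drop set_drop_subset by metis+
  with 1 have "sorted_wrt leq (omit i ls)" by (auto simp: omit_def sorted_wrt_append)
  moreover have "omit i ls \<noteq> []" using assms(3,4) length_omit[of i ls] by fastforce
  moreover have "set (omit i ls) \<subseteq> \<Lambda>" using set_omit[of i ls] assms by (auto simp: multiindices_eq)
  ultimately show ?thesis using assms by (simp add: multiindices_eq)
qed

lemma twisted_alt_sum_cong:
  assumes "directed_set \<Lambda> leq" "ls \<in> multiindices \<Lambda> leq"
    and eq: "\<And>u v. u \<in> multiindices \<Lambda> leq \<Longrightarrow> length u + 1 = length ls \<Longrightarrow> c u v = c' u v"
  shows "twisted_alt_sum p c ls y = twisted_alt_sum p c' ls y"
proof (cases "length ls \<le> 1")
  case False
  then obtain l m t where ls: "ls = l # m # t"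
    by (cases ls; cases "tl ls") auto
  have o: "omit i ls \<in> multiindices \<Lambda> leq" "length (omit i ls) + 1 = length ls" if "i < length ls" for i
    using omit_multiindices[OF assms(1,2) _ that] that False by auto
  have "c (m # t) z = c' (m # t) z" for z using eq o[of 0] by (simp add: ls)
  moreover have "alt_sum (\<lambda>u. c (l # u) y) (m # t) = alt_sum (\<lambda>u. c' (l # u) y) (m # t)"
    by (rule alt_sum_cong) (use eq o[of "Suc _"] in \<open>simp add: ls\<close>)
  ultimately show ?thesis by (simp add: ls del: alt_sum.simps)
qed (simp add: twisted_alt_sum_def)

text \<open>The only pairs of faces not settled by \<open>alt_sum_alt\<close> involve the twist.
  Omitting the first two entries in the two possible orders transports along \<open>p k l\<close>
  and \<open>p l m\<close>, or directly along \<open>p k m\<close>; functoriality of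
  \<open>p\<close> makes them cancel.\<close>

lemma twisted_alt_sum_twisted_alt_sum:
  assumes "directed_set \<Lambda> leq" "ls \<in> multiindices \<Lambda> leq"
    and fn: "\<And>k l m y. \<lbrakk>k \<in> \<Lambda>; l \<in> \<Lambda>; m \<in> \<Lambda>; leq k l; leq l m\<rbrakk> \<Longrightarrow> p l m (p k l y) = p k m y"
  shows "twisted_alt_sum p (twisted_alt_sum p c) ls y = 0"
proof (cases "length ls \<le> 2")
  case True
  then consider "ls = []" | l where "ls = [l]" | l m where "ls = [l, m]"
    by (cases ls; cases "tl ls"; cases "tl (tl ls)") auto
  then show ?thesis by cases auto
next
  case False
  then obtain k l m t where ls: "ls = k # l # m # t"
    by (cases ls; cases "tl ls"; cases "tl (tl ls)") auto
  have f: "p l m (p k l y) = p k m y"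
    by (rule fn) (use assms(2) in \<open>auto simp: ls multiindices_eq[OF assms(1)]\<close>)
  have i: "twisted_alt_sum p c (k # l # u) y = c (l # u) (p k l y) - (c (k # u) y - alt_sum (\<lambda>v. c (k # l # v) y) u)" for u
    by simp
  have "alt_sum (\<lambda>u. twisted_alt_sum p c (k # u) y) (l # m # t) = twisted_alt_sum p c (k # m # t) y - alt_sum (\<lambda>u. twisted_alt_sum p c (k # l # u) y) (m # t)"
    by simp
  also have "alt_sum (\<lambda>u. twisted_alt_sum p c (k # l # u) y) (m # t) = alt_sum (\<lambda>u. c (l # u) (p k l y)) (m # t) - alt_sum (\<lambda>u. c (k # u) y) (m # t)"
    unfolding i alt_sum_diff using alt_sum_alt[of "\<lambda>v. c (k # l # v) y" "m # t"] by (simp del: alt_sum.simps)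
  finally show ?thesis
    unfolding ls by (simp only: twisted_alt_sum_Cons f) simp
qed

text \<open>The cochain groups in degree \<open>n\<close> are the quotients of the ungraded groups \<open>'x\<close> and \<open>'y\<close> by the
  subgroups \<open>NA n\<close> and \<open>NC l n\<close>; cochains of the wrong degree are absorbed by these subgroups.\<close>

locale cochain_system =
  fixes \<Lambda> :: "'l set" and leq :: "'l \<Rightarrow> 'l \<Rightarrow> bool"
    and dA :: "'x::ab_group_add \<Rightarrow> 'x" and dC :: "'l \<Rightarrow> 'y::ab_group_add \<Rightarrow> 'y"
    and p :: "'l \<Rightarrow> 'l \<Rightarrow> 'y \<Rightarrow> 'y" and q :: "'l \<Rightarrow> 'y \<Rightarrow> 'x"
    and NA :: "int \<Rightarrow> 'x set" and NC :: "'l \<Rightarrow> int \<Rightarrow> 'y set"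
  assumes dir: "directed_set \<Lambda> leq"
    and add_dA: "Modules.additive dA" and add_dC: "\<And>l. Modules.additive (dC l)"
    and add_p: "\<And>l m. Modules.additive (p l m)" and add_q: "\<And>l. Modules.additive (q l)"
    and dA_dA: "\<And>x. dA (dA x) = 0" and dC_dC: "\<And>l y. dC l (dC l y) = 0"
    and p_dC: "\<And>l m y. \<lbrakk>l \<in> \<Lambda>; m \<in> \<Lambda>; leq l m\<rbrakk> \<Longrightarrow> p l m (dC l y) = dC m (p l m y)"
    and q_dC: "\<And>l y. l \<in> \<Lambda> \<Longrightarrow> q l (dC l y) = dA (q l y)"
    and p_p: "\<And>k l m y. \<lbrakk>k \<in> \<Lambda>; l \<in> \<Lambda>; m \<in> \<Lambda>; leq k l; leq l m\<rbrakk> \<Longrightarrow> p l m (p k l y) = p k m y"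
    and q_p: "\<And>l m y. \<lbrakk>l \<in> \<Lambda>; m \<in> \<Lambda>; leq l m\<rbrakk> \<Longrightarrow> q m (p l m y) = q l y"
    and NA: "\<And>n. add_subgroup (NA n)" and NC: "\<And>l n. add_subgroup (NC l n)"
    and dA_NA: "\<And>n x. x \<in> NA n \<Longrightarrow> dA x \<in> NA (n + 1)"
    and dC_NC: "\<And>l n y. y \<in> NC l n \<Longrightarrow> dC l y \<in> NC l (n + 1)"
    and p_NC: "\<And>l m n y. \<lbrakk>l \<in> \<Lambda>; m \<in> \<Lambda>; leq l m; y \<in> NC l n\<rbrakk> \<Longrightarrow> p l m y \<in> NC m n"
    and q_NC: "\<And>l n y. \<lbrakk>l \<in> \<Lambda>; y \<in> NC l n\<rbrakk> \<Longrightarrow> q l y \<in> NA n"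
    and coh_surj: "\<And>n x. dA x \<in> NA (n + 1) \<Longrightarrow>
          \<exists>l\<in>\<Lambda>. \<exists>y x'. dC l y \<in> NC l (n + 1) \<and> x - (q l y - dA x') \<in> NA n"
    and coh_inj: "\<And>n l y x. \<lbrakk>l \<in> \<Lambda>; dC l y \<in> NC l (n + 1); q l y - dA x \<in> NA n\<rbrakk> \<Longrightarrow>
          \<exists>m\<in>\<Lambda>. leq l m \<and> (\<exists>y'. p l m y - dC m y' \<in> NC m n)"
begin

abbreviation MI :: "'l list set" where "MI \<equiv> multiindices \<Lambda> leq"

text \<open>Keys may be arbitrary lists. Sending those outside \<open>MI\<close> to 0 lets the
  identities below hold for all finitely supported functions, without a carrier set.\<close>

abbreviation ext :: "('l list \<Rightarrow> 'v \<Rightarrow> 'w::ab_group_add) \<Rightarrow> ('l list \<Rightarrow>\<^sub>0 'v::ab_group_add) \<Rightarrow> 'w" where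
  "ext f \<equiv> lin_ext (\<lambda>ls y. if ls \<in> MI then f ls y else 0)"

definition dB :: "('l list \<Rightarrow>\<^sub>0 'y) \<Rightarrow> ('l list \<Rightarrow>\<^sub>0 'y)" where
  "dB = ext (\<lambda>ls y. single ls (dC (hd ls) y))"

definition eps :: "('l list \<Rightarrow>\<^sub>0 'y) \<Rightarrow> ('l list \<Rightarrow>\<^sub>0 'y)" where
  "eps = ext (twisted_alt_sum p single)"

text \<open>The exponent \<open>n + 1\<close> is dictated by the total complex: in the first
  component of the cone, precomposition with \<open>DB (n - 1)\<close> gives the sign (-1)^n, and in
  the second the minus sign of the cone turns the exponent of \<open>DB n\<close> into
  \<open>n\<close> as well. Consecutive signs differ and \<open>dB\<close> commutes with
  \<open>eps\<close>, so the mixed terms of the square cancel.\<close>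

definition DB :: "int \<Rightarrow> ('l list \<Rightarrow>\<^sub>0 'y) \<Rightarrow> ('l list \<Rightarrow>\<^sub>0 'y)" where
  "DB n b = dB b + sign_pow (n + 1) (eps b)"

definition fB :: "('l list \<Rightarrow>\<^sub>0 'y) \<Rightarrow> 'x" where
  "fB = ext (\<lambda>ls y. if length ls = 1 then q (hd ls) y else 0)"

text \<open>The summand at \<open>ls\<close> is shifted by its level, as in the total complex.
  Nothing is required at lists outside \<open>MI\<close>, so passing to the quotient removes
  them.\<close>

definition NB :: "int \<Rightarrow> ('l list \<Rightarrow>\<^sub>0 'y) set" where
  "NB n = {b. \<forall>ls\<in>MI. Poly_Mapping.lookup b ls \<in> NC (hd ls) (n + level ls)}"

section \<open>The double complex of the homotopy colimit and its map to the cochains of the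
  space\<close>

lemma MI_iff: "ls \<in> MI \<longleftrightarrow> ls \<noteq> [] \<and> set ls \<subseteq> \<Lambda> \<and> sorted_wrt leq ls"
  by (simp add: multiindices_eq[OF dir])

lemma leq_trans: "\<lbrakk>k \<in> \<Lambda>; l \<in> \<Lambda>; m \<in> \<Lambda>; leq k l; leq l m\<rbrakk> \<Longrightarrow> leq k m"
  using dir unfolding directed_set_def by (meson transp_onD)

lemma additive_ext: "(\<And>ls. ls \<in> MI \<Longrightarrow> Modules.additive (f ls)) \<Longrightarrow> Modules.additive (ext f)"
  by (intro additive_lin_ext additive_if additive_zero)

lemma ext_single: "(ls \<in> MI \<Longrightarrow> Modules.additive (f ls)) \<Longrightarrow>
    ext f (single ls y) = (if ls \<in> MI then f ls y else 0)"
  by (subst lin_ext_single) (intro additive_if additive_zero, auto)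

lemma additive_twisted_alt_sum:
  assumes "\<And>u. Modules.additive (c u)"
  shows "Modules.additive (twisted_alt_sum p c ls)"
proof
  fix x y
  have "alt_sum (\<lambda>u. c (hd ls # u) (x + y)) (tl ls)
      = alt_sum (\<lambda>u. c (hd ls # u) x) (tl ls) + alt_sum (\<lambda>u. c (hd ls # u) y) (tl ls)"
    by (simp add: additive.add[OF assms] alt_sum_add)
  then show "twisted_alt_sum p c ls (x + y) = twisted_alt_sum p c ls x + twisted_alt_sum p c ls y"
    by (simp add: twisted_alt_sum_def additive.add[OF assms] additive.add[OF add_p])
qed

lemma additive_dB: "Modules.additive dB"
  unfolding dB_def by (intro additive_ext additive_compose[OF additive_single] add_dC)

lemma additive_eps: "Modules.additive eps"
  unfolding eps_def by (intro additive_ext additive_twisted_alt_sum additive_single)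

lemma additive_DB: "Modules.additive (DB n)"
  unfolding DB_def by (intro additive_plus additive_dB additive_compose[OF additive_sign_pow] additive_eps)

lemma additive_q1: "Modules.additive (\<lambda>y. if length ls = 1 then q (hd ls) y else 0)"
  by (intro additive_if add_q additive_zero)

lemma additive_fB: "Modules.additive fB"
  unfolding fB_def by (intro additive_ext additive_q1)

lemma dB_single: "dB (single ls y) = (if ls \<in> MI then single ls (dC (hd ls) y) else 0)"
  unfolding dB_def by (intro ext_single additive_compose[OF additive_single] add_dC)

lemma eps_single: "eps (single ls y) = (if ls \<in> MI then twisted_alt_sum p single ls y else 0)"
  unfolding eps_def by (intro ext_single additive_twisted_alt_sum additive_single)

lemma fB_single: "fB (single ls y) = (if ls \<in> MI \<and> length ls = 1 then q (hd ls) y else 0)"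
  unfolding fB_def by (subst ext_single) (use additive_q1[of ls] in auto)

text \<open>Turns every identity about \<open>eps\<close> into one about
  \<open>twisted_alt_sum\<close>. The restriction to \<open>MI\<close> inside \<open>ext\<close> is
  invisible, since faces of multiindices of length at least two are multiindices and shorter ones
  contribute nothing.\<close>

lemma ext_eps_single:
  assumes "\<And>u. Modules.additive (c u)" "ls \<in> MI"
  shows "ext c (eps (single ls y)) = twisted_alt_sum p c ls y"
proof -
  have "ext c (eps (single ls y)) = twisted_alt_sum p (\<lambda>u v. ext c (single u v)) ls y"
    using assms by (simp add: eps_single twisted_alt_sum_additive additive_ext)
  also have "\<dots> = twisted_alt_sum p c ls y"
    by (rule twisted_alt_sum_cong[OF dir assms(2)]) (simp add: ext_single assms)
  finally show ?thesis .
qed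

lemma MI_ConsD: "l # m # t \<in> MI \<Longrightarrow> l \<in> \<Lambda> \<and> m \<in> \<Lambda> \<and> leq l m"
  by (auto simp: MI_iff)

lemma not_MI_Nil: "[] \<notin> MI"
  by (simp add: MI_iff)

lemma additive_eqI:
  assumes "Modules.additive F" "Modules.additive G"
    and "\<And>k v. F (single k v) = G (single k v)"
  shows "F b = G b"
  using additive_eq_on_keys[OF assms(1,2)] assms(3) by blast

lemma dB_dB: "dB (dB b) = 0"
  by (rule additive_eqI[where F="\<lambda>b. dB (dB b)" and G="\<lambda>b. 0"])
    (auto intro: additive_compose[OF additive_dB additive_dB] additive_zero
       simp: dB_single dC_dC additive.zero[OF additive_dB])

lemma dB_eps: "dB (eps b) = eps (dB b)"
proof (rule additive_eqI[where F="\<lambda>b. dB (eps b)" and G="\<lambda>b. eps (dB b)"])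
  show "Modules.additive (\<lambda>b. dB (eps b))" by (rule additive_compose[OF additive_dB additive_eps])
  show "Modules.additive (\<lambda>b. eps (dB b))" by (rule additive_compose[OF additive_eps additive_dB])
  fix ls y
  show "dB (eps (single ls y)) = eps (dB (single ls y))"
  proof (cases "ls \<in> MI")
    case True
    have "dB (eps (single ls y)) = twisted_alt_sum p (\<lambda>ls y. single ls (dC (hd ls) y)) ls y"
      unfolding dB_def by (rule ext_eps_single) (auto intro: additive_compose[OF additive_single] add_dC True)
    also have "\<dots> = twisted_alt_sum p single ls (dC (hd ls) y)"
    proof (cases "length ls \<le> 1")
      case False
      then obtain l m t where ls: "ls = l # m # t" by (cases ls; cases "tl ls") auto
      then show ?thesis using MI_ConsD[of l m t] True
        by (simp add: p_dC del: alt_sum.simps)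
    qed (simp add: twisted_alt_sum_def)
    finally show ?thesis using True by (simp add: dB_single eps_single)
  qed (simp add: dB_single eps_single additive.zero[OF additive_dB] additive.zero[OF additive_eps])
qed

lemma eps_eps: "eps (eps b) = 0"
proof (rule additive_eqI[where F="\<lambda>b. eps (eps b)" and G="\<lambda>b. 0"])
  show "Modules.additive (\<lambda>b. eps (eps b))" by (rule additive_compose[OF additive_eps additive_eps])
  show "Modules.additive (\<lambda>b. 0)" by (rule additive_zero)
  fix ls y
  show "eps (eps (single ls y)) = 0"
  proof (cases "ls \<in> MI")
    case True
    have "eps (eps (single ls y)) = twisted_alt_sum p (twisted_alt_sum p single) ls y"
      by (subst eps_def) (rule ext_eps_single, auto intro: additive_twisted_alt_sum additive_single True)
    also have "\<dots> = 0" by (rule twisted_alt_sum_twisted_alt_sum[OF dir True p_p])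
    finally show ?thesis .
  qed (simp add: eps_single additive.zero[OF additive_eps])
qed

lemma sign_pow_simps: "sign_pow (k + 1) x = - sign_pow k x" "sign_pow k (sign_pow k x) = x" "sign_pow k (- x) = - sign_pow k x" "sign_pow k 0 = 0"
    "sign_pow (k - 1) x = - sign_pow k x"
  by (auto simp: sign_pow_def)

lemma additive_sign_pow_commute: "Modules.additive f \<Longrightarrow> f (sign_pow k x) = sign_pow k (f x)"
  by (auto simp: sign_pow_def additive.minus)

lemma DB_DB: "DB (n + 1) (DB n b) = 0"
  unfolding DB_def
  by (simp add: additive.diff[OF additive_dB] additive.diff[OF additive_eps] additive.diff[OF additive_sign_pow] additive.add[OF additive_dB] additive.add[OF additive_eps] dB_dB eps_eps dB_eps
      additive_sign_pow_commute[OF additive_dB] additive_sign_pow_commute[OF additive_eps] sign_pow_simps additive.add[OF additive_sign_pow])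
    (simp add: sign_pow_def)

text \<open>Among multiindices only \<open>[l, m]\<close> has faces of length one. Their
  contributions carry opposite signs and agree up to sign by \<open>q_p\<close>.\<close>

lemma fB_eps: "fB (eps b) = 0"
proof (rule additive_eqI[where F="\<lambda>b. fB (eps b)" and G="\<lambda>b. 0"])
  show "Modules.additive (\<lambda>b. fB (eps b))" by (rule additive_compose[OF additive_fB additive_eps])
  show "Modules.additive (\<lambda>b. 0)" by (rule additive_zero)
  fix ls y
  show "fB (eps (single ls y)) = 0"
  proof (cases "ls \<in> MI")
    case True
    let ?c = "\<lambda>ls y. if length ls = 1 then q (hd ls) y else 0"
    have "fB (eps (single ls y)) = twisted_alt_sum p ?c ls y"
      unfolding fB_def by (rule ext_eps_single[OF additive_q1 True])
    also have "\<dots> = 0"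
    proof (cases "length ls \<le> 1")
      case False
      then obtain l m t where ls: "ls = l # m # t" by (cases ls; cases "tl ls") auto
      show ?thesis
      proof (cases t)
        case Nil then show ?thesis using MI_ConsD[of l m t] True by (simp add: ls q_p)
      next
        case (Cons k t')
        have "alt_sum (\<lambda>u. ?c (l # u) y) (m # t) = alt_sum (\<lambda>u. 0) (m # t)"
          by (rule alt_sum_cong) (auto simp: Cons dest: arg_cong[where f = length] simp flip: length_0_conv)
        then show ?thesis unfolding ls twisted_alt_sum_Cons by (simp add: Cons alt_sum_zero del: alt_sum.simps)
      qed
    qed (simp add: twisted_alt_sum_def)
    finally show ?thesis .
  qed (simp add: eps_single additive.zero[OF additive_fB])
qed

lemma fB_dB: "fB (dB b) = dA (fB b)"
proof (rule additive_eqI[where F="\<lambda>b. fB (dB b)" and G="\<lambda>b. dA (fB b)"])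
  show "Modules.additive (\<lambda>b. fB (dB b))" by (rule additive_compose[OF additive_fB additive_dB])
  show "Modules.additive (\<lambda>b. dA (fB b))" by (rule additive_compose[OF add_dA additive_fB])
  fix ls y
  show "fB (dB (single ls y)) = dA (fB (single ls y))"
    by (cases ls) (auto simp: dB_single fB_single q_dC MI_iff additive.zero[OF additive_fB] additive.zero[OF add_dA])
qed

lemma fB_DB: "fB (DB n b) = dA (fB b)"
  by (simp add: DB_def additive.add[OF additive_fB] additive.diff[OF additive_fB] additive_sign_pow_commute[OF additive_fB] fB_eps fB_dB sign_pow_simps)

lemma NB: "add_subgroup (NB n)"
  using NC by (auto simp: add_subgroup_def NB_def lookup_minus)

lemma single_in_NB: "(ls \<in> MI \<Longrightarrow> y \<in> NC (hd ls) (n + level ls)) \<Longrightarrow> single ls y \<in> NB n"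
  using add_subgroup_zero[OF NC] by (auto simp: NB_def lookup_single when_def)

lemma single_in_NB_iff: "ls \<in> MI \<Longrightarrow> single ls y \<in> NB n \<longleftrightarrow> y \<in> NC (hd ls) (n + level ls)"
  using single_in_NB[of ls y n] by (auto simp: NB_def dest!: bspec[where x=ls])

lemma lin_ext_in_subgroup:
  assumes "add_subgroup S" "\<And>k. k \<in> Poly_Mapping.keys b \<Longrightarrow> f k (Poly_Mapping.lookup b k) \<in> S"
  shows "lin_ext f b \<in> S"
  unfolding lin_ext_def using assms by (intro add_subgroup_sum) auto

lemma dB_NB: "b \<in> NB n \<Longrightarrow> dB b \<in> NB (n + 1)"
  unfolding dB_def
proof (rule lin_ext_in_subgroup[OF NB])
  fix ls assume "b \<in> NB n"
  then have "ls \<in> MI \<Longrightarrow> dC (hd ls) (Poly_Mapping.lookup b ls) \<in> NC (hd ls) (n + level ls + 1)"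
    by (intro dC_NC) (auto simp: NB_def)
  then show "(if ls \<in> MI then single ls (dC (hd ls) (Poly_Mapping.lookup b ls)) else 0) \<in> NB (n + 1)"
    using add_subgroup_zero[OF NB] by (auto intro!: single_in_NB simp: algebra_simps)
qed

lemma twisted_alt_sum_single_NB:
  assumes "ls \<in> MI" "y \<in> NC (hd ls) (n + level ls)"
  shows "twisted_alt_sum p single ls y \<in> NB (n + 1)"
proof (cases "length ls \<le> 1")
  case False
  then obtain l m t where ls: "ls = l # m # t" by (cases ls; cases "tl ls") auto
  note L = MI_ConsD[OF assms(1)[unfolded ls]]
  have "single (m # t) (p l m y) \<in> NB (n + 1)"
    using p_NC[of l m y "n + level ls"] L assms(2)
    by (intro single_in_NB) (simp add: ls algebra_simps)
  moreover have "alt_sum (\<lambda>u. single (l # u) y) (m # t) \<in> NB (n + 1)"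
  proof (rule alt_sum_in_subgroup[OF NB])
    fix i assume "i < length (m # t)"
    then have "length (omit i (m # t)) = length t" by simp
    then show "single (l # omit i (m # t)) y \<in> NB (n + 1)"
      using assms(2) by (intro single_in_NB) (simp add: ls algebra_simps)
  qed
  ultimately show ?thesis unfolding ls twisted_alt_sum_Cons by (rule add_subgroup_diff[OF NB])
qed (simp add: twisted_alt_sum_def add_subgroup_zero[OF NB])

lemma eps_NB: "b \<in> NB n \<Longrightarrow> eps b \<in> NB (n + 1)"
  unfolding eps_def
proof (rule lin_ext_in_subgroup[OF NB])
  fix ls assume "b \<in> NB n"
  then show "(if ls \<in> MI then twisted_alt_sum p single ls (Poly_Mapping.lookup b ls) else 0) \<in> NB (n + 1)"
    using twisted_alt_sum_single_NB[of ls "Poly_Mapping.lookup b ls" n] add_subgroup_zero[OF NB, of "n + 1"] by (cases "ls \<in> MI") (auto simp: NB_def[of n])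
qed

lemma DB_NB: "b \<in> NB n \<Longrightarrow> DB n b \<in> NB (n + 1)"
  unfolding DB_def by (intro add_subgroup_add[OF NB] dB_NB add_subgroup_sign_pow[OF NB] eps_NB)

lemma fB_NB: "b \<in> NB n \<Longrightarrow> fB b \<in> NA n"
  unfolding fB_def
proof (rule lin_ext_in_subgroup[OF NA])
  fix ls assume b: "b \<in> NB n"
  show "(if ls \<in> MI then if length ls = 1 then q (hd ls) (Poly_Mapping.lookup b ls) else 0 else 0) \<in> NA n"
  proof (cases "ls \<in> MI \<and> length ls = 1")
    case True
    then have "hd ls \<in> \<Lambda>" by (cases ls) (auto simp: MI_iff)
    moreover have "Poly_Mapping.lookup b ls \<in> NC (hd ls) n" using True b by (auto simp: NB_def)
    ultimately show ?thesis using True q_NC by auto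
  qed (use add_subgroup_zero[OF NA] in auto)
qed

section \<open>Contraction of the direct sum onto one late term\<close>

definition hB :: "'l \<Rightarrow> ('l list \<Rightarrow>\<^sub>0 'y) \<Rightarrow> ('l list \<Rightarrow>\<^sub>0 'y)" where
  "hB m = ext (\<lambda>ls y. sign_pow (int (length ls)) (single (ls @ [m]) y))"

lemma additive_hB: "Modules.additive (hB m)"
  unfolding hB_def by (intro additive_ext additive_compose[OF additive_sign_pow] additive_single)

lemma hB_single: "hB m (single ls y) =
    (if ls \<in> MI then sign_pow (int (length ls)) (single (ls @ [m]) y) else 0)"
  unfolding hB_def by (intro ext_single additive_compose[OF additive_sign_pow] additive_single)

lemma hB_NB: "b \<in> NB (n + 1) \<Longrightarrow> hB m b \<in> NB n"
  unfolding hB_def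
proof (rule lin_ext_in_subgroup[OF NB])
  fix ls assume b: "b \<in> NB (n + 1)"
  have "sign_pow (int (length ls)) (single (ls @ [m]) (Poly_Mapping.lookup b ls)) \<in> NB n" if "ls \<in> MI"
    using that b not_MI_Nil by (intro add_subgroup_sign_pow[OF NB] single_in_NB) (auto simp: NB_def algebra_simps hd_append)
  then show "(if ls \<in> MI then sign_pow (int (length ls)) (single (ls @ [m]) (Poly_Mapping.lookup b ls)) else 0) \<in> NB n"
    using add_subgroup_zero[OF NB] by auto
qed

text \<open>The sign in \<open>hB\<close> is that of the last face of \<open>ls @ [m]\<close>, so
  this face returns \<open>ls\<close> with coefficient one. The other faces also end in
  \<open>m\<close> and cancel against \<open>hB m (eps _)\<close>, whose sign has the opposite
  parity. What remains is the correction of \<open>twisted_alt_sum_snoc\<close> for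
  singletons.\<close>

lemma eps_hB_single:
  assumes ls: "ls \<in> MI" and m: "m \<in> \<Lambda>" "\<And>l. l \<in> set ls \<Longrightarrow> leq l m"
  shows "eps (hB m (single ls y)) + hB m (eps (single ls y))
     = single ls y - (if length ls = 1 then single [m] (p (hd ls) m y) else 0)"
proof -
  let ?X = "twisted_alt_sum p (\<lambda>u. single (u @ [m])) ls y"
  have ne: "ls \<noteq> []" and lsm: "ls @ [m] \<in> MI" using ls m by (auto simp: MI_iff sorted_wrt_append)
  have "eps (hB m (single ls y)) = sign_pow (int (length ls)) (?X + sign_pow (int (length ls)) (single ls y)
     + (if length ls = 1 then single [m] (p (hd ls) m y) else 0))"
    using ls lsm by (simp add: hB_single additive_sign_pow_commute[OF additive_eps] eps_single twisted_alt_sum_snoc[OF ne])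
  moreover have "hB m (eps (single ls y)) = twisted_alt_sum p (\<lambda>u v. sign_pow (int (length u)) (single (u @ [m]) v)) ls y"
    unfolding hB_def by (rule ext_eps_single) (auto intro: additive_compose[OF additive_sign_pow] additive_single ls)
  \<comment> \<open>All faces of \<open>ls\<close> have the same length, one less than that of
    \<open>ls\<close>, so the sign is constant and can be pulled out.\<close>
  moreover have "\<dots> = twisted_alt_sum p (\<lambda>u v. sign_pow (int (length ls) - 1) (single (u @ [m]) v)) ls y"
    by (rule twisted_alt_sum_cong[OF dir ls]) (metis add_diff_cancel_right' of_nat_1 of_nat_add)
  moreover have "\<dots> = sign_pow (int (length ls) - 1) ?X"
    by (rule twisted_alt_sum_additive[OF additive_sign_pow])
  ultimately show ?thesis
    by (auto simp: sign_pow_simps additive.add[OF additive_sign_pow]) (simp add: sign_pow_def)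
qed

lemma dB_hB_single:
  assumes ls: "ls \<in> MI" and m: "m \<in> \<Lambda>" "\<And>l. l \<in> set ls \<Longrightarrow> leq l m"
  shows "dB (hB m (single ls y)) = hB m (dB (single ls y))"
proof -
  have ne: "ls \<noteq> []" and lsm: "ls @ [m] \<in> MI" using ls m by (auto simp: MI_iff sorted_wrt_append)
  then show ?thesis using ls by (simp add: hB_single additive_sign_pow_commute[OF additive_dB] dB_single)
qed

definition pB :: "'l \<Rightarrow> ('l list \<Rightarrow>\<^sub>0 'y) \<Rightarrow> 'y" where
  "pB m = ext (\<lambda>ls y. if length ls = 1 then p (hd ls) m y else 0)"

lemma additive_p1: "Modules.additive (\<lambda>y. if length ls = 1 then p (hd ls) m y else 0)"
  by (intro additive_if add_p additive_zero)

lemma additive_pB: "Modules.additive (pB m)"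
  unfolding pB_def by (intro additive_ext additive_p1)

lemma pB_single: "pB m (single ls y) = (if ls \<in> MI \<and> length ls = 1 then p (hd ls) m y else 0)"
  unfolding pB_def by (subst ext_single) (use additive_p1[of ls] in auto)

text \<open>The factor \<open>sign_pow n\<close> cancels the sign of \<open>eps\<close> in
  \<open>DB (n - 1)\<close>. Thus \<open>b\<close> is homotopic to its transport
  \<open>pB m b\<close> to the term \<open>m\<close>, and the second claim says that this transport
  keeps the image in the cochains of the space.\<close>

lemma contraction:
  assumes b: "Poly_Mapping.keys b \<subseteq> MI" and m: "m \<in> \<Lambda>" "\<And>ls l. ls \<in> Poly_Mapping.keys b \<Longrightarrow> l \<in> set ls \<Longrightarrow> leq l m"
  shows "DB (n - 1) (sign_pow n (hB m b)) = b - single [m] (pB m b) + sign_pow n (hB m (DB n b))"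
    and "fB b = q m (pB m b)"
proof -
  have "eps (hB m b) + hB m (eps b) = b - single [m] (pB m b)"
  proof (rule additive_eq_on_keys[where F="\<lambda>b. eps (hB m b) + hB m (eps b)"
        and G="\<lambda>b. b - single [m] (pB m b)"])
    fix ls y assume "ls \<in> Poly_Mapping.keys b"
    with b m have "ls \<in> MI" "\<And>l. l \<in> set ls \<Longrightarrow> leq l m" by auto
    then show "eps (hB m (single ls y)) + hB m (eps (single ls y)) =
        single ls y - single [m] (pB m (single ls y))"
      using m(1) eps_hB_single[of ls m y] by (simp add: pB_single)
  next
    show "Modules.additive (\<lambda>b. eps (hB m b) + hB m (eps b))"
      by (intro additive_plus additive_compose[OF additive_eps additive_hB] additive_compose[OF additive_hB additive_eps])
    show "Modules.additive (\<lambda>b. b - single [m] (pB m b))"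
      by unfold_locales (simp add: additive.add[OF additive_pB] single_add)
  qed
  then have e: "eps (hB m b) = b - single [m] (pB m b) - hB m (eps b)"
    by (simp add: eq_diff_eq)
  moreover have "dB (hB m b) = hB m (dB b)"
  proof (rule additive_eq_on_keys[where F="\<lambda>b. dB (hB m b)" and G="\<lambda>b. hB m (dB b)",
        OF additive_compose[OF additive_dB additive_hB] additive_compose[OF additive_hB additive_dB]])
    fix ls y assume "ls \<in> Poly_Mapping.keys b"
    with b m have "ls \<in> MI" "\<And>l. l \<in> set ls \<Longrightarrow> leq l m" by auto
    then show "dB (hB m (single ls y)) = hB m (dB (single ls y))"
      using m(1) dB_hB_single by blast
  qed
  ultimately show "DB (n - 1) (sign_pow n (hB m b)) = b - single [m] (pB m b) + sign_pow n (hB m (DB n b))"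
    by (simp add: e DB_def additive.add[OF additive_hB] additive_sign_pow_commute[OF additive_hB] additive_sign_pow_commute[OF additive_dB] additive_sign_pow_commute[OF additive_eps]
       sign_pow_simps additive.add[OF additive_sign_pow] algebra_simps) (simp add: sign_pow_def)
  show "fB b = q m (pB m b)"
  proof (rule additive_eq_on_keys[where G="\<lambda>b. q m (pB m b)", OF additive_fB additive_compose[OF add_q additive_pB]])
    fix ls y assume "ls \<in> Poly_Mapping.keys b"
    with b m have *: "ls \<in> MI" "\<And>l. l \<in> set ls \<Longrightarrow> leq l m" by auto
    then have "hd ls \<in> \<Lambda>" "leq (hd ls) m" by (cases ls; force simp: MI_iff)+
    with * m(1) show "fB (single ls y) = q m (pB m (single ls y))"
      by (auto simp: fB_single pB_single q_p additive.zero[OF add_q])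
  qed
qed

lemma directed_upper_bound:
  assumes "finite F" "F \<subseteq> \<Lambda>"
  shows "\<exists>m\<in>\<Lambda>. \<forall>l\<in>F. leq l m"
  using assms
proof (induction F rule: finite_induct)
  case empty
  then show ?case using dir by (auto simp: directed_set_def)
next
  case (insert k F)
  then obtain m where m: "m \<in> \<Lambda>" "\<forall>l\<in>F. leq l m" by auto
  moreover have "k \<in> \<Lambda>" using insert by auto
  ultimately obtain n where n: "n \<in> \<Lambda>" "leq m n" "leq k n"
    using dir unfolding directed_set_def by blast
  then have "\<forall>l\<in>insert k F. leq l n"
    using m insert.prems leq_trans by (metis insert_iff subsetD)
  then show ?case using n by blast
qed

text \<open>Spurious keys are null in every degree, so they can be discarded before a common bound
  for the indices in the support is chosen.\<close>

lemma decompose_MI: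
  obtains b0 where "Poly_Mapping.keys b0 \<subseteq> MI" "\<And>n. b - b0 \<in> NB n"
proof
  let ?b0 = "ext single b"
  let ?S = "{b::'l list \<Rightarrow>\<^sub>0 'y. \<forall>k. k \<notin> MI \<longrightarrow> Poly_Mapping.lookup b k = 0}"
  have "add_subgroup ?S" by (simp add: add_subgroup_def lookup_minus)
  then have "?b0 \<in> ?S" by (rule lin_ext_in_subgroup) (auto simp: lookup_single when_def)
  then show "Poly_Mapping.keys ?b0 \<subseteq> MI" by (auto simp: in_keys_iff)
  fix n
  let ?R = "lin_ext (\<lambda>ls y. if ls \<in> MI then 0 else single ls y) :: ('l list \<Rightarrow>\<^sub>0 'y) \<Rightarrow> ('l list \<Rightarrow>\<^sub>0 'y)"
  have aR: "Modules.additive ?R" by (intro additive_lin_ext additive_if additive_single additive_zero)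
  have aE: "Modules.additive (ext single :: ('l list \<Rightarrow>\<^sub>0 'y) \<Rightarrow> 'l list \<Rightarrow>\<^sub>0 'y)" by (intro additive_ext additive_single)
  have "?b0 + ?R b = b"
  proof (rule additive_eqI[where F="\<lambda>b::'l list \<Rightarrow>\<^sub>0 'y. ext single b + ?R b" and G="\<lambda>b. b"])
    show "Modules.additive (\<lambda>b::'l list \<Rightarrow>\<^sub>0 'y. ext single b + ?R b)" by (rule additive_plus[OF aE aR])
    show "Modules.additive (\<lambda>b::'l list \<Rightarrow>\<^sub>0 'y. b)" by unfold_locales simp
    fix ls and y :: 'y
    have "?R (single ls y) = (if ls \<in> MI then 0 else single ls y)"
      by (rule lin_ext_single) (intro additive_if additive_single additive_zero)
    then show "ext single (single ls y) + ?R (single ls y) = single ls y"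
      by (simp add: ext_single additive_single)
  qed
  then have "b - ?b0 = ?R b" by (simp add: algebra_simps)
  moreover have "?R b \<in> NB n"
    by (rule lin_ext_in_subgroup[OF NB]) (auto intro!: single_in_NB add_subgroup_zero[OF NB])
  ultimately show "b - ?b0 \<in> NB n" by simp
qed

text \<open>A cocycle of the direct sum is pushed by the contraction onto a single term, where
  injectivity makes it bounding after a further push.\<close>

lemma exact_B:
  assumes b: "DB n b \<in> NB (n + 1)" and a: "fB b - dA a \<in> NA n"
  shows "\<exists>b'. b - DB (n - 1) b' \<in> NB n"
proof -
  obtain b0 where b0: "Poly_Mapping.keys b0 \<subseteq> MI" "\<And>n. b - b0 \<in> NB n"
    using decompose_MI[of b] by blast
  have "DB n (b - b0) \<in> NB (n + 1)" using b0(2) by (rule DB_NB)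
  then have Db0: "DB n b0 \<in> NB (n + 1)"
    using b by (simp add: additive.diff[OF additive_DB] add_subgroup_cong[OF NB])
  have "fB (b - b0) \<in> NA n" using b0(2) by (rule fB_NB)
  then have "fB b - fB b0 \<in> NA n" by (simp add: additive.diff[OF additive_fB])
  from add_subgroup_diff[OF NA a this] have fb0: "fB b0 - dA a \<in> NA n" by simp
  have "finite (\<Union>(set ` Poly_Mapping.keys b0))" "\<Union>(set ` Poly_Mapping.keys b0) \<subseteq> \<Lambda>"
    using b0(1) by (auto simp: MI_iff dest!: subsetD)
  from directed_upper_bound[OF this] obtain m where m: "m \<in> \<Lambda>" "\<And>ls l. ls \<in> Poly_Mapping.keys b0 \<Longrightarrow> l \<in> set ls \<Longrightarrow> leq l m"
    by auto
  define c where "c = pB m b0"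
  define b1 where "b1 = sign_pow n (hB m b0)"
  have "sign_pow n (hB m (DB n b0)) \<in> NB n" using hB_NB[OF Db0] add_subgroup_sign_pow[OF NB] by blast
  then have b1: "(b0 - single [m] c) - DB (n - 1) b1 \<in> NB n"
    using contraction(1)[OF b0(1) m, where n=n] add_subgroup_uminus[OF NB] by (fastforce simp: b1_def c_def)
  have fc: "fB b0 = q m c" unfolding c_def by (rule contraction(2)[OF b0(1) m])
  have mMI: "[m] \<in> MI" using m by (simp add: MI_iff)
  have DBm: "DB k (single [l] y) = single [l] (dC l y)" if "l \<in> \<Lambda>" for k l y
    using that by (simp add: DB_def dB_single eps_single MI_iff sign_pow_simps)
  from DB_NB[OF b1] have "DB n b0 - DB n (single [m] c) - DB n (DB (n - 1) b1) \<in> NB (n + 1)"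
    by (simp add: additive.diff[OF additive_DB])
  then have "DB n b0 - single [m] (dC m c) \<in> NB (n + 1)"
    using DB_DB[of "n - 1" b1] by (simp add: DBm m)
  then have "single [m] (dC m c) \<in> NB (n + 1)"
    using Db0 add_subgroup_cong[OF NB] by blast
  then have "dC m c \<in> NC m (n + 1)" using mMI by (simp add: single_in_NB_iff)
  from coh_inj[OF m(1) this fb0[unfolded fc]] obtain k y' where k: "k \<in> \<Lambda>" "leq m k" "p m k c - dC k y' \<in> NC k n"
    by blast
  \<comment> \<open>The edge \<open>[m, k]\<close> connects the two terms: the faces of
    \<open>single [m, k] c\<close> are the transport of \<open>c\<close> to \<open>[k]\<close> minus
    \<open>c\<close> at \<open>[m]\<close>. The factor \<open>sign_pow n\<close> cancels the sign of
    \<open>eps\<close> in \<open>DB (n - 1)\<close>, and the remaining part is null since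
    \<open>c\<close> is a cocycle modulo null cochains.\<close>
  define b2 where "b2 = sign_pow n (single [m, k] c)"
  define b3 where "b3 = single [k] y'"
  have mkMI: "[m, k] \<in> MI" using m k by (simp add: MI_iff)
  have b2: "DB (n - 1) b2 - (single [k] (p m k c) - single [m] c) \<in> NB n"
  proof -
    have "DB (n - 1) b2 - (single [k] (p m k c) - single [m] c) = sign_pow n (single [m, k] (dC m c))"
      using mkMI by (simp add: b2_def DB_def additive_sign_pow_commute[OF additive_dB] additive_sign_pow_commute[OF additive_eps]
         dB_single eps_single sign_pow_simps)
    moreover have "\<dots> \<in> NB n"
      using \<open>dC m c \<in> NC m (n + 1)\<close> by (intro add_subgroup_sign_pow[OF NB] single_in_NB) (simp add: algebra_simps)
    ultimately show ?thesis by simp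
  qed
  have b3: "single [k] (p m k c) - DB (n - 1) b3 \<in> NB n"
  proof -
    have "single [k] (p m k c) - DB (n - 1) b3 = single [k] (p m k c - dC k y')"
      by (simp add: b3_def DBm k single_diff)
    moreover have "\<dots> \<in> NB n" using k by (intro single_in_NB) simp
    ultimately show ?thesis by simp
  qed
  have "b - DB (n - 1) (b1 - b2 + b3) = (b - b0) + ((b0 - single [m] c) - DB (n - 1) b1)
     + ((DB (n - 1) b2 - (single [k] (p m k c) - single [m] c)) + (single [k] (p m k c) - DB (n - 1) b3))"
    by (simp add: additive.diff[OF additive_DB] additive.add[OF additive_DB])
  also have "\<dots> \<in> NB n"
    by (intro add_subgroup_add[OF NB] b0(2) b1 b2 b3)
  finally show ?thesis by blast
qed

text \<open>Acyclicity of the mapping cone of \<open>fB\<close>, modulo null cochains. If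
  \<open>b1\<close> bounds \<open>b\<close>, then \<open>a - fB b1\<close> is a cocycle one degree
  lower and comes, up to a coboundary, from a cocycle \<open>y\<close> of some term
  \<open>l\<close>. Adding \<open>single [l] y\<close> to \<open>b1\<close> corrects
  \<open>a\<close> and changes \<open>DB (n - 1) b1\<close> only by a null cochain.\<close>

theorem exact:
  assumes b: "DB n b \<in> NB (n + 1)" and a: "fB b - dA a \<in> NA n"
  shows "\<exists>a' b'. a - (fB b' - dA a') \<in> NA (n - 1) \<and> b - DB (n - 1) b' \<in> NB n"
proof -
  obtain b1 where b1: "b - DB (n - 1) b1 \<in> NB n" using exact_B[OF assms] by blast
  then have "fB b - dA (fB b1) \<in> NA n"
    using fB_NB[OF b1] by (simp add: additive.diff[OF additive_fB] fB_DB)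
  from add_subgroup_diff[OF NA this a] have "dA (a - fB b1) \<in> NA n"
    by (simp add: additive.diff[OF add_dA])
  then obtain l y x' where l: "l \<in> \<Lambda>" "dC l y \<in> NC l n" "(a - fB b1) - (q l y - dA x') \<in> NA (n - 1)"
    using coh_surj[of "a - fB b1" "n - 1"] by auto
  let ?s = "single [l] y"
  have "fB ?s = q l y" using l by (simp add: fB_single MI_iff)
  then have "a - (fB (b1 + ?s) - dA x') \<in> NA (n - 1)"
    using l(3) by (simp add: additive.add[OF additive_fB] algebra_simps)
  moreover have "DB (n - 1) ?s \<in> NB n"
    using l by (simp add: DB_def dB_single eps_single MI_iff sign_pow_simps) (auto intro: single_in_NB)
  then have "b - DB (n - 1) (b1 + ?s) \<in> NB n"
    using add_subgroup_diff[OF NB b1] by (simp add: additive.add[OF additive_DB] diff_diff_eq)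
  ultimately show ?thesis by blast
qed

end

section \<open>Maps into divisible groups\<close>

definition divisible :: "('i, 'b) monoid_scheme \<Rightarrow> bool" where
  "divisible I \<longleftrightarrow> comm_group I \<and> (\<forall>x\<in>carrier I. \<forall>n::nat. n > 0 \<longrightarrow> (\<exists>y\<in>carrier I. y [^]\<^bsub>I\<^esub> n = x))"

text \<open>To divide \<open>x\<close> by \<open>n\<close>, the homomorphism with 1 \<mapsto>
  \<open>x\<close> is extended along multiplication by \<open>n\<close> on \<open>Z\<close>, a copy
  of the integers carried by \<open>range f\<close>. The value of the extension at 1 is the required
  root.\<close>

lemma injective_group_divisible:
  fixes f :: "int \<Rightarrow> 'u"
  assumes f: "inj f" and I: "injective_group TYPE('u) I"
  shows "divisible I"
proof -
  interpret I: comm_group I using I by (simp add: injective_group_def)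
  define Z where "Z = \<lparr>carrier = range f, monoid.mult = (\<lambda>a b. f (inv_into UNIV f a + inv_into UNIV f b)), one = f 0\<rparr>"
  have Z: "comm_group Z"
    by (rule comm_groupI) (use f in \<open>auto simp: Z_def add_ac, metis add.right_inverse\<close>)
  have "\<exists>y\<in>carrier I. y [^]\<^bsub>I\<^esub> n = x" if x: "x \<in> carrier I" and n: "n > 0" for x and n :: nat
  proof -
    define j where "j = (\<lambda>a. f (int n * inv_into UNIV f a))"
    define h where "h = (\<lambda>a. x [^]\<^bsub>I\<^esub> inv_into UNIV f a)"
    have "j \<in> mon Z Z"
      using n by (auto simp: mon_def hom_def Z_def j_def inj_on_def inj_eq[OF f] inv_into_f_f[OF f] algebra_simps)
    moreover have "h \<in> hom Z I"
      using f x by (auto simp: hom_def Z_def h_def I.int_pow_mult)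
    ultimately obtain g where g: "g \<in> hom Z I" "\<forall>a\<in>carrier Z. g (j a) = h a"
      using I Z unfolding injective_group_def by blast
    have g0: "g (f 0) = \<one>\<^bsub>I\<^esub>"
      using hom_one[OF g(1)] Z by (simp add: Z_def comm_group_def)
    have gc: "g (f k) \<in> carrier I" for k using g(1) by (auto simp: hom_def Z_def)
    have gadd: "g (f (k + l)) = g (f k) \<otimes>\<^bsub>I\<^esub> g (f l)" for k l
      using hom_mult[OF g(1), of "f k" "f l"] f by (simp add: Z_def)
    have "g (f 1) [^]\<^bsub>I\<^esub> m = g (f (int m))" for m :: nat
      by (induction m) (simp_all add: g0 gadd gc I.m_comm)
    then have "g (f 1) [^]\<^bsub>I\<^esub> n = g (j (f 1))" using f by (simp add: j_def)
    also have "\<dots> = x" using g(2) f x by (simp add: Z_def h_def)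
    finally show ?thesis using gc by blast
  qed
  then show ?thesis using I.comm_group_axioms by (simp add: divisible_def)
qed

section \<open>Baer's argument: extension of homomorphisms into divisible groups\<close>

definition mult_of_nat :: "nat \<Rightarrow> 'm::ab_group_add \<Rightarrow> 'm" where
  "mult_of_nat n z = ((+) z ^^ n) 0"

lemma mult_of_nat_simps [simp]: "mult_of_nat 0 z = 0" "mult_of_nat (Suc n) z = z + mult_of_nat n z"
  by (simp_all add: mult_of_nat_def)

lemma mult_of_nat_add: "mult_of_nat (m + n) z = mult_of_nat m z + mult_of_nat n z"
  by (induction m) (simp_all add: add_ac)

text \<open>A homomorphism defined on a subgroup, given by its graph. The domain stays implicit,
  extension is inclusion, and unions of chains are again such graphs, as Zorn's lemma requires.
  Triviality of the values at 0 encodes single-valuedness.\<close>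

definition partial_hom :: "('i, 'b) monoid_scheme \<Rightarrow> ('m::ab_group_add \<times> 'i) set \<Rightarrow> bool" where
  "partial_hom I H \<longleftrightarrow> H \<subseteq> UNIV \<times> carrier I \<and> (0, \<one>\<^bsub>I\<^esub>) \<in> H \<and>
     (\<forall>x a y b. (x, a) \<in> H \<longrightarrow> (y, b) \<in> H \<longrightarrow> (x - y, a \<otimes>\<^bsub>I\<^esub> inv\<^bsub>I\<^esub> b) \<in> H) \<and>
     (\<forall>a. (0, a) \<in> H \<longrightarrow> a = \<one>\<^bsub>I\<^esub>)"

context comm_group begin

lemma partial_homD:
  assumes "partial_hom G H"
  shows "(x, a) \<in> H \<Longrightarrow> a \<in> carrier G" "(0, \<one>) \<in> H"
    "(x, a) \<in> H \<Longrightarrow> (y, b) \<in> H \<Longrightarrow> (x - y, a \<otimes> inv b) \<in> H" "(0, a) \<in> H \<Longrightarrow> a = \<one>"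
    "(x, a) \<in> H \<Longrightarrow> (- x, inv a) \<in> H"
    "(x, a) \<in> H \<Longrightarrow> (y, b) \<in> H \<Longrightarrow> (x + y, a \<otimes> b) \<in> H"
    "(x, a) \<in> H \<Longrightarrow> (x, b) \<in> H \<Longrightarrow> a = b"
proof -
  show c: "(x, a) \<in> H \<Longrightarrow> a \<in> carrier G" for x a using assms by (auto simp: partial_hom_def)
  show 0: "(0, \<one>) \<in> H" "(0, a) \<in> H \<Longrightarrow> a = \<one>" for a using assms by (auto simp: partial_hom_def)
  show d: "(x, a) \<in> H \<Longrightarrow> (y, b) \<in> H \<Longrightarrow> (x - y, a \<otimes> inv b) \<in> H" for x a y b
    using assms by (auto simp: partial_hom_def)
  show u: "(x, a) \<in> H \<Longrightarrow> (- x, inv a) \<in> H" for x a using d[OF 0(1), of x a] c[of x a] by simp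
  show "(x, a) \<in> H \<Longrightarrow> (y, b) \<in> H \<Longrightarrow> (x + y, a \<otimes> b) \<in> H"
    using d[of x a "- y" "inv b"] u[of y b] c[of y b] by simp
  show "(x, a) \<in> H \<Longrightarrow> (x, b) \<in> H \<Longrightarrow> a = b"
    using d[of x a x b] 0(2)[of "a \<otimes> inv b"] c[of x a] c[of x b] by (simp add: inv_solve_right')
qed

lemma partial_hom_mult:
  assumes "partial_hom G H" "(x, a) \<in> H"
  shows "(mult_of_nat n x, a [^] n) \<in> H"
proof (induction n)
  case 0 then show ?case using partial_homD(2)[OF assms(1)] by simp
next
  case (Suc n)
  then show ?case using partial_homD(6)[OF assms(1,2) Suc] partial_homD(1)[OF assms] by (simp add: m_comm)
qed

lemma mult_of_nat_mult: "mult_of_nat (m * n) z = mult_of_nat m (mult_of_nat n z)"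
  by (induction m) (simp_all add: mult_of_nat_add)

text \<open>Finds a value \<open>c\<close> for \<open>z\<close> that is compatible with the
  multiples of \<open>z\<close> already in the domain. These are the multiples of the least positive
  one, \<open>mult_of_nat n z\<close>, and \<open>c\<close> is an \<open>n\<close>-th root of its
  value. If there is no positive one, \<open>\<one>\<close> serves.\<close>

lemma partial_hom_step:
  assumes div: "divisible G" and M: "partial_hom G M"
  obtains c where "c \<in> carrier G" "\<And>i b. (mult_of_nat i z, b) \<in> M \<Longrightarrow> b = c [^] i"
proof (cases "\<exists>n>0. \<exists>a. (mult_of_nat n z, a) \<in> M")
  case False
  show ?thesis
  proof (rule that)
    show "b = \<one> [^] i" if "(mult_of_nat i z, b) \<in> M" for i b
    proof -
      have "i = 0" using False that by (metis gr0I)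
      then show ?thesis using that partial_homD(4)[OF M] by simp
    qed
  qed simp
next
  case True
  define n where "n = (LEAST n. n > 0 \<and> (\<exists>a. (mult_of_nat n z, a) \<in> M))"
  have n: "n > 0 \<and> (\<exists>a. (mult_of_nat n z, a) \<in> M)"
    unfolding n_def by (rule LeastI_ex) (use True in blast)
  then obtain a where a: "(mult_of_nat n z, a) \<in> M" by blast
  obtain c where c: "c \<in> carrier G" "c [^] n = a"
    using div n partial_homD(1)[OF M a] unfolding divisible_def by blast
  show ?thesis
  proof (rule that[OF c(1)])
    fix i b assume b: "(mult_of_nat i z, b) \<in> M"
    have i: "i = i div n * n + i mod n" by simp
    have "mult_of_nat (i mod n) z = mult_of_nat i z - mult_of_nat (i div n) (mult_of_nat n z)"
      by (subst (2) i) (simp only: mult_of_nat_add mult_of_nat_mult, simp)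
    then have r: "(mult_of_nat (i mod n) z, b \<otimes> inv (a [^] (i div n))) \<in> M"
      using partial_homD(3)[OF M b partial_hom_mult[OF M a, of "i div n"]] by simp
    have "i mod n = 0"
    proof (rule ccontr)
      assume "i mod n \<noteq> 0"
      then have "n \<le> i mod n" unfolding n_def by (intro Least_le) (use r in \<open>auto simp: n_def\<close>)
      then show False using n mod_less_divisor[of n i] by linarith
    qed
    with r have "b \<otimes> inv (a [^] (i div n)) = \<one>" using partial_homD(4)[OF M] by simp
    then have "b = a [^] (i div n)"
      using partial_homD(1)[OF M a] partial_homD(1)[OF M b] by (simp add: inv_solve_right')
    also have "\<dots> = c [^] (n * (i div n))" using c by (simp add: nat_pow_pow[symmetric])
    also have "n * (i div n) = i" using \<open>i mod n = 0\<close> by auto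
    finally show "b = c [^] i" .
  qed
qed

lemma partial_hom_extend:
  assumes div: "divisible G" and M: "partial_hom G M"
  obtains M' c where "partial_hom G M'" "M \<subseteq> M'" "(z, c) \<in> M'"
proof -
  obtain c where c: "c \<in> carrier G" and cM: "\<And>i b. (mult_of_nat i z, b) \<in> M \<Longrightarrow> b = c [^] i"
    using partial_hom_step[OF assms] by blast
  \<comment> \<open>An integral multiple of \<open>z\<close> is written as a difference of two
    natural ones, matching the exponent \<open>int i - int j\<close>.\<close>
  define M' where "M' = {(x + mult_of_nat i z - mult_of_nat j z, a \<otimes> c [^] (int i - int j)) | x a i j. (x, a) \<in> M}"
  have I: "(x + mult_of_nat i z - mult_of_nat j z, a \<otimes> c [^] (int i - int j)) \<in> M'" if "(x, a) \<in> M" for x a i j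
    using that unfolding M'_def by blast
  have "partial_hom G M'"
    unfolding partial_hom_def
  proof (intro conjI allI impI)
    show "M' \<subseteq> UNIV \<times> carrier G" unfolding M'_def using c partial_homD(1)[OF M] by auto
    show "(0, \<one>) \<in> M'" using I[OF partial_homD(2)[OF M], of 0 0] by simp
  next
    fix x a y b assume "(x, a) \<in> M'" "(y, b) \<in> M'"
    then obtain x' a' i j y' b' k l where
      x: "(x', a') \<in> M" "x = x' + mult_of_nat i z - mult_of_nat j z" "a = a' \<otimes> c [^] (int i - int j)" and
      y: "(y', b') \<in> M" "y = y' + mult_of_nat k z - mult_of_nat l z" "b = b' \<otimes> c [^] (int k - int l)"
      unfolding M'_def by blast
    note cl = partial_homD(1)[OF M x(1)] partial_homD(1)[OF M y(1)]
    have "x - y = (x' - y') + mult_of_nat (i + l) z - mult_of_nat (j + k) z"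
      by (simp add: x y mult_of_nat_add)
    moreover have "int (i + l) - int (j + k) = (int i - int j) - (int k - int l)" by simp
    then have "a \<otimes> inv b = (a' \<otimes> inv b') \<otimes> c [^] (int (i + l) - int (j + k))"
      unfolding x y using cl c by (simp only: int_pow_diff) (simp add: inv_mult m_ac)
    ultimately show "(x - y, a \<otimes> inv b) \<in> M'"
      using I[OF partial_homD(3)[OF M x(1) y(1)], of "i + l" "j + k"] by simp
  next
    fix a assume "(0, a) \<in> M'"
    then obtain x' a' i j where
      x: "(x', a') \<in> M" "0 = x' + mult_of_nat i z - mult_of_nat j z" "a = a' \<otimes> c [^] (int i - int j)"
      unfolding M'_def by blast
    note cl = partial_homD(1)[OF M x(1)]
    show "a = \<one>"
    \<comment> \<open>\<open>cM\<close> speaks of natural multiples of \<open>z\<close>: for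
      \<open>i \<le> j\<close> it is applied to \<open>x'\<close>, otherwise to
      \<open>- x'\<close>.\<close>
    proof (cases "i \<le> j")
      case True
      then have "mult_of_nat j z = mult_of_nat (j - i) z + mult_of_nat i z"
        by (simp flip: mult_of_nat_add)
      then have "x' = mult_of_nat (j - i) z" using x(2) by (simp add: algebra_simps)
      then have "a' = c [^] (j - i)" using x(1) cM by simp
      then have "a' = c [^] (int j - int i)" using True by (simp add: int_pow_int flip: of_nat_diff)
      then show ?thesis unfolding x(3) using c by (simp flip: int_pow_mult)
    next
      case False
      then have "mult_of_nat i z = mult_of_nat (i - j) z + mult_of_nat j z"
        by (simp flip: mult_of_nat_add)
      then have "- x' = mult_of_nat (i - j) z" using x(2) by (simp add: algebra_simps neg_eq_iff_add_eq_0)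
      then have "inv a' = c [^] (i - j)" using partial_homD(5)[OF M x(1)] cM by simp
      then have "inv a' = c [^] (int i - int j)" using False by (simp add: int_pow_int flip: of_nat_diff)
      then show ?thesis unfolding x(3) using cl by (metis r_inv)
    qed
  qed
  moreover have "M \<subseteq> M'"
  proof
    fix u assume "u \<in> M"
    then show "u \<in> M'" using I[of "fst u" "snd u" 0 0] partial_homD(1)[OF M, of "fst u" "snd u"] by simp
  qed
  moreover have "(z, c) \<in> M'" using I[OF partial_homD(2)[OF M], of 1 0] c by (simp add: int_pow_int[of _ 1, simplified])
  ultimately show ?thesis by (rule that)
qed

text \<open>A maximal partial homomorphism is total, because \<open>partial_hom_extend\<close>
  adjoins any given \<open>z\<close> to its domain.\<close>

lemma divisible_extension:
  fixes H :: "('m::ab_group_add \<times> 'a) set"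
  assumes div: "divisible G" and H: "partial_hom G H"
  obtains h where "\<And>x. h x \<in> carrier G" "\<And>x y. h (x + y) = h x \<otimes> h y" "\<And>x a. (x, a) \<in> H \<Longrightarrow> h x = a"
proof -
  let ?A = "{M. partial_hom G M \<and> H \<subseteq> M}"
  have "\<exists>M\<in>?A. \<forall>X\<in>?A. M \<subseteq> X \<longrightarrow> X = M"
  proof (rule subset_Zorn_nonempty)
    show "?A \<noteq> {}" using H by blast
    fix C assume C: "C \<noteq> {}" "subset.chain ?A C"
    have ex: "\<exists>M\<in>C. u \<in> M \<and> v \<in> M" if uv: "u \<in> \<Union>C" "v \<in> \<Union>C" for u v
    proof -
      obtain M where M: "M \<in> C" "u \<in> M" using uv by auto
      obtain N where N: "N \<in> C" "v \<in> N" using uv by auto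
      have "M \<subseteq> N \<or> N \<subseteq> M" using C(2) M N unfolding subset_chain_def by blast
      then show ?thesis using M N by auto
    qed
    have P: "partial_hom G M" if "M \<in> C" for M using that C(2) by (auto simp: subset_chain_def)
    have "partial_hom G (\<Union>C)"
      unfolding partial_hom_def
    proof (intro conjI allI impI)
      show "\<Union>C \<subseteq> UNIV \<times> carrier G" using P partial_homD(1) by fastforce
      show "(0, \<one>) \<in> \<Union>C" using C(1) P partial_homD(2) by blast
      show "a = \<one>" if "(0, a) \<in> \<Union>C" for a using that P partial_homD(4) by blast
      show "(x - y, a \<otimes> inv b) \<in> \<Union>C" if "(x, a) \<in> \<Union>C" "(y, b) \<in> \<Union>C" for x a y b
        using ex[OF that] P partial_homD(3) by blast
    qed
    moreover have "H \<subseteq> \<Union>C"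
    proof -
      obtain M where "M \<in> C" using C(1) by blast
      moreover have "H \<subseteq> M" using calculation C(2) unfolding subset_chain_def by blast
      ultimately show ?thesis by blast
    qed
    ultimately show "\<Union>C \<in> ?A" by blast
  qed
  then obtain M where M: "partial_hom G M" "H \<subseteq> M" and max: "\<And>X. partial_hom G X \<Longrightarrow> M \<subseteq> X \<Longrightarrow> X = M"
    by (smt (verit, best) mem_Collect_eq order.trans)
  have "\<exists>a. (z, a) \<in> M" for z
  proof -
    obtain M' c where "partial_hom G M'" "M \<subseteq> M'" "(z, c) \<in> M'" by (rule partial_hom_extend[OF div M(1)])
    then show ?thesis using max by blast
  qed
  then obtain h where h: "\<And>x. (x, h x) \<in> M" by metis
  show ?thesis
  proof
    show "h x \<in> carrier G" for x using partial_homD(1)[OF M(1) h] .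
    show "h (x + y) = h x \<otimes> h y" for x y
      using partial_homD(6)[OF M(1) h h, of x y] h[of "x + y"] partial_homD(7)[OF M(1)] by blast
    show "h x = a" if "(x, a) \<in> H" for x a using that M(2) h partial_homD(7)[OF M(1)] by blast
  qed
qed

end

text \<open>Stands for the homomorphisms from the quotient by \<open>N\<close> to \<open>I\<close>,
  as functions on representatives. Every group that occurs as a source is then a whole type.\<close>

definition ahom :: "('i, 'b) monoid_scheme \<Rightarrow> 'm::ab_group_add set \<Rightarrow> ('m \<Rightarrow> 'i) set" where
  "ahom I N = {h. (\<forall>x. h x \<in> carrier I) \<and> (\<forall>x y. h (x + y) = h x \<otimes>\<^bsub>I\<^esub> h y) \<and> (\<forall>x\<in>N. h x = \<one>\<^bsub>I\<^esub>)}"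

lemma ahom_closed: "h \<in> ahom I N \<Longrightarrow> h x \<in> carrier I"
  and ahom_add: "h \<in> ahom I N \<Longrightarrow> h (x + y) = h x \<otimes>\<^bsub>I\<^esub> h y"
  and ahom_null: "h \<in> ahom I N \<Longrightarrow> x \<in> N \<Longrightarrow> h x = \<one>\<^bsub>I\<^esub>"
  by (auto simp: ahom_def)

lemma ahom_compose:
  "h \<in> ahom I N' \<Longrightarrow> Modules.additive f \<Longrightarrow> (\<And>x. x \<in> N \<Longrightarrow> f x \<in> N') \<Longrightarrow> (\<lambda>x. h (f x)) \<in> ahom I N"
  by (auto simp: ahom_def additive.add)

context comm_group begin

lemma ahom_zero:
  assumes "h \<in> ahom G N" shows "h 0 = \<one>"
proof -
  have "h 0 \<otimes> h 0 = h 0" using ahom_add[OF assms, of 0 0] by simp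
  then show ?thesis using ahom_closed[OF assms, of 0] by (simp add: r_cancel_one')
qed

lemma ahom_minus:
  assumes "h \<in> ahom G N" shows "h (- x) = inv (h x)"
proof -
  have "h (- x) \<otimes> h x = \<one>" using ahom_add[OF assms, of "- x" x] ahom_zero[OF assms] by simp
  then show ?thesis using ahom_closed[OF assms] by (simp add: inv_equality)
qed

lemma ahom_diff: "h \<in> ahom G N \<Longrightarrow> h (x - y) = h x \<otimes> inv (h y)"
  using ahom_add[of h G N x "- y"] ahom_minus[of h N y] by simp

lemma ahom_mult: "h \<in> ahom G N \<Longrightarrow> k \<in> ahom G N \<Longrightarrow> (\<lambda>x. h x \<otimes> k x) \<in> ahom G N"
  by (auto simp: ahom_def m_ac)

lemma ahom_inv: "h \<in> ahom G N \<Longrightarrow> (\<lambda>x. inv (h x)) \<in> ahom G N"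
  by (auto simp: ahom_def inv_mult)

lemma ahom_eqI:
  assumes "h \<in> ahom G N" "x - y \<in> N" shows "h x = h y"
proof -
  have "h x \<otimes> inv (h y) = \<one>" using ahom_null[OF assms] ahom_diff[OF assms(1)] by simp
  then show ?thesis using ahom_closed[OF assms(1)] by (simp add: inv_solve_right')
qed

lemma ahom_hom: "\<beta> \<in> hom G H \<Longrightarrow> comm_group H \<Longrightarrow> h \<in> ahom G N \<Longrightarrow> (\<lambda>x. \<beta> (h x)) \<in> ahom H N"
  using hom_one[of \<beta> G H] by (auto simp: ahom_def hom_mult comm_group_def dest: hom_in_carrier)

text \<open>The assignment \<open>D m + v\<close> \<mapsto> \<open>\<phi> m\<close> on the subgroup
  generated by the range of \<open>D\<close> and \<open>N\<close> is well defined because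
  \<open>\<phi>\<close> is trivial wherever \<open>D\<close> takes values in \<open>N\<close>. It
  then extends by divisibility. This is how exactness survives the application of Hom.\<close>

lemma ahom_factor:
  assumes div: "divisible G" and D: "Modules.additive D" and N: "add_subgroup N" and \<phi>: "\<phi> \<in> ahom G K"
    and null: "\<And>m. D m \<in> N \<Longrightarrow> \<phi> m = \<one>"
  obtains \<xi> where "\<xi> \<in> ahom G N" "\<And>m. \<xi> (D m) = \<phi> m"
proof -
  define H where "H = {(D m + v, \<phi> m) | m v. v \<in> N}"
  have I: "(D m + v, \<phi> m) \<in> H" if "v \<in> N" for m v using that by (auto simp: H_def)
  have "partial_hom G H"
    unfolding partial_hom_def
  proof (intro conjI allI impI)
    show "H \<subseteq> UNIV \<times> carrier G" using ahom_closed[OF \<phi>] by (auto simp: H_def)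
    show "(0, \<one>) \<in> H"
      using I[of 0 0] add_subgroup_zero[OF N] by (simp add: ahom_zero[OF \<phi>] additive.zero[OF D])
  next
    fix x a y b assume "(x, a) \<in> H" "(y, b) \<in> H"
    then obtain m v m' v' where e: "x = D m + v" "a = \<phi> m" "v \<in> N" "y = D m' + v'" "b = \<phi> m'" "v' \<in> N"
      unfolding H_def by blast
    have "(D (m - m') + (v - v'), \<phi> (m - m')) \<in> H" using I add_subgroup_diff[OF N] e by blast
    then show "(x - y, a \<otimes> inv b) \<in> H"
      by (simp add: e additive.diff[OF D] ahom_diff[OF \<phi>] algebra_simps)
  next
    fix a assume "(0, a) \<in> H"
    then obtain m v where e: "0 = D m + v" "a = \<phi> m" "v \<in> N" unfolding H_def by blast
    have "D m = - v" using e(1) by (simp add: eq_neg_iff_add_eq_0)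
    then show "a = \<one>" using null add_subgroup_uminus[OF N e(3)] e(2) by simp
  qed
  from divisible_extension[OF div this] obtain h where
    h: "\<And>x. h x \<in> carrier G" "\<And>x y. h (x + y) = h x \<otimes> h y" "\<And>x a. (x, a) \<in> H \<Longrightarrow> h x = a" by blast
  show ?thesis
  proof
    show "h (D m) = \<phi> m" for m using h(3) I[of 0 m] add_subgroup_zero[OF N] by simp
    have "h v = \<one>" if "v \<in> N" for v
      using h(3) I[OF that, of 0] by (simp add: ahom_zero[OF \<phi>] additive.zero[OF D])
    then show "h \<in> ahom G N" using h by (simp add: ahom_def)
  qed
qed

end

section \<open>The cone construction applied to the acyclic mapping cone\<close>

locale cochain_system_coeff = cochain_system \<Lambda> leq dA dC p q NA NC
  for \<Lambda> :: "'l set" and leq :: "'l \<Rightarrow> 'l \<Rightarrow> bool"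
    and dA :: "'x::ab_group_add \<Rightarrow> 'x" and dC :: "'l \<Rightarrow> 'y::ab_group_add \<Rightarrow> 'y"
    and p :: "'l \<Rightarrow> 'l \<Rightarrow> 'y \<Rightarrow> 'y" and q :: "'l \<Rightarrow> 'y \<Rightarrow> 'x"
    and NA :: "int \<Rightarrow> 'x set" and NC :: "'l \<Rightarrow> int \<Rightarrow> 'y set" +
  fixes I0 :: "'i monoid" and \<beta> :: "'i \<Rightarrow> 'j" and I1 :: "'j monoid"
  assumes div0: "divisible I0" and div1: "divisible I1" and \<beta>: "\<beta> \<in> hom I0 I1"
begin

sublocale I0: comm_group I0 using div0 by (simp add: divisible_def)
sublocale I1: comm_group I1 using div1 by (simp add: divisible_def)

text \<open>The differential of the mapping cone of \<open>fB\<close>, whose degree \<open>n\<close>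
  part pairs cochains of degree \<open>n - 1\<close> of the space with elements of degree
  \<open>n\<close> of the direct sum.\<close>

definition DM :: "int \<Rightarrow> 'x \<times> ('l list \<Rightarrow>\<^sub>0 'y) \<Rightarrow> 'x \<times> ('l list \<Rightarrow>\<^sub>0 'y)" where
  "DM n m = (fB (snd m) - dA (fst m), DB n (snd m))"

definition NM :: "int \<Rightarrow> ('x \<times> ('l list \<Rightarrow>\<^sub>0 'y)) set" where
  "NM n = NA (n - 1) \<times> NB n"

lemma additive_DM: "Modules.additive (DM n)"
  by unfold_locales (simp add: DM_def additive.add[OF additive_fB] additive.add[OF add_dA] additive.add[OF additive_DB])

lemma NM: "add_subgroup (NM n)"
  using NA NB by (auto simp: add_subgroup_def NM_def zero_prod_def)

lemma exact_M: "DM n m \<in> NM (n + 1) \<Longrightarrow> \<exists>m'. m - DM (n - 1) m' \<in> NM n"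
  using exact[of n "snd m" "fst m"] by (cases m) (auto simp: DM_def NM_def)

lemma \<beta>_closed: "x \<in> carrier I0 \<Longrightarrow> \<beta> x \<in> carrier I1"
  using \<beta> by (auto simp: hom_def)

lemma \<beta>_mult: "x \<in> carrier I0 \<Longrightarrow> y \<in> carrier I0 \<Longrightarrow> \<beta> (x \<otimes>\<^bsub>I0\<^esub> y) = \<beta> x \<otimes>\<^bsub>I1\<^esub> \<beta> y"
  using \<beta> by (auto simp: hom_def)

lemma \<beta>_one: "\<beta> \<one>\<^bsub>I0\<^esub> = \<one>\<^bsub>I1\<^esub>"
  using hom_one[OF \<beta> I0.is_group I1.is_group] .

lemma \<beta>_inv: "x \<in> carrier I0 \<Longrightarrow> \<beta> (inv\<^bsub>I0\<^esub> x) = inv\<^bsub>I1\<^esub> (\<beta> x)"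
  using group_hom.hom_inv[of I0 I1 \<beta> x] \<beta> I0.is_group I1.is_group by (simp add: group_hom_def group_hom_axioms_def)

lemma \<beta>_ahom: "h \<in> ahom I0 N \<Longrightarrow> (\<lambda>x. \<beta> (h x)) \<in> ahom I1 N"
  by (rule I0.ahom_hom[OF \<beta> I1.comm_group_axioms])

text \<open>A cycle bounds, and the two components are solved in turn. \<open>\<phi>'\<close> is
  trivial on coboundaries, hence by exactness on cocycles, and factors through \<open>DM\<close>.
  The resulting error \<open>\<theta>\<close> in the second component is again trivial on
  coboundaries, by the second cycle condition, and factors in the same way.\<close>

lemma cone_exact:
  assumes \<phi>': "\<phi>' \<in> ahom I0 (NM n)" and \<phi>'': "\<phi>'' \<in> ahom I1 (NM (n + 1))"
    and 1: "\<And>m. \<phi>' (DM (n - 1) m) = \<one>\<^bsub>I0\<^esub>" and 2: "\<And>m. \<beta> (\<phi>' m) = \<phi>'' (DM n m)"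
  obtains \<xi>' \<xi>'' where "\<xi>' \<in> ahom I0 (NM (n + 1))" "\<xi>'' \<in> ahom I1 (NM (n + 2))"
    "\<And>m. \<phi>' m = \<xi>' (DM n m)" "\<And>m. \<phi>'' m = \<beta> (\<xi>' m) \<otimes>\<^bsub>I1\<^esub> inv\<^bsub>I1\<^esub> (\<xi>'' (DM (n + 1) m))"
proof -
  have "\<phi>' m = \<one>\<^bsub>I0\<^esub>" if "DM n m \<in> NM (n + 1)" for m
    using exact_M[OF that] I0.ahom_eqI[OF \<phi>'] 1 by metis
  then obtain \<xi>' where \<xi>': "\<xi>' \<in> ahom I0 (NM (n + 1))" "\<And>m. \<xi>' (DM n m) = \<phi>' m"
    using I0.ahom_factor[OF div0 additive_DM NM \<phi>'] by blast
  define \<theta> where "\<theta> m = \<phi>'' m \<otimes>\<^bsub>I1\<^esub> inv\<^bsub>I1\<^esub> (\<beta> (\<xi>' m))" for m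
  have \<theta>: "\<theta> \<in> ahom I1 (NM (n + 1))"
    unfolding \<theta>_def by (intro I1.ahom_mult I1.ahom_inv \<beta>_ahom \<phi>'' \<xi>')
  have "\<theta> m = \<one>\<^bsub>I1\<^esub>" if m: "DM (n + 1) m \<in> NM (n + 2)" for m
  proof -
    obtain m' where "m - DM n m' \<in> NM (n + 1)" using exact_M[of "n + 1" m] m by (auto simp: add.commute[of 2 n])
    then have "\<theta> m = \<theta> (DM n m')" by (rule I1.ahom_eqI[OF \<theta>])
    also have "\<dots> = \<one>\<^bsub>I1\<^esub>" using ahom_closed[OF \<phi>''] by (simp add: \<theta>_def \<xi>' 2)
    finally show ?thesis .
  qed
  then obtain \<omega> where \<omega>: "\<omega> \<in> ahom I1 (NM (n + 2))" "\<And>m. \<omega> (DM (n + 1) m) = \<theta> m"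
    using I1.ahom_factor[OF div1 additive_DM NM \<theta>] by blast
  show ?thesis
  proof
    \<comment> \<open>The boundary of the cone divides by the second component, so the primitive
      contains the inverse of \<open>\<omega>\<close>.\<close>
    show "\<phi>'' m = \<beta> (\<xi>' m) \<otimes>\<^bsub>I1\<^esub> inv\<^bsub>I1\<^esub> (inv\<^bsub>I1\<^esub> (\<omega> (DM (n + 1) m)))" for m
      using ahom_closed[OF \<phi>''] ahom_closed[OF \<xi>'(1)] \<beta>_closed
      by (simp add: \<omega> \<theta>_def I1.m_lcomm[of "\<beta> _" "\<phi>'' _"])
  qed (use \<xi>' \<omega> I1.ahom_inv in auto)
qed

lemma additive_Pair0: "Modules.additive (\<lambda>a. (a, 0))"
  and additive_Pair1: "Modules.additive (\<lambda>b. (0, b))"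
  and additive_fst: "Modules.additive fst" and additive_snd: "Modules.additive snd"
  by (simp_all add: Modules.additive_def)

text \<open>Surjectivity in homology. Composed with the projection \<open>snd\<close> of the mapping
  cone, a cycle of the direct sum becomes a cycle of an acyclic complex. The restriction of a
  primitive to the first summand yields a cycle of the space, and its restriction to the second
  shows that this cycle maps to the class of the given one.\<close>

lemma cone_surj:
  assumes c: "c' \<in> ahom I0 (NB n)" "c'' \<in> ahom I1 (NB (n + 1))"
    and 1: "\<And>b. c' (DB (n - 1) b) = \<one>\<^bsub>I0\<^esub>" and 2: "\<And>b. \<beta> (c' b) = c'' (DB n b)"
  obtains \<psi>' \<psi>'' t' t'' where "\<psi>' \<in> ahom I0 (NA n)" "\<psi>'' \<in> ahom I1 (NA (n + 1))"
    "t' \<in> ahom I0 (NB (n + 1))" "t'' \<in> ahom I1 (NB (n + 2))"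
    "\<forall>a. \<psi>' (dA a) = \<one>\<^bsub>I0\<^esub>" "\<forall>a. \<beta> (\<psi>' a) = \<psi>'' (dA a)"
    "\<forall>b. c' b = \<psi>' (fB b) \<otimes>\<^bsub>I0\<^esub> t' (DB n b)"
    "\<forall>b. c'' b = \<psi>'' (fB b) \<otimes>\<^bsub>I1\<^esub> (\<beta> (t' b) \<otimes>\<^bsub>I1\<^esub> inv\<^bsub>I1\<^esub> (t'' (DB (n + 1) b)))"
proof -
  have "(\<lambda>m. c' (snd m)) \<in> ahom I0 (NM n)" "(\<lambda>m. c'' (snd m)) \<in> ahom I1 (NM (n + 1))"
    by (auto intro: ahom_compose[OF c(1) additive_snd] ahom_compose[OF c(2) additive_snd] simp: NM_def)
  then obtain \<xi>' \<xi>'' where \<xi>: "\<xi>' \<in> ahom I0 (NM (n + 1))" "\<xi>'' \<in> ahom I1 (NM (n + 2))" and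
    e: "\<And>m. c' (snd m) = \<xi>' (DM n m)" "\<And>m. c'' (snd m) = \<beta> (\<xi>' m) \<otimes>\<^bsub>I1\<^esub> inv\<^bsub>I1\<^esub> (\<xi>'' (DM (n + 1) m))"
    by (rule cone_exact) (auto simp: DM_def 1 2)
  note cl = ahom_closed[OF \<xi>(1)] ahom_closed[OF \<xi>(2)] \<beta>_closed
  define \<psi>' where "\<psi>' a = \<xi>' (a, 0)" for a
  \<comment> \<open>The inverse compensates the sign of \<open>dA\<close> in \<open>DM\<close> and
    that of the second component in the boundary of the cone.\<close>
  define \<psi>'' where "\<psi>'' a = inv\<^bsub>I1\<^esub> (\<xi>'' (a, 0))" for a
  define t' where "t' b = \<xi>' (0, b)" for b
  define t'' where "t'' b = \<xi>'' (0, b)" for b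
  have s': "\<xi>' (a, b) = \<psi>' a \<otimes>\<^bsub>I0\<^esub> t' b" for a b
    using ahom_add[OF \<xi>(1), of "(a, 0)" "(0, b)"] by (simp add: \<psi>'_def t'_def)
  have s'': "\<xi>'' (a, b) = inv\<^bsub>I1\<^esub> (\<psi>'' a) \<otimes>\<^bsub>I1\<^esub> t'' b" for a b
    using ahom_add[OF \<xi>(2), of "(a, 0)" "(0, b)"] cl by (simp add: \<psi>''_def t''_def)
  have h: "\<psi>' \<in> ahom I0 (NA n)" "\<psi>'' \<in> ahom I1 (NA (n + 1))" "t' \<in> ahom I0 (NB (n + 1))" "t'' \<in> ahom I1 (NB (n + 2))"
    unfolding \<psi>'_def[abs_def] \<psi>''_def[abs_def] t'_def[abs_def] t''_def[abs_def]
    by (auto intro!: I1.ahom_inv ahom_compose[OF \<xi>(1) additive_Pair0] ahom_compose[OF \<xi>(2) additive_Pair0]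
        ahom_compose[OF \<xi>(1) additive_Pair1] ahom_compose[OF \<xi>(2) additive_Pair1]
        simp: NM_def add_subgroup_zero[OF NA] add_subgroup_zero[OF NB] add.commute[of 1 n] add.commute[of 2 n])
  note z = I0.ahom_zero[OF c(1)] I1.ahom_zero[OF c(2)] I0.ahom_zero[OF h(1)] I1.ahom_zero[OF h(2)]
    I0.ahom_zero[OF h(3)] I1.ahom_zero[OF h(4)]
    additive.zero[OF additive_fB] additive.zero[OF add_dA] additive.zero[OF additive_DB]
  note hc = ahom_closed[OF h(1)] ahom_closed[OF h(2)] ahom_closed[OF h(3)] ahom_closed[OF h(4)]
  show ?thesis
  proof (rule that[OF h]; intro allI)
    fix a
    have "\<one>\<^bsub>I0\<^esub> = \<psi>' (- dA a)" using e(1)[of "(a, 0)"] hc by (simp add: DM_def z s')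
    then have "\<one>\<^bsub>I0\<^esub> = inv\<^bsub>I0\<^esub> (\<psi>' (dA a))" by (simp add: I0.ahom_minus[OF h(1)])
    then show "\<psi>' (dA a) = \<one>\<^bsub>I0\<^esub>" using hc(1) by (metis I0.inv_inv I0.inv_one)
    have "\<one>\<^bsub>I1\<^esub> = \<beta> (\<psi>' a) \<otimes>\<^bsub>I1\<^esub> \<psi>'' (- dA a)" using e(2)[of "(a, 0)"] hc by (simp add: DM_def z s' s'')
    then have "\<one>\<^bsub>I1\<^esub> = \<beta> (\<psi>' a) \<otimes>\<^bsub>I1\<^esub> inv\<^bsub>I1\<^esub> (\<psi>'' (dA a))" by (simp add: I1.ahom_minus[OF h(2)])
    then show "\<beta> (\<psi>' a) = \<psi>'' (dA a)" using hc \<beta>_closed by (metis I1.inv_solve_right' I1.l_one I1.one_closed)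
  next
    fix b
    show "c' b = \<psi>' (fB b) \<otimes>\<^bsub>I0\<^esub> t' (DB n b)" using e(1)[of "(0, b)"] by (simp add: DM_def z s')
    show "c'' b = \<psi>'' (fB b) \<otimes>\<^bsub>I1\<^esub> (\<beta> (t' b) \<otimes>\<^bsub>I1\<^esub> inv\<^bsub>I1\<^esub> (t'' (DB (n + 1) b)))"
      using e(2)[of "(0, b)"] hc \<beta>_closed by (simp add: DM_def z s' s'' I1.inv_mult I1.m_ac)
  qed
qed

text \<open>Injectivity in homology. If the image of the cycle \<open>\<psi>\<close> bounds
  \<open>t\<close>, then \<open>\<psi>\<close> on the first summand and \<open>t\<close> on the
  second combine, with signs, to a cycle of the mapping cone one degree higher. A primitive of it
  restricts to a primitive of \<open>\<psi>\<close>.\<close>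

lemma cone_inj:
  assumes \<psi>: "\<psi>' \<in> ahom I0 (NA n)" "\<psi>'' \<in> ahom I1 (NA (n + 1))"
    and t: "t' \<in> ahom I0 (NB (n + 1))" "t'' \<in> ahom I1 (NB (n + 2))"
    and 1: "\<And>a. \<psi>' (dA a) = \<one>\<^bsub>I0\<^esub>" "\<And>a. \<beta> (\<psi>' a) = \<psi>'' (dA a)"
    and 2: "\<And>b. \<psi>' (fB b) = t' (DB n b)" "\<And>b. \<psi>'' (fB b) = \<beta> (t' b) \<otimes>\<^bsub>I1\<^esub> inv\<^bsub>I1\<^esub> (t'' (DB (n + 1) b))"
  obtains \<omega>' \<omega>'' where "\<omega>' \<in> ahom I0 (NA (n + 1))" "\<omega>'' \<in> ahom I1 (NA (n + 2))"
    "\<And>a. \<psi>' a = \<omega>' (dA a)" "\<And>a. \<psi>'' a = \<beta> (\<omega>' a) \<otimes>\<^bsub>I1\<^esub> inv\<^bsub>I1\<^esub> (\<omega>'' (dA a))"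
proof -
  define \<phi>' where "\<phi>' m = \<psi>' (fst m) \<otimes>\<^bsub>I0\<^esub> inv\<^bsub>I0\<^esub> (t' (snd m))" for m
  define \<phi>'' where "\<phi>'' m = inv\<^bsub>I1\<^esub> (\<psi>'' (fst m)) \<otimes>\<^bsub>I1\<^esub> inv\<^bsub>I1\<^esub> (t'' (snd m))" for m
  note hc = ahom_closed[OF \<psi>(1)] ahom_closed[OF \<psi>(2)] ahom_closed[OF t(1)] ahom_closed[OF t(2)] \<beta>_closed
  have \<phi>: "\<phi>' \<in> ahom I0 (NM (n + 1))" "\<phi>'' \<in> ahom I1 (NM (n + 1 + 1))"
    unfolding \<phi>'_def[abs_def] \<phi>''_def[abs_def]
    by (auto intro!: I0.ahom_mult I1.ahom_mult I0.ahom_inv I1.ahom_inv ahom_compose[OF \<psi>(1) additive_fst]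
       ahom_compose[OF \<psi>(2) additive_fst] ahom_compose[OF t(1) additive_snd] ahom_compose[OF t(2) additive_snd]
       simp: NM_def add.commute[of 1 n] add.commute[of 2 n])
  have \<phi>1: "\<phi>' (DM (n + 1 - 1) m) = \<one>\<^bsub>I0\<^esub>" for m
    using hc by (simp add: \<phi>'_def DM_def I0.ahom_diff[OF \<psi>(1)] 1 2)
  have \<phi>2: "\<beta> (\<phi>' m) = \<phi>'' (DM (n + 1) m)" for m
    using hc by (simp add: \<phi>'_def \<phi>''_def DM_def I1.ahom_diff[OF \<psi>(2)] 2 \<beta>_mult \<beta>_inv I1.inv_mult I1.m_ac flip: 1(2))
  obtain \<xi>' \<xi>'' where \<xi>: "\<xi>' \<in> ahom I0 (NM (n + 2))" "\<xi>'' \<in> ahom I1 (NM (n + 3))" and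
    e: "\<And>m. \<phi>' m = \<xi>' (DM (n + 1) m)" "\<And>m. \<phi>'' m = \<beta> (\<xi>' m) \<otimes>\<^bsub>I1\<^esub> inv\<^bsub>I1\<^esub> (\<xi>'' (DM (n + 2) m))"
    using cone_exact[OF \<phi> \<phi>1 \<phi>2] by (auto simp: add.assoc)
  note cl = ahom_closed[OF \<xi>(1)] ahom_closed[OF \<xi>(2)] \<beta>_closed
  note z = I0.ahom_zero[OF \<psi>(1)] I1.ahom_zero[OF \<psi>(2)] I0.ahom_zero[OF t(1)] I1.ahom_zero[OF t(2)]
    additive.zero[OF additive_fB] additive.zero[OF add_dA] additive.zero[OF additive_DB]
  define \<omega>' where "\<omega>' a = inv\<^bsub>I0\<^esub> (\<xi>' (a, 0))" for a
  define \<omega>'' where "\<omega>'' a = \<xi>'' (a, 0)" for a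
  have h: "\<omega>' \<in> ahom I0 (NA (n + 1))" "\<omega>'' \<in> ahom I1 (NA (n + 2))"
    unfolding \<omega>'_def[abs_def] \<omega>''_def[abs_def]
    by (auto intro!: I0.ahom_inv ahom_compose[OF \<xi>(1) additive_Pair0] ahom_compose[OF \<xi>(2) additive_Pair0]
        simp: NM_def add_subgroup_zero[OF NB] add.commute[of 1 n] add.commute[of 2 n])
  show ?thesis
  proof (rule that[OF h])
    fix a
    have "\<psi>' a = \<xi>' (- dA a, 0)" using e(1)[of "(a, 0)"] hc by (simp add: DM_def \<phi>'_def z)
    also have "(- dA a, 0::'l list \<Rightarrow>\<^sub>0 'y) = - (dA a, 0)" by simp
    also have "\<xi>' \<dots> = \<omega>' (dA a)" by (simp only: I0.ahom_minus[OF \<xi>(1)] \<omega>'_def)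
    finally show "\<psi>' a = \<omega>' (dA a)" .
    have "inv\<^bsub>I1\<^esub> (\<psi>'' a) = \<beta> (\<xi>' (a, 0)) \<otimes>\<^bsub>I1\<^esub> inv\<^bsub>I1\<^esub> (\<xi>'' (- dA a, 0))"
      using e(2)[of "(a, 0)"] hc by (simp add: DM_def \<phi>''_def z)
    also have "(- dA a, 0::'l list \<Rightarrow>\<^sub>0 'y) = - (dA a, 0)" by simp
    also have "inv\<^bsub>I1\<^esub> (\<xi>'' \<dots>) = \<omega>'' (dA a)" using cl by (simp only: I1.ahom_minus[OF \<xi>(2)] \<omega>''_def I1.inv_inv)
    finally have "inv\<^bsub>I1\<^esub> (inv\<^bsub>I1\<^esub> (\<psi>'' a)) = inv\<^bsub>I1\<^esub> (\<beta> (\<xi>' (a, 0)) \<otimes>\<^bsub>I1\<^esub> \<omega>'' (dA a))" by simp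
    then show "\<psi>'' a = \<beta> (\<omega>' a) \<otimes>\<^bsub>I1\<^esub> inv\<^bsub>I1\<^esub> (\<omega>'' (dA a))"
      using hc cl ahom_closed[OF h(2)] by (simp add: \<omega>'_def \<beta>_inv I1.inv_mult)
  qed
qed

end

section \<open>Isomorphisms of homology from evaluations on representatives\<close>

lemma (in comm_group) subgroup_comm_group:
  assumes "subgroup H G" shows "comm_group (G\<lparr>carrier := H\<rparr>)"
proof (rule group.group_comm_groupI)
  show "group (G\<lparr>carrier := H\<rparr>)" using assms by (rule subgroup_imp_group)
qed (use subgroup.subset[OF assms] in \<open>auto intro: m_comm\<close>)

text \<open>The first isomorphism theorem for the map from the cycles of \<open>K\<close> to the
  homology of \<open>L\<close>, whose kernel is the group of boundaries of \<open>K\<close>. The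
  equivalence in \<open>inj\<close> gives well-definedness and injectivity at once, so only degree
  \<open>n\<close> of the chain map is needed.\<close>

lemma homology_iso:
  fixes K :: "'a graded_complex" and L :: "'b graded_complex"
  assumes K: "comm_group (grp K n)" "comm_group (grp K (n - 1))"
    and L: "comm_group (grp L (n + 1))" "comm_group (grp L n)" "comm_group (grp L (n - 1))"
    and dK: "diff K n \<in> hom (grp K n) (grp K (n - 1))"
    and dL: "diff L n \<in> hom (grp L n) (grp L (n - 1))" "diff L (n + 1) \<in> hom (grp L (n + 1)) (grp L n)"
    and ddL: "\<And>t. t \<in> carrier (grp L (n + 1)) \<Longrightarrow> diff L n (diff L (n + 1) t) = \<one>\<^bsub>grp L (n - 1)\<^esub>"
    and ddK: "\<And>t. t \<in> carrier (grp K (n + 1)) \<Longrightarrow> diff K (n + 1) t \<in> kernel (grp K n) (grp K (n - 1)) (diff K n)"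
    and \<Phi>: "\<Phi> \<in> hom (grp K n) (grp L n)"
    and cyc: "\<And>x. x \<in> kernel (grp K n) (grp K (n - 1)) (diff K n) \<Longrightarrow> \<Phi> x \<in> kernel (grp L n) (grp L (n - 1)) (diff L n)"
    and inj: "\<And>x. x \<in> kernel (grp K n) (grp K (n - 1)) (diff K n) \<Longrightarrow>
       \<Phi> x \<in> diff L (n + 1) ` carrier (grp L (n + 1)) \<longleftrightarrow> x \<in> diff K (n + 1) ` carrier (grp K (n + 1))"
    and surj: "\<And>y. y \<in> kernel (grp L n) (grp L (n - 1)) (diff L n) \<Longrightarrow>
       \<exists>x \<in> kernel (grp K n) (grp K (n - 1)) (diff K n). \<exists>t\<in>carrier (grp L (n + 1)). y = diff L (n + 1) t \<otimes>\<^bsub>grp L n\<^esub> \<Phi> x"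
  shows "homology K n \<cong> homology L n"
proof -
  interpret K: comm_group "grp K n" by (rule K)
  interpret L: comm_group "grp L n" by (rule L)
  interpret dK: group_hom "grp K n" "grp K (n - 1)" "diff K n"
    using K dK by (simp add: group_hom_def group_hom_axioms_def comm_group_def)
  interpret dL: group_hom "grp L n" "grp L (n - 1)" "diff L n"
    using L dL by (simp add: group_hom_def group_hom_axioms_def comm_group_def)
  interpret dL1: group_hom "grp L (n + 1)" "grp L n" "diff L (n + 1)"
    using L dL by (simp add: group_hom_def group_hom_axioms_def comm_group_def)
  define ZK where "ZK = (grp K n)\<lparr>carrier := kernel (grp K n) (grp K (n - 1)) (diff K n)\<rparr>"
  define ZL where "ZL = (grp L n)\<lparr>carrier := kernel (grp L n) (grp L (n - 1)) (diff L n)\<rparr>"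
  define B where "B = diff L (n + 1) ` carrier (grp L (n + 1))"
  have subK: "subgroup (kernel (grp K n) (grp K (n - 1)) (diff K n)) (grp K n)" by (rule dK.subgroup_kernel)
  have subL: "subgroup (kernel (grp L n) (grp L (n - 1)) (diff L n)) (grp L n)" by (rule dL.subgroup_kernel)
  interpret ZK: comm_group ZK unfolding ZK_def by (rule K.subgroup_comm_group[OF subK]) 
  interpret ZL: comm_group ZL unfolding ZL_def by (rule L.subgroup_comm_group[OF subL])
  have "B \<subseteq> kernel (grp L n) (grp L (n - 1)) (diff L n)"
    using ddL by (auto simp: B_def kernel_def)
  moreover have "subgroup B (grp L n)" unfolding B_def by (rule dL1.img_is_subgroup)
  ultimately have "subgroup B ZL" unfolding ZL_def using subL L.subgroup_incl by blast
  then have nB: "B \<lhd> ZL" by (simp add: ZL.normal_iff_subgroup)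
  interpret nB: normal B ZL by (rule nB)
  have \<Phi>Z: "\<Phi> \<in> hom ZK ZL"
    using \<Phi> cyc unfolding hom_def ZK_def ZL_def by (auto simp: kernel_def)
  define h where "h x = B #>\<^bsub>ZL\<^esub> \<Phi> x" for x
  have h: "h \<in> hom ZK (ZL Mod B)"
    using hom_compose[OF \<Phi>Z nB.r_coset_hom_Mod] by (simp add: h_def[abs_def] o_def)
  interpret h: group_hom ZK "ZL Mod B" h
    using h ZK.is_group nB.factorgroup_is_group by (simp add: group_hom_def group_hom_axioms_def)
  have "h ` carrier ZK = carrier (ZL Mod B)"
  proof
    show "h ` carrier ZK \<subseteq> carrier (ZL Mod B)" using h by (auto simp: hom_def)
    show "carrier (ZL Mod B) \<subseteq> h ` carrier ZK"
    proof
      fix c assume "c \<in> carrier (ZL Mod B)"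
      then obtain y where y: "y \<in> carrier ZL" "c = B #>\<^bsub>ZL\<^esub> y" by (auto simp: carrier_FactGroup)
      have "y \<in> kernel (grp L n) (grp L (n - 1)) (diff L n)" using y by (simp add: ZL_def)
      from surj[OF this] obtain x t where x: "x \<in> carrier ZK" "t \<in> carrier (grp L (n + 1))" "y = diff L (n + 1) t \<otimes>\<^bsub>grp L n\<^esub> \<Phi> x"
        by (auto simp: ZK_def)
      have "y \<in> B #>\<^bsub>ZL\<^esub> \<Phi> x" using x by (auto simp: r_coset_def ZL_def B_def)
      moreover have "\<Phi> x \<in> carrier ZL" using x \<Phi>Z by (auto simp: hom_def)
      ultimately have "c = h x"
        using ZL.repr_independence[of y B "\<Phi> x"] \<open>subgroup B ZL\<close> y by (simp add: h_def)
      then show "c \<in> h ` carrier ZK" using x by blast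
    qed
  qed
  moreover have "kernel ZK (ZL Mod B) h = diff K (n + 1) ` carrier (grp K (n + 1))"
  proof -
    have "h x = B \<longleftrightarrow> \<Phi> x \<in> B" if "x \<in> carrier ZK" for x
    proof -
      have px: "\<Phi> x \<in> carrier ZL" using that \<Phi>Z by (auto simp: hom_def)
      show ?thesis
        using ZL.coset_join1[of B "\<Phi> x"] ZL.coset_join2[of "\<Phi> x" B] \<open>subgroup B ZL\<close> px nB.subset
        by (auto simp: h_def)
    qed
    then have "kernel ZK (ZL Mod B) h = {x \<in> carrier ZK. \<Phi> x \<in> B}" by (auto simp: kernel_def)
    also have "\<dots> = {x \<in> carrier ZK. x \<in> diff K (n + 1) ` carrier (grp K (n + 1))}"
      using inj by (auto simp: ZK_def B_def)
    also have "\<dots> = diff K (n + 1) ` carrier (grp K (n + 1))" using ddK by (auto simp: ZK_def)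
    finally show ?thesis .
  qed
  ultimately show ?thesis using h.FactGroup_iso by (simp add: homology_def ZK_def ZL_def B_def)
qed

text \<open>The functions \<open>ev1\<close> and \<open>ev2\<close> are the two components of a chain, viewed as homomorphisms on
  representatives of cochains.\<close>

locale cone_like =
  fixes I0 :: "'i monoid" and \<beta> :: "'i \<Rightarrow> 'j" and I1 :: "'j monoid" and L :: "'c graded_complex"
    and ev1 :: "int \<Rightarrow> 'c \<Rightarrow> 'z::ab_group_add \<Rightarrow> 'i" and ev2 :: "int \<Rightarrow> 'c \<Rightarrow> 'z \<Rightarrow> 'j"
    and N :: "int \<Rightarrow> 'z set" and D :: "int \<Rightarrow> 'z \<Rightarrow> 'z"
  assumes I0: "comm_group I0" and I1: "comm_group I1" and \<beta>: "\<beta> \<in> hom I0 I1"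
    and grp_L: "\<And>n. comm_group (grp L n)"
    and ev1: "\<And>n c. c \<in> carrier (grp L n) \<Longrightarrow> ev1 n c \<in> ahom I0 (N n)"
    and ev2: "\<And>n c. c \<in> carrier (grp L n) \<Longrightarrow> ev2 n c \<in> ahom I1 (N (n + 1))"
    and ev1_mult: "\<And>n c c' x. \<lbrakk>c \<in> carrier (grp L n); c' \<in> carrier (grp L n)\<rbrakk> \<Longrightarrow>
        ev1 n (c \<otimes>\<^bsub>grp L n\<^esub> c') x = ev1 n c x \<otimes>\<^bsub>I0\<^esub> ev1 n c' x"
    and ev2_mult: "\<And>n c c' x. \<lbrakk>c \<in> carrier (grp L n); c' \<in> carrier (grp L n)\<rbrakk> \<Longrightarrow>
        ev2 n (c \<otimes>\<^bsub>grp L n\<^esub> c') x = ev2 n c x \<otimes>\<^bsub>I1\<^esub> ev2 n c' x"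
    and ev_eqI: "\<And>n c c'. \<lbrakk>c \<in> carrier (grp L n); c' \<in> carrier (grp L n); \<And>x. ev1 n c x = ev1 n c' x;
        \<And>x. ev2 n c x = ev2 n c' x\<rbrakk> \<Longrightarrow> c = c'"
    and ev_ex: "\<And>n u v. \<lbrakk>u \<in> ahom I0 (N n); v \<in> ahom I1 (N (n + 1))\<rbrakk> \<Longrightarrow>
        \<exists>c\<in>carrier (grp L n). (\<forall>x. ev1 n c x = u x) \<and> (\<forall>x. ev2 n c x = v x)"
    and diff_closed: "\<And>n c. c \<in> carrier (grp L n) \<Longrightarrow> diff L n c \<in> carrier (grp L (n - 1))"
    and ev1_diff: "\<And>n c x. c \<in> carrier (grp L n) \<Longrightarrow> ev1 (n - 1) (diff L n c) x = ev1 n c (D (n - 1) x)"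
    and ev2_diff: "\<And>n c x. c \<in> carrier (grp L n) \<Longrightarrow>
        ev2 (n - 1) (diff L n c) x = \<beta> (ev1 n c x) \<otimes>\<^bsub>I1\<^esub> inv\<^bsub>I1\<^esub> (ev2 n c (D n x))"
    and D_D: "\<And>n x. D (n + 1) (D n x) = 0"
begin

sublocale I0: comm_group I0 by (rule I0)
sublocale I1: comm_group I1 by (rule I1)

lemma ev_closed: "c \<in> carrier (grp L n) \<Longrightarrow> ev1 n c x \<in> carrier I0" "c \<in> carrier (grp L n) \<Longrightarrow> ev2 n c x \<in> carrier I1"
  using ahom_closed ev1 ev2 by blast+

lemma \<beta>_closed: "x \<in> carrier I0 \<Longrightarrow> \<beta> x \<in> carrier I1"
  using \<beta> by (auto simp: hom_def)

lemma one_closed: "\<one>\<^bsub>grp L n\<^esub> \<in> carrier (grp L n)"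
  using grp_L by (simp add: comm_group_def group.is_monoid)

lemma mult_closed: "\<lbrakk>c \<in> carrier (grp L n); c' \<in> carrier (grp L n)\<rbrakk> \<Longrightarrow> c \<otimes>\<^bsub>grp L n\<^esub> c' \<in> carrier (grp L n)"
  using grp_L by (simp add: comm_group_def group.is_monoid monoid.m_closed)

lemma ev_one: "ev1 n \<one>\<^bsub>grp L n\<^esub> x = \<one>\<^bsub>I0\<^esub>" "ev2 n \<one>\<^bsub>grp L n\<^esub> x = \<one>\<^bsub>I1\<^esub>"
proof -
  interpret L: comm_group "grp L n" by (rule grp_L)
  show "ev1 n \<one>\<^bsub>grp L n\<^esub> x = \<one>\<^bsub>I0\<^esub>"
    using ev1_mult[of "\<one>\<^bsub>grp L n\<^esub>" n "\<one>\<^bsub>grp L n\<^esub>" x] ev_closed(1)[of "\<one>\<^bsub>grp L n\<^esub>" n x]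
    by (simp add: I0.l_cancel_one)
  show "ev2 n \<one>\<^bsub>grp L n\<^esub> x = \<one>\<^bsub>I1\<^esub>"
    using ev2_mult[of "\<one>\<^bsub>grp L n\<^esub>" n "\<one>\<^bsub>grp L n\<^esub>" x] ev_closed(2)[of "\<one>\<^bsub>grp L n\<^esub>" n x]
    by (simp add: I1.l_cancel_one)
qed

lemma diff_hom: "diff L n \<in> hom (grp L n) (grp L (n - 1))"
proof (rule homI)
  fix c c' assume c: "c \<in> carrier (grp L n)" "c' \<in> carrier (grp L n)"
  note m = mult_closed[OF c]
  show "diff L n (c \<otimes>\<^bsub>grp L n\<^esub> c') = diff L n c \<otimes>\<^bsub>grp L (n - 1)\<^esub> diff L n c'"
  proof (rule ev_eqI)
    fix x
    show "ev1 (n - 1) (diff L n (c \<otimes>\<^bsub>grp L n\<^esub> c')) x = ev1 (n - 1) (diff L n c \<otimes>\<^bsub>grp L (n - 1)\<^esub> diff L n c') x"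
      using c m by (simp add: ev1_diff ev1_mult diff_closed)
    have "\<beta> (ev1 n c x \<otimes>\<^bsub>I0\<^esub> ev1 n c' x) = \<beta> (ev1 n c x) \<otimes>\<^bsub>I1\<^esub> \<beta> (ev1 n c' x)"
      using \<beta> ev_closed c by (auto simp: hom_def)
    then show "ev2 (n - 1) (diff L n (c \<otimes>\<^bsub>grp L n\<^esub> c')) x = ev2 (n - 1) (diff L n c \<otimes>\<^bsub>grp L (n - 1)\<^esub> diff L n c') x"
      using c m by (simp add: ev1_diff ev2_diff ev1_mult ev2_mult diff_closed ev_closed \<beta>_closed I1.inv_mult I1.m_ac)
  qed (use c m mult_closed diff_closed in auto)
qed (rule diff_closed)

lemma cycle_iff:
  assumes c: "c \<in> carrier (grp L n)"
  shows "c \<in> kernel (grp L n) (grp L (n - 1)) (diff L n) \<longleftrightarrow>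
    (\<forall>x. ev1 n c (D (n - 1) x) = \<one>\<^bsub>I0\<^esub>) \<and> (\<forall>x. \<beta> (ev1 n c x) = ev2 n c (D n x))"
proof -
  have "diff L n c = \<one>\<^bsub>grp L (n - 1)\<^esub> \<longleftrightarrow> (\<forall>x. ev1 (n - 1) (diff L n c) x = \<one>\<^bsub>I0\<^esub>) \<and> (\<forall>x. ev2 (n - 1) (diff L n c) x = \<one>\<^bsub>I1\<^esub>)"
    using ev_one ev_eqI[OF diff_closed[OF c] one_closed] by fastforce
  also have "\<dots> \<longleftrightarrow> (\<forall>x. ev1 n c (D (n - 1) x) = \<one>\<^bsub>I0\<^esub>) \<and> (\<forall>x. \<beta> (ev1 n c x) = ev2 n c (D n x))"
    using c \<beta>_closed ev_closed by (simp add: ev1_diff ev2_diff I1.inv_solve_right')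
  finally show ?thesis using c by (simp add: kernel_def)
qed

lemma eq_diff_iff:
  assumes "c \<in> carrier (grp L n)" "t \<in> carrier (grp L (n + 1))"
  shows "c = diff L (n + 1) t \<longleftrightarrow> (\<forall>x. ev1 n c x = ev1 (n + 1) t (D n x)) \<and>
    (\<forall>x. ev2 n c x = \<beta> (ev1 (n + 1) t x) \<otimes>\<^bsub>I1\<^esub> inv\<^bsub>I1\<^esub> (ev2 (n + 1) t (D (n + 1) x)))"
  using ev_eqI[OF assms(1)] diff_closed[OF assms(2)] ev1_diff[OF assms(2)] ev2_diff[OF assms(2)] by auto

lemma diff_in_kernel:
  assumes D0: "D n 0 = 0" and t: "t \<in> carrier (grp L (n + 1))"
  shows "diff L (n + 1) t \<in> kernel (grp L n) (grp L (n - 1)) (diff L n)"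
proof -
  have z: "ev1 (n + 1) t 0 = \<one>\<^bsub>I0\<^esub>" "ev2 (n + 1) t 0 = \<one>\<^bsub>I1\<^esub>"
    using I0.ahom_zero[OF ev1[OF t]] I1.ahom_zero[OF ev2[OF t]] .
  have dd: "D n (D (n - 1) x) = 0" for x using D_D[of "n - 1" x] by simp
  have c: "diff L (n + 1) t \<in> carrier (grp L n)" using diff_closed[OF t] by simp
  then show ?thesis
    using ev1_diff[OF t] ev2_diff[OF t] t
    by (subst cycle_iff[OF c]) (simp add: dd z D_D ev_closed \<beta>_closed)
qed

end

text \<open>Both complexes enter only through their evaluations on representatives, so
  \<open>cone_surj\<close> and \<open>cone_inj\<close> apply directly. \<open>K\<close> is meant for
  the chains of the space and \<open>T\<close> for the total complex.\<close>

theorem (in cochain_system_coeff) homology_iso_cone_like: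
  assumes "cone_like I0 \<beta> I1 K e1 e2 NA (\<lambda>n. dA)" "cone_like I0 \<beta> I1 T f1 f2 NB DB"
  shows "homology K n \<cong> homology T n"
proof -
  interpret K: cone_like I0 \<beta> I1 K e1 e2 NA "\<lambda>n. dA" by fact
  interpret T: cone_like I0 \<beta> I1 T f1 f2 NB DB by fact
  \<comment> \<open>The chain map is precomposition with \<open>fB\<close>; its values exist by
    \<open>ev_ex\<close> because \<open>fB\<close> preserves null cochains.\<close>
  have "\<exists>t\<in>carrier (grp T n). (\<forall>b. f1 n t b = e1 n c (fB b)) \<and> (\<forall>b. f2 n t b = e2 n c (fB b))" if "c \<in> carrier (grp K n)" for c
    using that by (intro T.ev_ex ahom_compose[OF K.ev1 additive_fB] ahom_compose[OF K.ev2 additive_fB] fB_NB)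
  then obtain \<Phi> where \<Phi>: "\<And>c. c \<in> carrier (grp K n) \<Longrightarrow> \<Phi> c \<in> carrier (grp T n)"
    "\<And>c b. c \<in> carrier (grp K n) \<Longrightarrow> f1 n (\<Phi> c) b = e1 n c (fB b)"
    "\<And>c b. c \<in> carrier (grp K n) \<Longrightarrow> f2 n (\<Phi> c) b = e2 n c (fB b)" by metis
  show ?thesis
  proof (rule homology_iso[where \<Phi> = \<Phi>])
    show "\<Phi> \<in> hom (grp K n) (grp T n)"
    proof (rule homI)
      fix c c' assume c: "c \<in> carrier (grp K n)" "c' \<in> carrier (grp K n)"
      show "\<Phi> (c \<otimes>\<^bsub>grp K n\<^esub> c') = \<Phi> c \<otimes>\<^bsub>grp T n\<^esub> \<Phi> c'"
        using c K.mult_closed[OF c]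
        by (intro T.ev_eqI[where n = n]) (auto simp: \<Phi> T.mult_closed T.ev1_mult T.ev2_mult K.ev1_mult K.ev2_mult)
    qed (rule \<Phi>(1))
    show "diff T n (diff T (n + 1) t) = \<one>\<^bsub>grp T (n - 1)\<^esub>" if "t \<in> carrier (grp T (n + 1))" for t
      using T.diff_in_kernel[OF additive.zero[OF additive_DB] that] by (simp add: kernel_def)
    show "diff K (n + 1) t \<in> kernel (grp K n) (grp K (n - 1)) (diff K n)" if "t \<in> carrier (grp K (n + 1))" for t
      using K.diff_in_kernel[OF additive.zero[OF add_dA] that] .
    show "diff T (n + 1) \<in> hom (grp T (n + 1)) (grp T n)" using T.diff_hom[of "n + 1"] by simp
  next
    fix x assume x: "x \<in> kernel (grp K n) (grp K (n - 1)) (diff K n)"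
    then have xc: "x \<in> carrier (grp K n)" by (simp add: kernel_def)
    with x have x1: "\<And>a. e1 n x (dA a) = \<one>\<^bsub>I0\<^esub>" "\<And>a. \<beta> (e1 n x a) = e2 n x (dA a)" using K.cycle_iff by auto
    show "\<Phi> x \<in> kernel (grp T n) (grp T (n - 1)) (diff T n)"
      unfolding T.cycle_iff[OF \<Phi>(1)[OF xc]] using xc by (simp add: \<Phi> fB_DB x1)
    show "\<Phi> x \<in> diff T (n + 1) ` carrier (grp T (n + 1)) \<longleftrightarrow> x \<in> diff K (n + 1) ` carrier (grp K (n + 1))"
    proof
      assume "\<Phi> x \<in> diff T (n + 1) ` carrier (grp T (n + 1))"
      then obtain t where t: "t \<in> carrier (grp T (n + 1))" "\<Phi> x = diff T (n + 1) t" by blast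
      have 2: "\<And>b. e1 n x (fB b) = f1 (n + 1) t (DB n b)"
        "\<And>b. e2 n x (fB b) = \<beta> (f1 (n + 1) t b) \<otimes>\<^bsub>I1\<^esub> inv\<^bsub>I1\<^esub> (f2 (n + 1) t (DB (n + 1) b))"
        using t(2) T.eq_diff_iff[OF \<Phi>(1)[OF xc] t(1)] by (auto simp: \<Phi> xc)
      have t2: "f2 (n + 1) t \<in> ahom I1 (NB (n + 2))" using T.ev2[OF t(1)] by (simp add: add.assoc)
      obtain \<omega>' \<omega>'' where w: "\<omega>' \<in> ahom I0 (NA (n + 1))" "\<omega>'' \<in> ahom I1 (NA (n + 1 + 1))"
        "\<And>a. e1 n x a = \<omega>' (dA a)" "\<And>a. e2 n x a = \<beta> (\<omega>' a) \<otimes>\<^bsub>I1\<^esub> inv\<^bsub>I1\<^esub> (\<omega>'' (dA a))"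
        using cone_inj[OF K.ev1[OF xc] K.ev2[OF xc] T.ev1[OF t(1)] t2 x1 2] by (auto simp: add.assoc)
      obtain s where s: "s \<in> carrier (grp K (n + 1))" "\<And>a. e1 (n + 1) s a = \<omega>' a" "\<And>a. e2 (n + 1) s a = \<omega>'' a"
        using K.ev_ex[OF w(1,2)] by auto
      have "x = diff K (n + 1) s" using w s by (simp add: K.eq_diff_iff[OF xc s(1)])
      then show "x \<in> diff K (n + 1) ` carrier (grp K (n + 1))" using s by blast
    next
      assume "x \<in> diff K (n + 1) ` carrier (grp K (n + 1))"
      then obtain s where s: "s \<in> carrier (grp K (n + 1))" "x = diff K (n + 1) s" by blast
      obtain t where t: "t \<in> carrier (grp T (n + 1))" "\<And>b. f1 (n + 1) t b = e1 (n + 1) s (fB b)" "\<And>b. f2 (n + 1) t b = e2 (n + 1) s (fB b)"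
        using T.ev_ex[of "\<lambda>b. e1 (n + 1) s (fB b)" "n + 1" "\<lambda>b. e2 (n + 1) s (fB b)"]
          ahom_compose[OF K.ev1[OF s(1)] additive_fB fB_NB] ahom_compose[OF K.ev2[OF s(1)] additive_fB fB_NB] by blast
      have "\<Phi> x = diff T (n + 1) t"
        using s(2) unfolding T.eq_diff_iff[OF \<Phi>(1)[OF xc] t(1)] K.eq_diff_iff[OF xc s(1)] by (simp add: \<Phi> xc t fB_DB)
      then show "\<Phi> x \<in> diff T (n + 1) ` carrier (grp T (n + 1))" using t by blast
    qed
  next
    fix y assume y: "y \<in> kernel (grp T n) (grp T (n - 1)) (diff T n)"
    then have yc: "y \<in> carrier (grp T n)" by (simp add: kernel_def)
    with y have y1: "\<And>a. f1 n y (DB (n - 1) a) = \<one>\<^bsub>I0\<^esub>" "\<And>a. \<beta> (f1 n y a) = f2 n y (DB n a)" using T.cycle_iff by auto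
    obtain \<psi>' \<psi>'' t' t'' where w: "\<psi>' \<in> ahom I0 (NA n)" "\<psi>'' \<in> ahom I1 (NA (n + 1))"
      "t' \<in> ahom I0 (NB (n + 1))" "t'' \<in> ahom I1 (NB (n + 2))"
      "\<forall>a. \<psi>' (dA a) = \<one>\<^bsub>I0\<^esub>" "\<forall>a. \<beta> (\<psi>' a) = \<psi>'' (dA a)"
      "\<forall>b. f1 n y b = \<psi>' (fB b) \<otimes>\<^bsub>I0\<^esub> t' (DB n b)"
      "\<forall>b. f2 n y b = \<psi>'' (fB b) \<otimes>\<^bsub>I1\<^esub> (\<beta> (t' b) \<otimes>\<^bsub>I1\<^esub> inv\<^bsub>I1\<^esub> (t'' (DB (n + 1) b)))"
      by (rule cone_surj[OF T.ev1[OF yc] T.ev2[OF yc] y1])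
    obtain x where x: "x \<in> carrier (grp K n)" "\<And>a. e1 n x a = \<psi>' a" "\<And>a. e2 n x a = \<psi>'' a"
      using K.ev_ex[OF w(1,2)] by auto
    obtain t where t: "t \<in> carrier (grp T (n + 1))" "\<And>a. f1 (n + 1) t a = t' a" "\<And>a. f2 (n + 1) t a = t'' a"
      using T.ev_ex[of t' "n + 1" t''] w(3,4) by (auto simp: add.assoc)
    have xk: "x \<in> kernel (grp K n) (grp K (n - 1)) (diff K n)"
      unfolding K.cycle_iff[OF x(1)] by (simp add: x w)
    have dt: "diff T (n + 1) t \<in> carrier (grp T n)" using T.diff_closed[OF t(1)] by simp
    have "y = diff T (n + 1) t \<otimes>\<^bsub>grp T n\<^esub> \<Phi> x"
    proof (rule T.ev_eqI[OF yc])
      show "diff T (n + 1) t \<otimes>\<^bsub>grp T n\<^esub> \<Phi> x \<in> carrier (grp T n)" using dt \<Phi>(1)[OF x(1)] T.mult_closed by blast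
      note cl = ahom_closed[OF w(1)] ahom_closed[OF w(2)] ahom_closed[OF w(3)] ahom_closed[OF w(4)] \<beta>_closed
      fix b
      show "f1 n y b = f1 n (diff T (n + 1) t \<otimes>\<^bsub>grp T n\<^esub> \<Phi> x) b"
        using T.ev1_diff[OF t(1)] cl by (simp add: T.ev1_mult dt \<Phi> x w t I0.m_comm)
      show "f2 n y b = f2 n (diff T (n + 1) t \<otimes>\<^bsub>grp T n\<^esub> \<Phi> x) b"
        using T.ev2_diff[OF t(1)] cl by (simp add: T.ev2_mult dt \<Phi> x w t I1.m_comm)
    qed
    then show "\<exists>x\<in>kernel (grp K n) (grp K (n - 1)) (diff K n). \<exists>t\<in>carrier (grp T (n + 1)). y = diff T (n + 1) t \<otimes>\<^bsub>grp T n\<^esub> \<Phi> x"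
      using xk t(1) by blast
  qed (rule K.grp_L T.grp_L K.diff_hom T.diff_hom)+
qed

section \<open>Quotient groups, and homomorphisms out of them, by means of representatives\<close>

definition presents :: "('x::ab_group_add \<Rightarrow> 'r) \<Rightarrow> 'r monoid \<Rightarrow> 'x set \<Rightarrow> bool" where
  "presents \<kappa> R N \<longleftrightarrow> comm_group R \<and> range \<kappa> = carrier R \<and>
     (\<forall>x y. \<kappa> (x + y) = \<kappa> x \<otimes>\<^bsub>R\<^esub> \<kappa> y) \<and> (\<forall>x. \<kappa> x = \<one>\<^bsub>R\<^esub> \<longleftrightarrow> x \<in> N)"

lemma presentsD:
  assumes "presents \<kappa> R N"
  shows "comm_group R" "\<kappa> x \<in> carrier R" "r \<in> carrier R \<Longrightarrow> \<exists>x. r = \<kappa> x"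
    "\<kappa> (x + y) = \<kappa> x \<otimes>\<^bsub>R\<^esub> \<kappa> y" "\<kappa> x = \<one>\<^bsub>R\<^esub> \<longleftrightarrow> x \<in> N"
proof -
  have "range \<kappa> = carrier R" using assms by (simp add: presents_def)
  then show "\<kappa> x \<in> carrier R" "r \<in> carrier R \<Longrightarrow> \<exists>x. r = \<kappa> x" by auto
qed (use assms in \<open>auto simp: presents_def\<close>)

lemma presents_eqD:
  assumes P: "presents \<kappa> R N" and e: "\<kappa> x = \<kappa> y" shows "x - y \<in> N"
proof -
  interpret R: comm_group R using presentsD(1)[OF P] .
  have "\<kappa> (x - y) \<otimes>\<^bsub>R\<^esub> \<kappa> y = \<kappa> y" using presentsD(4)[OF P, of "x - y" y] e by simp
  then have "\<kappa> (x - y) = \<one>\<^bsub>R\<^esub>" using presentsD(2)[OF P] by (simp add: R.l_cancel_one)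
  then show ?thesis using presentsD(5)[OF P] by blast
qed

lemma comm_group_hom_group:
  assumes R: "comm_group R" and I: "comm_group I"
  shows "comm_group (hom_group R I)"
proof -
  interpret R: comm_group R by fact
  interpret I: comm_group I by fact
  show ?thesis
  proof (rule comm_groupI)
    fix f assume f: "f \<in> carrier (hom_group R I)"
    let ?g = "\<lambda>a\<in>carrier R. inv\<^bsub>I\<^esub> (f a)"
    have "?g \<in> carrier (hom_group R I)"
      using f by (auto simp: hom_group_def hom_def I.inv_mult Pi_def)
    moreover have "?g \<otimes>\<^bsub>hom_group R I\<^esub> f = \<one>\<^bsub>hom_group R I\<^esub>"
      using f by (auto simp: hom_group_def hom_def fun_eq_iff Pi_def)
    ultimately show "\<exists>g\<in>carrier (hom_group R I). g \<otimes>\<^bsub>hom_group R I\<^esub> f = \<one>\<^bsub>hom_group R I\<^esub>" by blast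
  qed (auto simp: hom_group_def hom_def Pi_def I.m_ac fun_eq_iff extensional_def)
qed

lemma comm_group_DirProd: "comm_group G \<Longrightarrow> comm_group H \<Longrightarrow> comm_group (G \<times>\<times> H)"
  by (rule group.group_comm_groupI[OF DirProd_group]) (auto simp: comm_group_def comm_monoid.m_comm)

lemma comm_group_product_group:
  "(\<And>i. i \<in> I \<Longrightarrow> comm_group (G i)) \<Longrightarrow> comm_group (product_group I G)"
  by (rule group.group_comm_groupI) (auto simp: comm_group_def PiE_iff intro!: restrict_ext comm_monoid.m_comm)

lemma hom_group_carrierI:
  assumes P: "presents \<kappa> R N" and h: "h \<in> ahom I N" and f: "\<And>x. f (\<kappa> x) = h x"
  shows "(\<lambda>r\<in>carrier R. f r) \<in> carrier (hom_group R I)"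
proof -
  interpret R: comm_group R using presentsD(1)[OF P] .
  have "(\<lambda>r\<in>carrier R. f r) \<in> hom R I"
  proof (rule homI)
    fix r s assume "r \<in> carrier R" "s \<in> carrier R"
    then obtain x y where x: "r = \<kappa> x" "s = \<kappa> y" using presentsD(3)[OF P] by meson
    then show "(\<lambda>r\<in>carrier R. f r) (r \<otimes>\<^bsub>R\<^esub> s) = (\<lambda>r\<in>carrier R. f r) r \<otimes>\<^bsub>I\<^esub> (\<lambda>r\<in>carrier R. f r) s"
      using presentsD(2,4)[OF P] by (simp add: f ahom_add[OF h] flip: presentsD(4)[OF P])
  next
    fix r assume "r \<in> carrier R"
    then obtain x where "r = \<kappa> x" using presentsD(3)[OF P] by meson
    then show "(\<lambda>r\<in>carrier R. f r) r \<in> carrier I" using presentsD(2)[OF P] by (simp add: f ahom_closed[OF h])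
  qed
  then show ?thesis by (simp add: hom_group_def)
qed

text \<open>The choice of a representative is immaterial, since two representatives of a class
  differ by an element of \<open>N\<close>, on which \<open>h\<close> is trivial.\<close>

lemma hom_group_ex:
  assumes P: "presents \<kappa> R N" and I: "comm_group I" and h: "h \<in> ahom I N"
  obtains g where "g \<in> carrier (hom_group R I)" "\<And>x. g (\<kappa> x) = h x"
proof
  let ?f = "\<lambda>r. h (SOME x. \<kappa> x = r)"
  have f: "?f (\<kappa> x) = h x" for x
  proof -
    have "\<kappa> (SOME y. \<kappa> y = \<kappa> x) = \<kappa> x" by (rule someI) simp
    then show ?thesis using presents_eqD[OF P] comm_group.ahom_eqI[OF I h] by blast
  qed
  show "(\<lambda>r\<in>carrier R. ?f r) \<in> carrier (hom_group R I)" by (rule hom_group_carrierI[OF P h f])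
  show "(\<lambda>r\<in>carrier R. ?f r) (\<kappa> x) = h x" for x using f presentsD(2)[OF P] by simp
qed

lemma hom_group_ahom:
  assumes P: "presents \<kappa> R N" and I: "comm_group I" and g: "g \<in> carrier (hom_group R I)"
  shows "(\<lambda>x. g (\<kappa> x)) \<in> ahom I N"
proof -
  have h: "g \<in> hom R I" using g by (simp add: hom_group_def)
  have "g \<one>\<^bsub>R\<^esub> = \<one>\<^bsub>I\<^esub>" using hom_one[OF h] presentsD(1)[OF P] I by (simp add: comm_group_def)
  then have "g (\<kappa> x) = \<one>\<^bsub>I\<^esub>" if "x \<in> N" for x using that presentsD(5)[OF P] by metis
  then show ?thesis
    using h presentsD(2)[OF P] by (auto simp: ahom_def hom_def presentsD(4)[OF P])
qed

lemma hom_group_eqI: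
  assumes P: "presents \<kappa> R N" and g: "g \<in> carrier (hom_group R I)" "g' \<in> carrier (hom_group R I)"
    and e: "\<And>x. g (\<kappa> x) = g' (\<kappa> x)"
  shows "g = g'"
proof (rule extensionalityI[of _ "carrier R"])
  fix r assume "r \<in> carrier R"
  then show "g r = g' r" using presentsD(3)[OF P] e by metis
qed (use g in \<open>auto simp: hom_group_def\<close>)

text \<open>Homomorphisms on the presented groups correspond to homomorphisms on representatives
  that are trivial on \<open>N\<close>; under this correspondence the boundary of the cone becomes
  precomposition with \<open>d\<close>.\<close>

lemma cone_like_cone_complex:
  fixes C :: "'r graded_complex" and \<kappa> :: "int \<Rightarrow> 'x::ab_group_add \<Rightarrow> 'r"
  assumes I: "comm_group I0" "comm_group I1" "\<beta> \<in> hom I0 I1"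
    and P: "\<And>n. presents (\<kappa> n) (grp C n) (N n)" and d: "Modules.additive d" "\<And>x. d (d x) = 0"
    and dN: "\<And>n x. x \<in> N n \<Longrightarrow> d x \<in> N (n + 1)"
    and diffC: "\<And>n x. diff C n (\<kappa> n x) = \<kappa> (n + 1) (d x)"
  shows "cone_like I0 \<beta> I1 (cone_complex I0 I1 \<beta> C) (\<lambda>n c x. fst c (\<kappa> n x)) (\<lambda>n c x. snd c (\<kappa> (n + 1) x)) N (\<lambda>n. d)"
proof (rule cone_like.intro)
  interpret I0: comm_group I0 by fact
  interpret I1: comm_group I1 by fact
  let ?L = "cone_complex I0 I1 \<beta> C"
  show "comm_group (grp ?L n)" for n
    using presentsD(1)[OF P] I by (simp add: cone_complex_def comm_group_DirProd comm_group_hom_group)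
  have car: "carrier (grp ?L n) = carrier (hom_group (grp C n) I0) \<times> carrier (hom_group (grp C (n + 1)) I1)" for n
    by (simp add: cone_complex_def DirProd_def)
  fix n
  show e1: "(\<lambda>x. fst c (\<kappa> n x)) \<in> ahom I0 (N n)" if "c \<in> carrier (grp ?L n)" for c n
    using that hom_group_ahom[OF P I(1)] by (auto simp: car)
  show e2: "(\<lambda>x. snd c (\<kappa> (n + 1) x)) \<in> ahom I1 (N (n + 1))" if "c \<in> carrier (grp ?L n)" for c n
    using that hom_group_ahom[OF P I(2)] by (auto simp: car)
  show "fst (c \<otimes>\<^bsub>grp ?L n\<^esub> c') (\<kappa> n x) = fst c (\<kappa> n x) \<otimes>\<^bsub>I0\<^esub> fst c' (\<kappa> n x)"
    "snd (c \<otimes>\<^bsub>grp ?L n\<^esub> c') (\<kappa> (n + 1) x) = snd c (\<kappa> (n + 1) x) \<otimes>\<^bsub>I1\<^esub> snd c' (\<kappa> (n + 1) x)" for c c' x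
    using presentsD(2)[OF P] by (cases c; cases c'; simp add: cone_complex_def hom_group_def)+
  show "c = c'" if "c \<in> carrier (grp ?L n)" "c' \<in> carrier (grp ?L n)"
    "\<And>x. fst c (\<kappa> n x) = fst c' (\<kappa> n x)" "\<And>x. snd c (\<kappa> (n + 1) x) = snd c' (\<kappa> (n + 1) x)" for c c'
    using that hom_group_eqI[OF P[of n], of "fst c" I0 "fst c'"] hom_group_eqI[OF P[of "n + 1"], of "snd c" I1 "snd c'"]
    by (auto simp: car prod_eq_iff)
  show "\<exists>c\<in>carrier (grp ?L n). (\<forall>x. fst c (\<kappa> n x) = u x) \<and> (\<forall>x. snd c (\<kappa> (n + 1) x) = v x)"
    if u: "u \<in> ahom I0 (N n)" and v: "v \<in> ahom I1 (N (n + 1))" for u v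
  proof -
    obtain g where "g \<in> carrier (hom_group (grp C n) I0)" "\<And>x. g (\<kappa> n x) = u x"
      using hom_group_ex[OF P I(1) u] by blast
    moreover obtain g' where "g' \<in> carrier (hom_group (grp C (n + 1)) I1)" "\<And>x. g' (\<kappa> (n + 1) x) = v x"
      using hom_group_ex[OF P I(2) v] by blast
    ultimately show ?thesis by (intro bexI[of _ "(g, g')"]) (auto simp: car)
  qed
  have fd: "fst (diff ?L n c) = (\<lambda>x\<in>carrier (grp C (n - 1)). fst c (diff C (n - 1) x))"
    "snd (diff ?L n c) = (\<lambda>x\<in>carrier (grp C n). \<beta> (fst c x) \<otimes>\<^bsub>I1\<^esub> inv\<^bsub>I1\<^esub> (snd c (diff C n x)))" for c
    by (simp_all add: cone_complex_def case_prod_beta)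
  show ev1: "fst (diff ?L n c) (\<kappa> (n - 1) x) = fst c (\<kappa> n (d x))" for c x
    using presentsD(2)[OF P] diffC[of "n - 1" x] by (simp add: fd)
  show ev2: "snd (diff ?L n c) (\<kappa> (n - 1 + 1) x) = \<beta> (fst c (\<kappa> n x)) \<otimes>\<^bsub>I1\<^esub> inv\<^bsub>I1\<^esub> (snd c (\<kappa> (n + 1) (d x)))" for c x
    using presentsD(2)[OF P] by (simp add: fd diffC)
  show "diff ?L n c \<in> carrier (grp ?L (n - 1))" if c: "c \<in> carrier (grp ?L n)" for c
  proof -
    have "(\<lambda>x. fst c (\<kappa> n (d x))) \<in> ahom I0 (N (n - 1))"
      using ahom_compose[OF e1[OF c] d(1), of "N (n - 1)"] dN[of _ "n - 1"] by simp
    then have "fst (diff ?L n c) \<in> carrier (hom_group (grp C (n - 1)) I0)"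
      unfolding fd using diffC[of "n - 1"] by (intro hom_group_carrierI[OF P]) auto
    moreover have "(\<lambda>x. \<beta> (fst c (\<kappa> n x)) \<otimes>\<^bsub>I1\<^esub> inv\<^bsub>I1\<^esub> (snd c (\<kappa> (n + 1) (d x)))) \<in> ahom I1 (N n)"
      by (intro I1.ahom_mult I1.ahom_inv I0.ahom_hom[OF I(3,2) e1[OF c]] ahom_compose[OF e2[OF c] d(1)] dN)
    then have "snd (diff ?L n c) \<in> carrier (hom_group (grp C n) I1)"
      unfolding fd by (intro hom_group_carrierI[OF P]) (auto simp: diffC)
    ultimately show ?thesis by (simp add: car mem_Times_iff)
  qed
qed (use I d in auto)

section \<open>Homomorphisms from direct sums into multiplicatively written groups\<close>

definition mult_lin_ext :: "('i, 'b) monoid_scheme \<Rightarrow> ('k \<Rightarrow> 'v \<Rightarrow> 'i) \<Rightarrow> ('k \<Rightarrow>\<^sub>0 'v::zero) \<Rightarrow> 'i" where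
  "mult_lin_ext I f b = finprod I (\<lambda>k. f k (Poly_Mapping.lookup b k)) (Poly_Mapping.keys b)"

context comm_group begin

lemma ahom_mult_lin_ext:
  assumes f: "\<And>k. f k \<in> ahom G (S k)" and N: "\<And>b k. b \<in> N \<Longrightarrow> Poly_Mapping.lookup b k \<in> S k"
  shows "mult_lin_ext G f \<in> ahom G N"
proof -
  note cl = ahom_closed[OF f]
  have sup: "mult_lin_ext G f b = finprod G (\<lambda>k. f k (Poly_Mapping.lookup b k)) K"
    if "finite K" "Poly_Mapping.keys b \<subseteq> K" for b K
    unfolding mult_lin_ext_def using that
    by (intro finprod_mono_neutral_cong_left) (auto simp: in_keys_iff ahom_zero[OF f] cl)
  have "mult_lin_ext G f (a + b) = mult_lin_ext G f a \<otimes> mult_lin_ext G f b" for a b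
  proof -
    let ?K = "Poly_Mapping.keys a \<union> Poly_Mapping.keys b"
    have "mult_lin_ext G f (a + b) = finprod G (\<lambda>k. f k (Poly_Mapping.lookup (a + b) k)) ?K"
      by (rule sup) (use Poly_Mapping.keys_add[of a b] in auto)
    also have "\<dots> = finprod G (\<lambda>k. f k (Poly_Mapping.lookup a k)) ?K \<otimes> finprod G (\<lambda>k. f k (Poly_Mapping.lookup b k)) ?K"
      by (simp add: lookup_add ahom_add[OF f] cl finprod_multf)
    also have "\<dots> = mult_lin_ext G f a \<otimes> mult_lin_ext G f b"
      by (subst (1 2) sup[of ?K]) auto
    finally show ?thesis .
  qed
  moreover have "mult_lin_ext G f b \<in> carrier G" for b unfolding mult_lin_ext_def by (rule finprod_closed) (auto simp: cl)
  moreover have "mult_lin_ext G f b = \<one>" if "b \<in> N" for b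
    unfolding mult_lin_ext_def by (rule finprod_one_eqI) (use ahom_null[OF f N[OF that]] in auto)
  ultimately show ?thesis by (simp add: ahom_def)
qed

lemma mult_lin_ext_single:
  assumes "f k \<in> ahom G S" shows "mult_lin_ext G f (single k v) = f k v"
proof (cases "v = 0")
  case True
  then show ?thesis using ahom_zero[OF assms] by (simp add: mult_lin_ext_def)
next
  case False
  have "finprod G (\<lambda>j. f j (Poly_Mapping.lookup (single k v) j)) {k} = f k v"
    using ahom_closed[OF assms] by (subst finprod_insert) auto
  then show ?thesis using False by (simp add: mult_lin_ext_def)
qed

lemma ahom_sum:
  assumes h: "h \<in> ahom G N" shows "h (\<Sum>i\<in>A. g i) = finprod G (\<lambda>i. h (g i)) A"
  by (induction A rule: infinite_finite_induct)
    (auto simp: ahom_zero[OF h] ahom_add[OF h] ahom_closed[OF h])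

lemma ahom_poly_eqI:
  assumes h: "h \<in> ahom G N" "h' \<in> ahom G N'"
    and e: "\<And>k v. h (single k v) = h' (single k v)"
  shows "h b = h' b"
  by (subst (1 2) poly_mapping_eq_sum_single) (simp add: ahom_sum[OF h(1)] ahom_sum[OF h(2)] e)

end

text \<open>Brings the recursive sum into the shape of \<open>total_delta\<close>, which separates
  the twisted face 0 from the faces with positive index.\<close>

lemma twisted_alt_sum_eq_sum:
  assumes "length ls \<ge> 2"
  shows "twisted_alt_sum p c ls y = c (omit 0 ls) (p (ls ! 0) (ls ! 1) y) + (\<Sum>j\<in>{1..<length ls}. sign_pow (int j) (c (omit j ls) y))"
proof -
  obtain l m t where ls: "ls = l # m # t" using assms by (cases ls; cases "tl ls") auto
  have "c (m # t) y - alt_sum (\<lambda>u. c (l # u) y) (m # t) = alt_sum (\<lambda>u. c u y) ls"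
    by (simp add: ls)
  also have "\<dots> = (\<Sum>j\<in>{0..<length ls}. sign_pow (int j) (c (omit j ls) y))"
    by (simp add: alt_sum_eq_sum atLeast0LessThan)
  also have "\<dots> = c (m # t) y + (\<Sum>j\<in>{1..<length ls}. sign_pow (int j) (c (omit j ls) y))"
    by (subst sum.atLeast_Suc_lessThan) (auto simp: ls sign_pow_def)
  finally show ?thesis by (simp add: ls del: alt_sum.simps)
qed

lemma hom_finprod:
  assumes G: "comm_group G" and H: "comm_group H" and e: "e \<in> hom G H" and f: "\<And>i. i \<in> A \<Longrightarrow> f i \<in> carrier G"
  shows "e (finprod G f A) = finprod H (\<lambda>i. e (f i)) A"
proof -
  interpret G: comm_group G by fact
  interpret H: comm_group H by fact
  have "e \<one>\<^bsub>G\<^esub> = \<one>\<^bsub>H\<^esub>" by (rule hom_one[OF e G.is_group H.is_group])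
  then show ?thesis using f
    by (induction A rule: infinite_finite_induct)
      (auto simp: hom_mult[OF e] G.finprod_closed Pi_def hom_in_carrier[OF e])
qed

lemma signed_closed: "comm_group D \<Longrightarrow> x \<in> carrier D \<Longrightarrow> signed D k x \<in> carrier D"
  by (simp add: signed_def comm_group_def)

lemma hom_signed: "comm_group D \<Longrightarrow> comm_group E \<Longrightarrow> e \<in> hom D E \<Longrightarrow> x \<in> carrier D \<Longrightarrow> e (signed D k x) = signed E k (e x)"
  using group_hom.hom_inv[of D E e x] by (simp add: signed_def comm_group_def group_hom_def group_hom_axioms_def)

lemma ahom_sign_pow: "comm_group I \<Longrightarrow> h \<in> ahom I N \<Longrightarrow> h (sign_pow k x) = signed I k (h x)"
  by (simp add: sign_pow_def signed_def comm_group.ahom_minus)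

section \<open>The total complex of the cones as the cone of the direct sum\<close>

locale presented_cochain_system = cochain_system_coeff \<Lambda> leq dA dC p q NA NC I0 \<beta> I1
  for \<Lambda> :: "'l set" and leq :: "'l \<Rightarrow> 'l \<Rightarrow> bool"
    and dA :: "'x::ab_group_add \<Rightarrow> 'x" and dC :: "'l \<Rightarrow> 'y::ab_group_add \<Rightarrow> 'y"
    and p :: "'l \<Rightarrow> 'l \<Rightarrow> 'y \<Rightarrow> 'y" and q :: "'l \<Rightarrow> 'y \<Rightarrow> 'x"
    and NA :: "int \<Rightarrow> 'x set" and NC :: "'l \<Rightarrow> int \<Rightarrow> 'y set"
    and I0 :: "'i monoid" and \<beta> :: "'i \<Rightarrow> 'j" and I1 :: "'j monoid" +
  fixes C :: "'l \<Rightarrow> 's graded_complex" and \<kappa> :: "'l \<Rightarrow> int \<Rightarrow> 'y \<Rightarrow> 's"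
    and P :: "'l \<Rightarrow> 'l \<Rightarrow> int \<Rightarrow> 's \<Rightarrow> 's"
  assumes presC: "\<And>l n. presents (\<kappa> l n) (grp (C l) n) (NC l n)"
    and diffC: "\<And>l n y. diff (C l) n (\<kappa> l n y) = \<kappa> l (n + 1) (dC l y)"
    and P_\<kappa>: "\<And>l m n y. \<lbrakk>l \<in> \<Lambda>; m \<in> \<Lambda>; leq l m\<rbrakk> \<Longrightarrow> P l m n (\<kappa> l n y) = \<kappa> m n (p l m y)"
begin

abbreviation K :: "'l \<Rightarrow> (('s \<Rightarrow> 'i) \<times> ('s \<Rightarrow> 'j)) graded_complex" where
  "K l \<equiv> cone_complex I0 I1 \<beta> (C l)"

abbreviation Pm :: "'l \<Rightarrow> 'l \<Rightarrow> int \<Rightarrow> ('s \<Rightarrow> 'i) \<times> ('s \<Rightarrow> 'j) \<Rightarrow> ('s \<Rightarrow> 'i) \<times> ('s \<Rightarrow> 'j)" where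
  "Pm l m \<equiv> cone_map (C l) (P l m)"

abbreviation T :: "('l list \<Rightarrow> ('s \<Rightarrow> 'i) \<times> ('s \<Rightarrow> 'j)) graded_complex" where
  "T \<equiv> total_complex \<Lambda> leq K Pm"

text \<open>The first component of the chain \<open>c ls\<close>, read on representatives. The
  trivial value outside \<open>MI\<close> matches \<open>NB\<close>, which puts no condition on such
  lists.\<close>

definition E1 :: "int \<Rightarrow> ('l list \<Rightarrow> ('s \<Rightarrow> 'i) \<times> ('s \<Rightarrow> 'j)) \<Rightarrow> 'l list \<Rightarrow> 'y \<Rightarrow> 'i" where
  "E1 n c ls y = (if ls \<in> MI then fst (c ls) (\<kappa> (hd ls) (n + level ls) y) else \<one>\<^bsub>I0\<^esub>)"

definition E2 :: "int \<Rightarrow> ('l list \<Rightarrow> ('s \<Rightarrow> 'i) \<times> ('s \<Rightarrow> 'j)) \<Rightarrow> 'l list \<Rightarrow> 'y \<Rightarrow> 'j" where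
  "E2 n c ls y = (if ls \<in> MI then snd (c ls) (\<kappa> (hd ls) (n + level ls + 1) y) else \<one>\<^bsub>I1\<^esub>)"

sublocale K: cone_like I0 \<beta> I1 "K l" "\<lambda>n c x. fst c (\<kappa> l n x)" "\<lambda>n c x. snd c (\<kappa> l (n + 1) x)" "NC l" "\<lambda>n. dC l" for l
  by (rule cone_like_cone_complex[where C = "C l" and \<kappa> = "\<kappa> l" and N = "NC l" and d = "dC l",
        OF I0.comm_group_axioms I1.comm_group_axioms \<beta> presC add_dC dC_dC dC_NC diffC])

lemma carrier_K: "carrier (grp (K l) n) = carrier (hom_group (grp (C l) n) I0) \<times> carrier (hom_group (grp (C l) (n + 1)) I1)"
  by (simp add: cone_complex_def DirProd_def)

lemma carrier_T: "c \<in> carrier (grp T n) \<longleftrightarrow> c \<in> extensional MI \<and> (\<forall>ls\<in>MI. c ls \<in> carrier (grp (K (hd ls)) (n + level ls)))"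
  by (auto simp: total_complex_def total_group_def PiE_iff)

lemma E1_ahom:
  assumes c: "c \<in> carrier (grp T n)"
  shows "E1 n c ls \<in> ahom I0 (if ls \<in> MI then NC (hd ls) (n + level ls) else UNIV)"
proof (cases "ls \<in> MI")
  case True
  then have "c ls \<in> carrier (grp (K (hd ls)) (n + level ls))" using c by (simp add: carrier_T)
  from K.ev1[OF this] show ?thesis using True by (simp add: E1_def[abs_def])
qed (simp add: E1_def[abs_def] ahom_def)

lemma E2_ahom:
  assumes c: "c \<in> carrier (grp T n)"
  shows "E2 n c ls \<in> ahom I1 (if ls \<in> MI then NC (hd ls) (n + level ls + 1) else UNIV)"
proof (cases "ls \<in> MI")
  case True
  then have "c ls \<in> carrier (grp (K (hd ls)) (n + level ls))" using c by (simp add: carrier_T)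
  from K.ev2[OF this] show ?thesis using True by (simp add: E2_def[abs_def])
qed (simp add: E2_def[abs_def] ahom_def)

lemma tot1: "c \<in> carrier (grp T n) \<Longrightarrow> mult_lin_ext I0 (E1 n c) \<in> ahom I0 (NB n)"
  by (rule I0.ahom_mult_lin_ext[where f = "E1 n c", OF E1_ahom]) (auto simp: NB_def)

lemma tot2: "c \<in> carrier (grp T n) \<Longrightarrow> mult_lin_ext I1 (E2 n c) \<in> ahom I1 (NB (n + 1))"
  by (rule I1.ahom_mult_lin_ext[where f = "E2 n c", OF E2_ahom]) (auto simp: NB_def algebra_simps)

lemma tot1_single: "c \<in> carrier (grp T n) \<Longrightarrow> mult_lin_ext I0 (E1 n c) (single ls y) = E1 n c ls y"
  by (rule I0.mult_lin_ext_single[where f = "E1 n c" and k = ls, OF E1_ahom])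

lemma tot2_single: "c \<in> carrier (grp T n) \<Longrightarrow> mult_lin_ext I1 (E2 n c) (single ls y) = E2 n c ls y"
  by (rule I1.mult_lin_ext_single[where f = "E2 n c" and k = ls, OF E2_ahom])

lemma cone_map_carrier:
  assumes l: "l \<in> \<Lambda>" "m \<in> \<Lambda>" "leq l m" and c: "c \<in> carrier (grp (K m) n)"
  shows "Pm l m n c \<in> carrier (grp (K l) n)" "fst (Pm l m n c) (\<kappa> l n y) = fst c (\<kappa> m n (p l m y))"
    "snd (Pm l m n c) (\<kappa> l (n + 1) y) = snd c (\<kappa> m (n + 1) (p l m y))"
proof -
  have f: "fst (Pm l m n c) = (\<lambda>x\<in>carrier (grp (C l) n). fst c (P l m n x))"
    "snd (Pm l m n c) = (\<lambda>x\<in>carrier (grp (C l) (n + 1)). snd c (P l m (n + 1) x))"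
    by (simp_all add: cone_map_def case_prod_beta)
  show "fst (Pm l m n c) (\<kappa> l n y) = fst c (\<kappa> m n (p l m y))"
    "snd (Pm l m n c) (\<kappa> l (n + 1) y) = snd c (\<kappa> m (n + 1) (p l m y))"
    using presentsD(2)[OF presC] by (simp_all add: f P_\<kappa>[OF l])
  have "fst (Pm l m n c) \<in> carrier (hom_group (grp (C l) n) I0)"
    unfolding f by (rule hom_group_carrierI[OF presC ahom_compose[OF K.ev1[OF c] add_p[of l m] p_NC[OF l]]]) (simp_all add: P_\<kappa>[OF l])
  moreover have "snd (Pm l m n c) \<in> carrier (hom_group (grp (C l) (n + 1)) I1)"
    unfolding f by (rule hom_group_carrierI[OF presC ahom_compose[OF K.ev2[OF c] add_p[of l m] p_NC[OF l]]]) (simp_all add: P_\<kappa>[OF l])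
  ultimately show "Pm l m n c \<in> carrier (grp (K l) n)" by (simp add: carrier_K mem_Times_iff)
qed

lemma MI_faces:
  assumes ls: "ls \<in> MI" "length ls \<ge> 2"
  shows "ls ! 0 = hd ls" "hd (omit 0 ls) = ls ! 1" "hd ls \<in> \<Lambda>" "ls ! 1 \<in> \<Lambda>" "leq (hd ls) (ls ! 1)"
    "i < length ls \<Longrightarrow> omit i ls \<in> MI" "i < length ls \<Longrightarrow> level (omit i ls) = level ls - 1"
    "i \<ge> 1 \<Longrightarrow> hd (omit i ls) = hd ls"
proof -
  obtain l m t where e: "ls = l # m # t" using ls(2) by (cases ls; cases "tl ls") auto
  show "ls ! 0 = hd ls" "hd (omit 0 ls) = ls ! 1" "hd ls \<in> \<Lambda>" "ls ! 1 \<in> \<Lambda>" "leq (hd ls) (ls ! 1)"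
    using MI_ConsD[of l m t] ls(1) by (simp_all add: e)
  show "i < length ls \<Longrightarrow> omit i ls \<in> MI" using omit_multiindices[OF dir ls] by blast
  show "i < length ls \<Longrightarrow> level (omit i ls) = level ls - 1" using ls(2) by (simp add: of_nat_diff)
  show "i \<ge> 1 \<Longrightarrow> hd (omit i ls) = hd ls" by (cases i) (auto simp: e)
qed

lemma face_carrier:
  assumes c: "c \<in> carrier (grp T n)" and ls: "ls \<in> MI" "length ls \<ge> 2"
  shows "Pm (ls ! 0) (ls ! 1) (n + level ls - 1) (c (omit 0 ls)) \<in> carrier (grp (K (hd ls)) (n + level ls - 1))"
    "j \<in> {1..<length ls} \<Longrightarrow> c (omit j ls) \<in> carrier (grp (K (hd ls)) (n + level ls - 1))"
    "c (omit 0 ls) \<in> carrier (grp (K (ls ! 1)) (n + level ls - 1))"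
proof -
  note F = MI_faces[OF ls]
  have c': "c (omit i ls) \<in> carrier (grp (K (hd (omit i ls))) (n + level ls - 1))" if "i < length ls" for i
  proof -
    have "c (omit i ls) \<in> carrier (grp (K (hd (omit i ls))) (n + level (omit i ls)))"
      using c F(6)[OF that] unfolding carrier_T by blast
    then show ?thesis by (simp only: F(7)[OF that] add_diff_eq)
  qed
  show "c (omit j ls) \<in> carrier (grp (K (hd ls)) (n + level ls - 1))" if "j \<in> {1..<length ls}"
    using c'[of j] F(8)[of j] that by simp
  have "0 < length ls" using ls(2) by linarith
  from c'[OF this] show c0: "c (omit 0 ls) \<in> carrier (grp (K (ls ! 1)) (n + level ls - 1))" by (simp only: F(2))
  show "Pm (ls ! 0) (ls ! 1) (n + level ls - 1) (c (omit 0 ls)) \<in> carrier (grp (K (hd ls)) (n + level ls - 1))"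
    using cone_map_carrier(1)[OF F(3,4,5) c0] by (simp add: F(1))
qed

lemma total_delta_carrier:
  assumes c: "c \<in> carrier (grp T n)" and ls: "ls \<in> MI"
  shows "total_delta K Pm n c ls \<in> carrier (grp (K (hd ls)) (n + level ls - 1))"
proof -
  interpret D: comm_group "grp (K (hd ls)) (n + level ls - 1)" by (rule K.grp_L)
  show ?thesis
  proof (cases "level ls = 0")
    case False
    then have l2: "length ls \<ge> 2" using MI_iff[of ls] ls by (cases ls; cases "tl ls") simp_all
    note fc = face_carrier[OF c ls l2]
    have "(\<Otimes>\<^bsub>grp (K (hd ls)) (n + level ls - 1)\<^esub>j\<in>{1..<length ls}. signed (grp (K (hd ls)) (n + level ls - 1)) (int j) (c (omit j ls)))
        \<in> carrier (grp (K (hd ls)) (n + level ls - 1))"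
      by (rule D.finprod_closed) (use fc signed_closed[OF D.comm_group_axioms] in auto)
    from D.m_closed[OF fc(1) this] show ?thesis
      unfolding total_delta_def Let_def using False by (simp only: if_False)
  qed (simp add: total_delta_def K.one_closed)
qed

text \<open>The evaluation \<open>e\<close> and the homomorphism \<open>F\<close> are left general
  so that one computation serves both components of the cone, with values in \<open>I0\<close> and
  \<open>I1\<close>.\<close>

lemma eval_total_delta:
  assumes c: "c \<in> carrier (grp T n)" and ls: "ls \<in> MI" and I: "comm_group (I :: 'k monoid)"
    and e: "e \<in> hom (grp (K (hd ls)) (n + level ls - 1)) I" and F: "F \<in> ahom I S"
    and e0: "length ls \<ge> 2 \<Longrightarrow> e (Pm (ls ! 0) (ls ! 1) (n + level ls - 1) (c (omit 0 ls))) = F (single (omit 0 ls) (p (ls ! 0) (ls ! 1) y))"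
    and ej: "\<And>j. length ls \<ge> 2 \<Longrightarrow> j \<in> {1..<length ls} \<Longrightarrow> e (c (omit j ls)) = F (single (omit j ls) y)"
  shows "e (total_delta K Pm n c ls) = F (twisted_alt_sum p single ls y)"
proof -
  interpret I: comm_group I by fact
  interpret D: comm_group "grp (K (hd ls)) (n + level ls - 1)" by (rule K.grp_L)
  show ?thesis
  proof (cases "level ls = 0")
    case True
    then show ?thesis using hom_one[OF e D.is_group I.is_group] I.ahom_zero[OF F] by (simp add: total_delta_def twisted_alt_sum_def)
  next
    case False
    then have l2: "length ls \<ge> 2" using MI_iff[of ls] ls by (cases ls; cases "tl ls") simp_all
    let ?D = "grp (K (hd ls)) (n + level ls - 1)"
    note fc = face_carrier[OF c ls l2]
    have eqj: "e (signed ?D (int j) (c (omit j ls))) = F (sign_pow (int j) (single (omit j ls) y))" if "j \<in> {1..<length ls}" for j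
      by (simp only: hom_signed[OF D.comm_group_axioms I e fc(2)[OF that]] ej[OF l2 that] ahom_sign_pow[OF I F])
    have "e (\<Otimes>\<^bsub>?D\<^esub>j\<in>{1..<length ls}. signed ?D (int j) (c (omit j ls))) =
        finprod I (\<lambda>j. e (signed ?D (int j) (c (omit j ls)))) {1..<length ls}"
      by (rule hom_finprod[OF D.comm_group_axioms I e]) (use fc signed_closed[OF D.comm_group_axioms] in auto)
    also have "\<dots> = finprod I (\<lambda>j. F (sign_pow (int j) (single (omit j ls) y))) {1..<length ls}"
      by (rule I.finprod_cong'[OF refl _ eqj]) (use ahom_closed[OF F] in blast)
    also have "\<dots> = F (\<Sum>j\<in>{1..<length ls}. sign_pow (int j) (single (omit j ls) y))"
      by (rule I.ahom_sum[OF F, symmetric])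
    finally have s: "e (\<Otimes>\<^bsub>?D\<^esub>j\<in>{1..<length ls}. signed ?D (int j) (c (omit j ls))) = \<dots>" .
    have "(\<Otimes>\<^bsub>?D\<^esub>j\<in>{1..<length ls}. signed ?D (int j) (c (omit j ls))) \<in> carrier ?D"
      by (rule D.finprod_closed) (use fc signed_closed[OF D.comm_group_axioms] in auto)
    then have "e (total_delta K Pm n c ls) = e (Pm (ls ! 0) (ls ! 1) (n + level ls - 1) (c (omit 0 ls))) \<otimes>\<^bsub>I\<^esub>
        e (\<Otimes>\<^bsub>?D\<^esub>j\<in>{1..<length ls}. signed ?D (int j) (c (omit j ls)))"
      unfolding total_delta_def Let_def using False by (simp only: if_False hom_mult[OF e fc(1)])
    also have "\<dots> = F (twisted_alt_sum p single ls y)"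
      unfolding s e0[OF l2] twisted_alt_sum_eq_sum[OF l2] by (rule ahom_add[OF F, symmetric])
    finally show ?thesis .
  qed
qed

lemma diff_T: "ls \<in> MI \<Longrightarrow> diff T n c ls = diff (K (hd ls)) (n + level ls) (c ls)
    \<otimes>\<^bsub>grp (K (hd ls)) (n + level ls - 1)\<^esub> signed (grp (K (hd ls)) (n + level ls - 1)) n (total_delta K Pm n c ls)"
  by (simp add: total_complex_def Let_def)

lemma hom_ev1: "(\<lambda>c. fst c (\<kappa> l n y)) \<in> hom (grp (K l) n) I0"
  by (rule homI) (use K.ev_closed K.ev1_mult in auto)

lemma hom_ev2: "(\<lambda>c. snd c (\<kappa> l (n + 1) y)) \<in> hom (grp (K l) n) I1"
  by (rule homI) (use K.ev_closed K.ev2_mult in auto)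

lemma diff_T_closed:
  assumes c: "c \<in> carrier (grp T n)" shows "diff T n c \<in> carrier (grp T (n - 1))"
  unfolding carrier_T
proof (intro conjI ballI)
  show "diff T n c \<in> extensional MI" by (simp add: total_complex_def)
  fix ls assume ls: "ls \<in> MI"
  have "diff (K (hd ls)) (n + level ls) (c ls) \<in> carrier (grp (K (hd ls)) (n + level ls - 1))"
    using c ls by (intro K.diff_closed) (simp add: carrier_T)
  then have "diff T n c ls \<in> carrier (grp (K (hd ls)) (n + level ls - 1))"
    unfolding diff_T[OF ls] by (intro K.mult_closed signed_closed[OF K.grp_L] total_delta_carrier[OF c ls])
  then show "diff T n c ls \<in> carrier (grp (K (hd ls)) (n - 1 + level ls))" by (simp add: algebra_simps)
qed

text \<open>The sign (-1)^n in front of \<delta> in the total boundary is the sign of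
  \<open>eps\<close> in \<open>DB (n - 1)\<close>, so both summands of the boundary are accounted
  for by a single precomposition.\<close>

lemma E1_diff:
  assumes c: "c \<in> carrier (grp T n)" and ls: "ls \<in> MI"
  shows "E1 (n - 1) (diff T n c) ls y = mult_lin_ext I0 (E1 n c) (DB (n - 1) (single ls y))"
proof -
  let ?D = "grp (K (hd ls)) (n + level ls - 1)" and ?F = "mult_lin_ext I0 (E1 n c)"
  let ?e = "\<lambda>c. fst c (\<kappa> (hd ls) (n + level ls - 1) y)"
  have cls: "c ls \<in> carrier (grp (K (hd ls)) (n + level ls))" using c ls by (simp add: carrier_T)
  have td: "total_delta K Pm n c ls \<in> carrier ?D" by (rule total_delta_carrier[OF c ls])
  have "?e (total_delta K Pm n c ls) = ?F (twisted_alt_sum p single ls y)"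
  proof (rule eval_total_delta[OF c ls I0.comm_group_axioms hom_ev1 tot1[OF c]])
    assume l2: "length ls \<ge> 2"
    note F = MI_faces[OF ls l2]
    have eval: "E1 n c (omit i ls) z = fst (c (omit i ls)) (\<kappa> (hd (omit i ls)) (n + level ls - 1) z)" if "i < length ls" for i z
      by (simp only: E1_def F(6)[OF that] F(7)[OF that] if_True add_diff_eq)
    have "0 < length ls" using l2 by linarith
    show "?e (Pm (ls ! 0) (ls ! 1) (n + level ls - 1) (c (omit 0 ls))) = ?F (single (omit 0 ls) (p (ls ! 0) (ls ! 1) y))"
      by (simp only: F(1) tot1_single[OF c] eval[OF \<open>0 < length ls\<close>] F(2) cone_map_carrier(2)[OF F(3,4,5) face_carrier(3)[OF c ls l2]])
    fix j assume j: "j \<in> {1..<length ls}"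
    then have "j < length ls" by simp
    show "?e (c (omit j ls)) = ?F (single (omit j ls) y)"
      using j F(8)[of j] by (simp only: tot1_single[OF c] eval[OF \<open>j < length ls\<close>]) simp
  qed
  then have "?e (diff T n c ls) = fst (c ls) (\<kappa> (hd ls) (n + level ls) (dC (hd ls) y)) \<otimes>\<^bsub>I0\<^esub> signed I0 n (?F (twisted_alt_sum p single ls y))"
    unfolding diff_T[OF ls]
    using K.ev1_mult[OF K.diff_closed[OF cls] signed_closed[OF K.grp_L td, of n], of y]
      hom_signed[OF K.grp_L I0.comm_group_axioms hom_ev1[of "hd ls" "n + level ls - 1" y] td, of n] K.ev1_diff[OF cls, of y] by simp
  also have "\<dots> = ?F (single ls (dC (hd ls) y)) \<otimes>\<^bsub>I0\<^esub> ?F (sign_pow n (twisted_alt_sum p single ls y))"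
    using ls by (simp add: tot1_single[OF c] E1_def ahom_sign_pow[OF I0.comm_group_axioms tot1[OF c]])
  also have "\<dots> = ?F (DB (n - 1) (single ls y))"
    using ls by (simp add: DB_def dB_single eps_single ahom_add[OF tot1[OF c]])
  finally show ?thesis using ls by (simp add: E1_def algebra_simps)
qed

lemma E2_diff:
  assumes c: "c \<in> carrier (grp T n)" and ls: "ls \<in> MI"
  shows "E2 (n - 1) (diff T n c) ls y = \<beta> (mult_lin_ext I0 (E1 n c) (single ls y)) \<otimes>\<^bsub>I1\<^esub>
     inv\<^bsub>I1\<^esub> (mult_lin_ext I1 (E2 n c) (DB n (single ls y)))"
proof -
  let ?D = "grp (K (hd ls)) (n + level ls - 1)" and ?F = "mult_lin_ext I1 (E2 n c)"
  let ?e = "\<lambda>c. snd c (\<kappa> (hd ls) (n + level ls - 1 + 1) y)"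
  have cls: "c ls \<in> carrier (grp (K (hd ls)) (n + level ls))" using c ls by (simp add: carrier_T)
  have td: "total_delta K Pm n c ls \<in> carrier ?D" by (rule total_delta_carrier[OF c ls])
  note cl = ahom_closed[OF tot1[OF c]] ahom_closed[OF tot2[OF c]] \<beta>_closed
  have "?e (total_delta K Pm n c ls) = ?F (twisted_alt_sum p single ls y)"
  proof (rule eval_total_delta[OF c ls I1.comm_group_axioms hom_ev2 tot2[OF c]])
    assume l2: "length ls \<ge> 2"
    note F = MI_faces[OF ls l2]
    have eval: "E2 n c (omit i ls) z = snd (c (omit i ls)) (\<kappa> (hd (omit i ls)) (n + level ls - 1 + 1) z)" if "i < length ls" for i z
      by (simp only: E2_def F(6)[OF that] F(7)[OF that] if_True add_diff_eq)
    have "0 < length ls" using l2 by linarith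
    show "?e (Pm (ls ! 0) (ls ! 1) (n + level ls - 1) (c (omit 0 ls))) = ?F (single (omit 0 ls) (p (ls ! 0) (ls ! 1) y))"
      by (simp only: F(1) tot2_single[OF c] eval[OF \<open>0 < length ls\<close>] F(2) cone_map_carrier(3)[OF F(3,4,5) face_carrier(3)[OF c ls l2]])
    fix j assume j: "j \<in> {1..<length ls}"
    then have "j < length ls" by simp
    show "?e (c (omit j ls)) = ?F (single (omit j ls) y)"
      using j F(8)[of j] by (simp only: tot2_single[OF c] eval[OF \<open>j < length ls\<close>]) simp
  qed
  then have "?e (diff T n c ls) = (\<beta> (fst (c ls) (\<kappa> (hd ls) (n + level ls) y)) \<otimes>\<^bsub>I1\<^esub>
      inv\<^bsub>I1\<^esub> (snd (c ls) (\<kappa> (hd ls) (n + level ls + 1) (dC (hd ls) y)))) \<otimes>\<^bsub>I1\<^esub> signed I1 n (?F (twisted_alt_sum p single ls y))"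
    unfolding diff_T[OF ls]
    using K.ev2_mult[OF K.diff_closed[OF cls] signed_closed[OF K.grp_L td, of n], of y]
      hom_signed[OF K.grp_L I1.comm_group_axioms hom_ev2[of "hd ls" "n + level ls - 1" y] td, of n] K.ev2_diff[OF cls, of y] by simp
  \<comment> \<open>In this component the cone takes an inverse, which changes the exponent
    \<open>n\<close> of the total boundary to the exponent \<open>n + 1\<close> of
    \<open>DB n\<close>.\<close>
  also have "\<dots> = (\<beta> (mult_lin_ext I0 (E1 n c) (single ls y)) \<otimes>\<^bsub>I1\<^esub> inv\<^bsub>I1\<^esub> (?F (single ls (dC (hd ls) y)))) \<otimes>\<^bsub>I1\<^esub>
      inv\<^bsub>I1\<^esub> (?F (sign_pow (n + 1) (twisted_alt_sum p single ls y)))"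
    using ls cl by (simp add: tot1_single[OF c] tot2_single[OF c] E1_def E2_def sign_pow_simps I1.ahom_minus[OF tot2[OF c]]
        ahom_sign_pow[OF I1.comm_group_axioms tot2[OF c]] signed_closed[OF I1.comm_group_axioms])
  also have "\<dots> = \<beta> (mult_lin_ext I0 (E1 n c) (single ls y)) \<otimes>\<^bsub>I1\<^esub> inv\<^bsub>I1\<^esub> (?F (DB n (single ls y)))"
    using ls cl by (simp add: DB_def dB_single eps_single ahom_add[OF tot2[OF c]] I1.inv_mult I1.m_ac)
  finally show ?thesis using ls by (simp add: E2_def algebra_simps)
qed

text \<open>Homomorphisms from a direct sum are families of homomorphisms from the summands. Hence
  the product over all multiindices that makes up \<open>T\<close> is the group of pairs of
  homomorphisms from the direct sum that are trivial on null elements.\<close>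

lemma cone_like_total:
  "cone_like I0 \<beta> I1 T (\<lambda>n c. mult_lin_ext I0 (E1 n c)) (\<lambda>n c. mult_lin_ext I1 (E2 n c)) NB DB"
proof (rule cone_like.intro)
  fix n
  show T: "comm_group (grp T n)" for n
    by (simp add: total_complex_def total_group_def comm_group_product_group K.grp_L)
  interpret T: comm_group "grp T n" by (rule T)
  have mult: "(c \<otimes>\<^bsub>grp T n\<^esub> c') ls = c ls \<otimes>\<^bsub>grp (K (hd ls)) (n + level ls)\<^esub> c' ls" if "ls \<in> MI" for c c' ls
    using that by (simp add: total_complex_def total_group_def)
  show "mult_lin_ext I0 (E1 n (c \<otimes>\<^bsub>grp T n\<^esub> c')) b = mult_lin_ext I0 (E1 n c) b \<otimes>\<^bsub>I0\<^esub> mult_lin_ext I0 (E1 n c') b"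
    if c: "c \<in> carrier (grp T n)" "c' \<in> carrier (grp T n)" for c c' b
  proof (rule I0.ahom_poly_eqI[OF tot1[OF T.m_closed[OF c]] I0.ahom_mult[OF tot1[OF c(1)] tot1[OF c(2)]]])
    fix ls y
    have "ls \<in> MI \<Longrightarrow> fst (c ls \<otimes>\<^bsub>grp (K (hd ls)) (n + level ls)\<^esub> c' ls) (\<kappa> (hd ls) (n + level ls) y) =
        fst (c ls) (\<kappa> (hd ls) (n + level ls) y) \<otimes>\<^bsub>I0\<^esub> fst (c' ls) (\<kappa> (hd ls) (n + level ls) y)"
      by (rule K.ev1_mult) (use c carrier_T in auto)
    then show "mult_lin_ext I0 (E1 n (c \<otimes>\<^bsub>grp T n\<^esub> c')) (single ls y) =
      mult_lin_ext I0 (E1 n c) (single ls y) \<otimes>\<^bsub>I0\<^esub> mult_lin_ext I0 (E1 n c') (single ls y)"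
      using c T.m_closed[OF c] by (simp add: tot1_single E1_def mult)
  qed
  show "mult_lin_ext I1 (E2 n (c \<otimes>\<^bsub>grp T n\<^esub> c')) b = mult_lin_ext I1 (E2 n c) b \<otimes>\<^bsub>I1\<^esub> mult_lin_ext I1 (E2 n c') b"
    if c: "c \<in> carrier (grp T n)" "c' \<in> carrier (grp T n)" for c c' b
  proof (rule I1.ahom_poly_eqI[OF tot2[OF T.m_closed[OF c]] I1.ahom_mult[OF tot2[OF c(1)] tot2[OF c(2)]]])
    fix ls y
    have "ls \<in> MI \<Longrightarrow> snd (c ls \<otimes>\<^bsub>grp (K (hd ls)) (n + level ls)\<^esub> c' ls) (\<kappa> (hd ls) (n + level ls + 1) y) =
        snd (c ls) (\<kappa> (hd ls) (n + level ls + 1) y) \<otimes>\<^bsub>I1\<^esub> snd (c' ls) (\<kappa> (hd ls) (n + level ls + 1) y)"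
      by (rule K.ev2_mult) (use c carrier_T in auto)
    then show "mult_lin_ext I1 (E2 n (c \<otimes>\<^bsub>grp T n\<^esub> c')) (single ls y) =
      mult_lin_ext I1 (E2 n c) (single ls y) \<otimes>\<^bsub>I1\<^esub> mult_lin_ext I1 (E2 n c') (single ls y)"
      using c T.m_closed[OF c] by (simp add: tot2_single E2_def mult)
  qed
  show "c = c'" if c: "c \<in> carrier (grp T n)" "c' \<in> carrier (grp T n)"
    and e: "\<And>x. mult_lin_ext I0 (E1 n c) x = mult_lin_ext I0 (E1 n c') x" "\<And>x. mult_lin_ext I1 (E2 n c) x = mult_lin_ext I1 (E2 n c') x" for c c'
  proof (rule extensionalityI[of _ MI])
    fix ls assume ls: "ls \<in> MI"
    show "c ls = c' ls"
    proof (rule K.ev_eqI)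
      show "c ls \<in> carrier (grp (K (hd ls)) (n + level ls))" "c' ls \<in> carrier (grp (K (hd ls)) (n + level ls))"
        using c ls carrier_T by auto
      fix y
      show "fst (c ls) (\<kappa> (hd ls) (n + level ls) y) = fst (c' ls) (\<kappa> (hd ls) (n + level ls) y)"
        using e(1)[of "single ls y"] ls c by (simp add: tot1_single E1_def)
      show "snd (c ls) (\<kappa> (hd ls) (n + level ls + 1) y) = snd (c' ls) (\<kappa> (hd ls) (n + level ls + 1) y)"
        using e(2)[of "single ls y"] ls c by (simp add: tot2_single E2_def)
    qed
  qed (use c carrier_T in auto)
  show "\<exists>c\<in>carrier (grp T n). (\<forall>x. mult_lin_ext I0 (E1 n c) x = u x) \<and> (\<forall>x. mult_lin_ext I1 (E2 n c) x = v x)"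
    if u: "u \<in> ahom I0 (NB n)" and v: "v \<in> ahom I1 (NB (n + 1))" for u v
  proof -
    have "\<exists>c\<in>carrier (grp (K (hd ls)) (n + level ls)). (\<forall>y. fst c (\<kappa> (hd ls) (n + level ls) y) = u (single ls y))
        \<and> (\<forall>y. snd c (\<kappa> (hd ls) (n + level ls + 1) y) = v (single ls y))" for ls
      by (rule K.ev_ex) (auto intro!: ahom_compose[OF u additive_single] ahom_compose[OF v additive_single] single_in_NB simp: algebra_simps)
    then obtain c where c: "\<And>ls. c ls \<in> carrier (grp (K (hd ls)) (n + level ls))"
      "\<And>ls y. fst (c ls) (\<kappa> (hd ls) (n + level ls) y) = u (single ls y)"
      "\<And>ls y. snd (c ls) (\<kappa> (hd ls) (n + level ls + 1) y) = v (single ls y)" by metis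
    define c' where "c' = restrict c MI"
    have c': "c' \<in> carrier (grp T n)" using c by (simp add: carrier_T c'_def)
    have r: "c' ls = c ls" if "ls \<in> MI" for ls using that by (simp add: c'_def)
    \<comment> \<open>A homomorphism trivial on \<open>NB\<close> ignores lists outside
      \<open>MI\<close>, so restricting \<open>c\<close> to \<open>MI\<close> loses nothing.\<close>
    have out: "single ls y \<in> NB k" if "ls \<notin> MI" for ls y k using that by (auto intro: single_in_NB)
    have "mult_lin_ext I0 (E1 n c') b = u b" for b
      by (rule I0.ahom_poly_eqI[OF tot1[OF c'] u])
        (auto simp: tot1_single[OF c'] E1_def r c ahom_null[OF u out])
    moreover have "mult_lin_ext I1 (E2 n c') b = v b" for b
      by (rule I1.ahom_poly_eqI[OF tot2[OF c'] v])
        (auto simp: tot2_single[OF c'] E2_def r c(3)[simplified] ahom_null[OF v out])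
    ultimately show ?thesis using c' by blast
  qed
  have out: "DB k (single ls y) = 0" if "ls \<notin> MI" for ls y k
    using that by (simp add: DB_def dB_single eps_single sign_pow_simps)
  show "mult_lin_ext I0 (E1 (n - 1) (diff T n c)) b = mult_lin_ext I0 (E1 n c) (DB (n - 1) b)" if c: "c \<in> carrier (grp T n)" for c b
  proof (rule I0.ahom_poly_eqI[OF tot1[OF diff_T_closed[OF c]]])
    show "(\<lambda>b. mult_lin_ext I0 (E1 n c) (DB (n - 1) b)) \<in> ahom I0 (NB (n - 1))"
      by (rule ahom_compose[OF tot1[OF c] additive_DB]) (use DB_NB[of _ "n - 1"] in simp)
    fix ls y
    show "mult_lin_ext I0 (E1 (n - 1) (diff T n c)) (single ls y) = mult_lin_ext I0 (E1 n c) (DB (n - 1) (single ls y))"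
      using E1_diff[OF c, of ls y] I0.ahom_zero[OF tot1[OF c]]
      by (cases "ls \<in> MI") (auto simp: tot1_single[OF diff_T_closed[OF c]] out E1_def)
  qed
  show "mult_lin_ext I1 (E2 (n - 1) (diff T n c)) b = \<beta> (mult_lin_ext I0 (E1 n c) b) \<otimes>\<^bsub>I1\<^esub> inv\<^bsub>I1\<^esub> (mult_lin_ext I1 (E2 n c) (DB n b))"
    if c: "c \<in> carrier (grp T n)" for c b
  proof (rule I1.ahom_poly_eqI[OF tot2[OF diff_T_closed[OF c]]])
    show "(\<lambda>b. \<beta> (mult_lin_ext I0 (E1 n c) b) \<otimes>\<^bsub>I1\<^esub> inv\<^bsub>I1\<^esub> (mult_lin_ext I1 (E2 n c) (DB n b))) \<in> ahom I1 (NB n)"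
      by (intro I1.ahom_mult I1.ahom_inv \<beta>_ahom tot1[OF c] ahom_compose[OF tot2[OF c] additive_DB] DB_NB)
    fix ls y
    show "mult_lin_ext I1 (E2 (n - 1) (diff T n c)) (single ls y) =
       \<beta> (mult_lin_ext I0 (E1 n c) (single ls y)) \<otimes>\<^bsub>I1\<^esub> inv\<^bsub>I1\<^esub> (mult_lin_ext I1 (E2 n c) (DB n (single ls y)))"
      using E2_diff[OF c, of ls y] I1.ahom_zero[OF tot2[OF c]]
      by (cases "ls \<in> MI") (auto simp: tot1_single[OF c] tot2_single[OF diff_T_closed[OF c]] out E1_def E2_def \<beta>_one)
  qed
qed (use I0.comm_group_axioms I1.comm_group_axioms \<beta> tot1 tot2 diff_T_closed DB_DB in auto)

theorem homology_iso_total: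
  assumes presA: "\<And>n. presents (\<kappa>A n) (grp A n) (NA n)"
    and diffA: "\<And>n x. diff A n (\<kappa>A n x) = \<kappa>A (n + 1) (dA x)"
  shows "homology (cone_complex I0 I1 \<beta> A) n \<cong> homology T n"
  by (rule homology_iso_cone_like[OF cone_like_cone_complex[OF I0.comm_group_axioms I1.comm_group_axioms \<beta> presA add_dA dA_dA dA_NA diffA] cone_like_total])

end

section \<open>Normal coverings as a uniformity\<close>

text \<open>A partition of unity without normalization and without a covering that contains the
  supports. This weaker notion passes directly to products and pullbacks, and its index set is
  arbitrary, whereas a subordinate partition of unity is indexed by its covering.\<close>

definition lf_cover :: "'a topology \<Rightarrow> 'i set \<Rightarrow> ('i \<Rightarrow> 'a \<Rightarrow> real) \<Rightarrow> bool" where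
  "lf_cover X I g \<longleftrightarrow> (\<forall>i\<in>I. continuous_map X euclideanreal (g i)) \<and> (\<forall>i\<in>I. \<forall>x\<in>topspace X. 0 \<le> g i x) \<and>
     (\<forall>x\<in>topspace X. \<exists>i\<in>I. 0 < g i x) \<and>
     (\<forall>x\<in>topspace X. \<exists>W. openin X W \<and> x \<in> W \<and> finite {i\<in>I. \<exists>y\<in>W. g i y \<noteq> 0})"

lemma lf_coverD:
  assumes "lf_cover X I g"
  shows "i \<in> I \<Longrightarrow> continuous_map X euclideanreal (g i)" "i \<in> I \<Longrightarrow> x \<in> topspace X \<Longrightarrow> 0 \<le> g i x"
    "x \<in> topspace X \<Longrightarrow> \<exists>i\<in>I. 0 < g i x"
    "x \<in> topspace X \<Longrightarrow> \<exists>W. openin X W \<and> x \<in> W \<and> finite {i\<in>I. \<exists>y\<in>W. g i y \<noteq> 0}"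
  using assms by (auto simp: lf_cover_def)

lemma lf_cover_finite:
  assumes "lf_cover X I g" "x \<in> topspace X"
  shows "finite {i\<in>I. g i x \<noteq> 0}"
  using lf_coverD(4)[OF assms] by (auto elim: rev_finite_subset)

lemma continuous_map_locally:
  assumes "\<And>x. x \<in> topspace X \<Longrightarrow> \<exists>W. openin X W \<and> x \<in> W \<and> continuous_map (subtopology X W) Y f"
  shows "continuous_map X Y f"
proof -
  obtain W where W: "\<And>x. x \<in> topspace X \<Longrightarrow> openin X (W x) \<and> x \<in> W x \<and> continuous_map (subtopology X (W x)) Y f"
    using assms by metis
  show ?thesis
    by (rule pasting_lemma[where I = "topspace X" and T = W and f = "\<lambda>_. f"]) (use W in auto)
qed

lemma continuous_map_eq_locally:
  assumes "\<And>x. x \<in> topspace X \<Longrightarrow> \<exists>W f'. openin X W \<and> x \<in> W \<and> continuous_map X Y f' \<and> (\<forall>y\<in>W. f y = f' y)"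
  shows "continuous_map X Y f"
proof (rule continuous_map_locally)
  fix x assume "x \<in> topspace X"
  then obtain W f' where W: "openin X W" "x \<in> W" "continuous_map X Y f'" "\<forall>y\<in>W. f y = f' y" using assms by blast
  have "continuous_map (subtopology X W) Y f"
    by (rule continuous_map_eq[OF continuous_map_from_subtopology[OF W(3)]]) (use W in auto)
  then show "\<exists>W. openin X W \<and> x \<in> W \<and> continuous_map (subtopology X W) Y f" using W by blast
qed

text \<open>\<open>Max\<close> makes sense for infinite \<open>I\<close> as well: where only
  finitely many members are nonzero, the set of values is finite. The inserted 0 covers the empty
  index set.\<close>

definition lsup :: "'i set \<Rightarrow> ('i \<Rightarrow> 'a \<Rightarrow> real) \<Rightarrow> 'a \<Rightarrow> real" where
  "lsup I g x = Max (insert 0 ((\<lambda>i. g i x) ` I))"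

definition lsum :: "'i set \<Rightarrow> ('i \<Rightarrow> 'a \<Rightarrow> real) \<Rightarrow> 'a \<Rightarrow> real" where
  "lsum I g x = (\<Sum>i | i \<in> I \<and> g i x \<noteq> 0. g i x)"

lemma lsup_eq:
  assumes "A \<subseteq> I" "\<And>i. i \<in> I - A \<Longrightarrow> g i x = 0"
  shows "lsup I g x = lsup A g x"
proof -
  have "insert 0 ((\<lambda>i. g i x) ` I) = insert 0 ((\<lambda>i. g i x) ` A)" using assms by (auto simp: image_iff)
  then show ?thesis by (simp add: lsup_def)
qed

lemma lsum_eq:
  assumes "A \<subseteq> I" "finite A" "\<And>i. i \<in> I - A \<Longrightarrow> g i x = 0"
  shows "lsum I g x = (\<Sum>i\<in>A. g i x)"
  unfolding lsum_def using assms by (intro sum.mono_neutral_left) auto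

lemma continuous_map_lsup_finite:
  assumes "finite A" "\<And>i. i \<in> A \<Longrightarrow> continuous_map X euclideanreal (g i)"
  shows "continuous_map X euclideanreal (lsup A g)"
  using assms
proof (induction A rule: finite_induct)
  case empty
  then show ?case by (simp add: lsup_def[abs_def])
next
  case (insert a A)
  have "lsup (insert a A) g = (\<lambda>x. max (g a x) (lsup A g x))"
    using insert.hyps by (auto simp: lsup_def fun_eq_iff insert_commute[of 0])
  then show ?case using insert by (simp add: continuous_map_real_max)
qed

lemma finite_lsup_set:
  assumes "finite {i \<in> I. g i x \<noteq> 0}"
  shows "finite (insert 0 ((\<lambda>i. g i x) ` I))"
proof -
  have "insert 0 ((\<lambda>i. g i x) ` I) \<subseteq> insert 0 ((\<lambda>i. g i x) ` {i \<in> I. g i x \<noteq> 0})" by auto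
  then show ?thesis using assms by (meson finite.insertI finite_imageI finite_subset)
qed

lemma lsup_ge: "finite {i \<in> I. g i x \<noteq> 0} \<Longrightarrow> i \<in> I \<Longrightarrow> g i x \<le> lsup I g x"
  unfolding lsup_def by (rule Max_ge[OF finite_lsup_set]) auto

lemma lsup_nonneg: "finite {i \<in> I. g i x \<noteq> 0} \<Longrightarrow> 0 \<le> lsup I g x"
  unfolding lsup_def by (rule Max_ge[OF finite_lsup_set]) auto

lemma lsup_attained: "finite {i \<in> I. g i x \<noteq> 0} \<Longrightarrow> lsup I g x = 0 \<or> (\<exists>i\<in>I. g i x = lsup I g x)"
  using Max_in[OF finite_lsup_set[of I g x]] by (auto simp: lsup_def)

lemma continuous_map_lsup:
  assumes g: "lf_cover X I g" and J: "J \<subseteq> I"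
  shows "continuous_map X euclideanreal (lsup J g)"
proof (rule continuous_map_eq_locally)
  fix x assume "x \<in> topspace X"
  then obtain W where W: "openin X W" "x \<in> W" "finite {i\<in>I. \<exists>y\<in>W. g i y \<noteq> 0}" using lf_coverD(4)[OF g] by blast
  let ?A = "{i\<in>J. \<exists>y\<in>W. g i y \<noteq> 0}"
  have fA: "finite ?A" using W(3) J by (auto elim: rev_finite_subset)
  have "continuous_map X euclideanreal (lsup ?A g)"
    by (rule continuous_map_lsup_finite[OF fA]) (use J lf_coverD(1)[OF g] in auto)
  moreover have "\<forall>y\<in>W. lsup J g y = lsup ?A g y" by (auto intro!: lsup_eq)
  ultimately show "\<exists>W f'. openin X W \<and> x \<in> W \<and> continuous_map X euclideanreal f' \<and> (\<forall>y\<in>W. lsup J g y = f' y)"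
    using W by blast
qed

lemma continuous_map_lsum:
  assumes g: "lf_cover X I g" and J: "J \<subseteq> I"
  shows "continuous_map X euclideanreal (lsum J g)"
proof (rule continuous_map_eq_locally)
  fix x assume "x \<in> topspace X"
  then obtain W where W: "openin X W" "x \<in> W" "finite {i\<in>I. \<exists>y\<in>W. g i y \<noteq> 0}" using lf_coverD(4)[OF g] by blast
  let ?A = "{i\<in>J. \<exists>y\<in>W. g i y \<noteq> 0}"
  have fA: "finite ?A" using W(3) J by (auto elim: rev_finite_subset)
  have "continuous_map X euclideanreal (\<lambda>x. \<Sum>i\<in>?A. g i x)"
    by (rule continuous_map_sum[OF fA]) (use J lf_coverD(1)[OF g] in auto)
  moreover have "\<forall>y\<in>W. lsum J g y = (\<Sum>i\<in>?A. g i y)" using fA by (auto intro!: lsum_eq)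
  ultimately show "\<exists>W f'. openin X W \<and> x \<in> W \<and> continuous_map X euclideanreal f' \<and> (\<forall>y\<in>W. lsum J g y = f' y)"
    using W by blast
qed

lemma lf_cover_mono_zero:
  assumes g: "lf_cover X I g" and f: "\<And>i. i \<in> I \<Longrightarrow> continuous_map X euclideanreal (f i)"
    "\<And>i x. i \<in> I \<Longrightarrow> x \<in> topspace X \<Longrightarrow> 0 \<le> f i x"
    and cov: "\<And>x. x \<in> topspace X \<Longrightarrow> \<exists>i\<in>I. 0 < f i x"
    and z: "\<And>i x. i \<in> I \<Longrightarrow> x \<in> topspace X \<Longrightarrow> g i x = 0 \<Longrightarrow> f i x = 0"
  shows "lf_cover X I f"
  unfolding lf_cover_def
proof (intro conjI ballI f cov)
  fix x assume "x \<in> topspace X"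
  then obtain W where W: "openin X W" "x \<in> W" "finite {i\<in>I. \<exists>y\<in>W. g i y \<noteq> 0}" using lf_coverD(4)[OF g] by blast
  have "W \<subseteq> topspace X" using W(1) by (rule openin_subset)
  then have "{i\<in>I. \<exists>y\<in>W. f i y \<noteq> 0} \<subseteq> {i\<in>I. \<exists>y\<in>W. g i y \<noteq> 0}" using z by blast
  then show "\<exists>W. openin X W \<and> x \<in> W \<and> finite {i\<in>I. \<exists>y\<in>W. f i y \<noteq> 0}" using W finite_subset by blast
qed

text \<open>Cutting off at half of the supremum makes the supports shrink.\<close>

lemma lf_cover_shrink:
  assumes g: "lf_cover X I g"
  obtains f where "lf_cover X I f" "\<And>i. i \<in> I \<Longrightarrow> X closure_of {x \<in> topspace X. f i x \<noteq> 0} \<subseteq> {x \<in> topspace X. 0 < g i x}"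
proof
  let ?M = "lsup I g"
  let ?f = "\<lambda>i x. max 0 (2 * g i x - ?M x)"
  have fin: "finite {i\<in>I. g i x \<noteq> 0}" if "x \<in> topspace X" for x by (rule lf_cover_finite[OF g that])
  have M: "continuous_map X euclideanreal ?M" by (rule continuous_map_lsup[OF g order_refl])
  have Mpos: "0 < ?M x" if "x \<in> topspace X" for x
    using lf_coverD(3)[OF g that] lsup_ge[of I g x, OF fin[OF that]] by (meson less_le_trans)
  have c: "continuous_map X euclideanreal (\<lambda>x. 2 * g i x - ?M x)" if "i \<in> I" for i
    by (intro continuous_map_diff M continuous_map_real_mult_left lf_coverD(1)[OF g that])
  show "lf_cover X I ?f"
  proof (rule lf_cover_mono_zero[OF g])
    show "continuous_map X euclideanreal (?f i)" if "i \<in> I" for i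
      by (intro continuous_map_real_max c[OF that]) simp
    show "\<exists>i\<in>I. 0 < ?f i x" if x: "x \<in> topspace X" for x
    proof -
      obtain i where "i \<in> I" "g i x = ?M x" using lsup_attained[of I g x, OF fin[OF x]] Mpos[OF x] by auto
      then show ?thesis using Mpos[OF x] by (intro bexI[of _ i]) auto
    qed
    show "?f i x = 0" if "i \<in> I" "x \<in> topspace X" "g i x = 0" for i x using that Mpos[of x] by simp
  qed simp
  fix i assume i: "i \<in> I"
  have "closedin X {x \<in> topspace X. 2 * g i x - ?M x \<in> {0..}}"
    by (rule closedin_continuous_map_preimage[OF c[OF i]]) simp
  then have "X closure_of {x \<in> topspace X. ?f i x \<noteq> 0} \<subseteq> {x \<in> topspace X. 2 * g i x - ?M x \<in> {0..}}"
    by (intro closure_of_minimal) auto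
  also have "\<dots> \<subseteq> {x \<in> topspace X. 0 < g i x}" using Mpos by fastforce
  finally show "X closure_of {x \<in> topspace X. ?f i x \<noteq> 0} \<subseteq> {x \<in> topspace X. 0 < g i x}" .
qed

text \<open>Distinct indices may have the same set of positivity, while a covering contains that set
  only once. One index is chosen for each set, which also keeps the family locally finite.\<close>

lemma lf_cover_reindex:
  assumes g: "lf_cover X I g"
  obtains h where "lf_cover X ((\<lambda>i. {x \<in> topspace X. 0 < g i x}) ` I) h"
    "\<And>U x. U \<in> (\<lambda>i. {x \<in> topspace X. 0 < g i x}) ` I \<Longrightarrow> x \<in> topspace X \<Longrightarrow> 0 < h U x \<longleftrightarrow> x \<in> U"
proof -
  let ?c = "\<lambda>i. {x \<in> topspace X. 0 < g i x}"
  define r where "r U = (SOME i. i \<in> I \<and> ?c i = U)" for U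
  have r: "r U \<in> I \<and> ?c (r U) = U" if "U \<in> ?c ` I" for U
    unfolding r_def by (rule someI_ex) (use that in blast)
  note r1 = r[THEN conjunct1] and r2 = r[THEN conjunct2]
  show ?thesis
  proof
    show "lf_cover X (?c ` I) (\<lambda>U. g (r U))"
      unfolding lf_cover_def
    proof (intro conjI ballI)
      fix x assume x: "x \<in> topspace X"
      obtain i where i: "i \<in> I" "0 < g i x" using lf_coverD(3)[OF g x] by blast
      then have "x \<in> ?c (r (?c i))" using r[of "?c i"] x by simp
      then show "\<exists>U\<in>?c ` I. 0 < g (r U) x" using i by (intro bexI[of _ "?c i"]) auto
      obtain W where W: "openin X W" "x \<in> W" "finite {i\<in>I. \<exists>y\<in>W. g i y \<noteq> 0}" using lf_coverD(4)[OF g x] by blast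
      have "{U \<in> ?c ` I. \<exists>y\<in>W. g (r U) y \<noteq> 0} \<subseteq> ?c ` {i\<in>I. \<exists>y\<in>W. g i y \<noteq> 0}"
      proof
        fix U assume U: "U \<in> {U \<in> ?c ` I. \<exists>y\<in>W. g (r U) y \<noteq> 0}"
        then have Uc: "U \<in> ?c ` I" and "\<exists>y\<in>W. g (r U) y \<noteq> 0" by simp_all
        then have "r U \<in> {i\<in>I. \<exists>y\<in>W. g i y \<noteq> 0}" using r1[OF Uc] by simp
        then show "U \<in> ?c ` {i\<in>I. \<exists>y\<in>W. g i y \<noteq> 0}"
          by (rule rev_image_eqI) (rule r2[OF Uc, symmetric])
      qed
      from finite_subset[OF this finite_imageI[OF W(3)]]
      show "\<exists>W. openin X W \<and> x \<in> W \<and> finite {U \<in> ?c ` I. \<exists>y\<in>W. g (r U) y \<noteq> 0}"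
        using W(1,2) by (intro exI[of _ W] conjI)
    next
      fix U assume "U \<in> ?c ` I"
      then have "r U \<in> I" by (rule r1)
      then show "continuous_map X euclideanreal (g (r U))" "\<And>x. x \<in> topspace X \<Longrightarrow> 0 \<le> g (r U) x"
        by (rule lf_coverD(1)[OF g], rule lf_coverD(2)[OF g])
    qed
    fix U x assume "U \<in> ?c ` I" "x \<in> topspace X"
    then have "x \<in> ?c (r U) \<longleftrightarrow> x \<in> U" using r2[of U] by simp
    then show "0 < g (r U) x \<longleftrightarrow> x \<in> U" using \<open>x \<in> topspace X\<close> by simp
  qed
qed

text \<open>After reindexing by the sets themselves, shrinking puts the closed supports inside the
  members, and division by the locally finite sum normalizes the family.\<close>

lemma normal_covering_lf_cover:
  assumes g: "lf_cover X I g"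
  shows "normal_covering X ((\<lambda>i. {x \<in> topspace X. 0 < g i x}) ` I)"
proof -
  let ?c = "\<lambda>i. {x \<in> topspace X. 0 < g i x}"
  obtain h where h: "lf_cover X (?c ` I) h"
    "\<And>U x. U \<in> ?c ` I \<Longrightarrow> x \<in> topspace X \<Longrightarrow> 0 < h U x \<longleftrightarrow> x \<in> U" using lf_cover_reindex[OF g] by blast
  obtain f where f: "lf_cover X (?c ` I) f" "\<And>U. U \<in> ?c ` I \<Longrightarrow> X closure_of {x \<in> topspace X. f U x \<noteq> 0} \<subseteq> {x \<in> topspace X. 0 < h U x}"
    using lf_cover_shrink[OF h(1)] by blast
  let ?S = "lsum (?c ` I) f"
  have Spos: "0 < ?S x" if x: "x \<in> topspace X" for x
  proof -
    obtain i where i: "i \<in> ?c ` I" "0 < f i x" using lf_coverD(3)[OF f(1) x] by blast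
    have "0 < f i x" by fact
    also have "f i x \<le> ?S x" unfolding lsum_def
      using i lf_coverD(2)[OF f(1) _ x] lf_cover_finite[OF f(1) x] by (intro member_le_sum) auto
    finally show ?thesis .
  qed
  let ?\<psi> = "\<lambda>U x. f U x / ?S x"
  have S: "continuous_map X euclideanreal ?S" by (rule continuous_map_lsum[OF f(1) order_refl])
  have nz: "{x \<in> topspace X. ?\<psi> U x \<noteq> 0} = {x \<in> topspace X. f U x \<noteq> 0}" for U using Spos by fastforce
  have "subordinate_partition_of_unity X (?c ` I) ?\<psi>"
    unfolding subordinate_partition_of_unity_def
  proof (intro conjI ballI)
    fix U assume U: "U \<in> ?c ` I"
    show "continuous_map X euclideanreal (?\<psi> U)"
      using Spos by (intro continuous_map_real_divide S lf_coverD(1)[OF f(1) U]) fastforce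
    show "0 \<le> ?\<psi> U x" if "x \<in> topspace X" for x using Spos[OF that] lf_coverD(2)[OF f(1) U that] by simp
    have "{x \<in> topspace X. 0 < h U x} = U" using h(2)[OF U] U by auto
    then show "X closure_of {x \<in> topspace X. ?\<psi> U x \<noteq> 0} \<subseteq> U" using f(2)[OF U] by (simp only: nz)
  next
    fix x assume x: "x \<in> topspace X"
    then obtain W where W: "openin X W" "x \<in> W" "finite {U\<in>?c ` I. \<exists>y\<in>W. f U y \<noteq> 0}" using lf_coverD(4)[OF f(1)] by blast
    have "{U\<in>?c ` I. \<exists>y\<in>W. ?\<psi> U y \<noteq> 0} \<subseteq> {U\<in>?c ` I. \<exists>y\<in>W. f U y \<noteq> 0}" by auto
    from finite_subset[OF this W(3)]
    show "\<exists>W. openin X W \<and> x \<in> W \<and> finite {U\<in>?c ` I. \<exists>y\<in>W. ?\<psi> U y \<noteq> 0}"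
      using W(1,2) by (intro exI[of _ W] conjI)
    have "{U \<in> ?c ` I. ?\<psi> U x \<noteq> 0} = {U \<in> ?c ` I. f U x \<noteq> 0}" using Spos[OF x] by auto
    then have "(\<Sum>U | U \<in> ?c ` I \<and> ?\<psi> U x \<noteq> 0. ?\<psi> U x) = ?S x / ?S x"
      by (simp add: lsum_def flip: sum_divide_distrib)
    then show "(\<Sum>U | U \<in> ?c ` I \<and> ?\<psi> U x \<noteq> 0. ?\<psi> U x) = 1" using Spos[OF x] by simp
  qed
  moreover have "open_covering X (?c ` I)"
    unfolding open_covering_def
  proof (intro conjI ballI)
    fix U assume "U \<in> ?c ` I"
    then obtain i where i: "i \<in> I" "U = {x \<in> topspace X. g i x \<in> {0<..}}" by auto
    show "openin X U" unfolding i(2)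
      by (rule openin_continuous_map_preimage[OF lf_coverD(1)[OF g i(1)]]) simp
  next
    show "\<Union>(?c ` I) = topspace X" using lf_coverD(3)[OF g] by blast
  qed
  ultimately show ?thesis unfolding normal_covering_def by blast
qed

lemma lf_cover_normal_covering:
  assumes "normal_covering X \<U>"
  obtains g where "lf_cover X \<U> g" "\<And>U x. U \<in> \<U> \<Longrightarrow> x \<in> topspace X \<Longrightarrow> 0 < g U x \<Longrightarrow> x \<in> U"
proof -
  obtain \<psi> where "subordinate_partition_of_unity X \<U> \<psi>" using assms by (auto simp: normal_covering_def)
  then have p: "\<forall>U\<in>\<U>. continuous_map X euclideanreal (\<psi> U)"
     "\<forall>U\<in>\<U>. \<forall>x\<in>topspace X. 0 \<le> \<psi> U x"
     "\<forall>U\<in>\<U>. X closure_of {x \<in> topspace X. \<psi> U x \<noteq> 0} \<subseteq> U"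
     "\<forall>x\<in>topspace X. \<exists>W. openin X W \<and> x \<in> W \<and> finite {U\<in>\<U>. \<exists>y\<in>W. \<psi> U y \<noteq> 0}"
     "\<forall>x\<in>topspace X. (\<Sum>U | U \<in> \<U> \<and> \<psi> U x \<noteq> 0. \<psi> U x) = 1"
    unfolding subordinate_partition_of_unity_def by - (elim conjE, assumption)+
  have "\<exists>U\<in>\<U>. 0 < \<psi> U x" if x: "x \<in> topspace X" for x
  proof (rule ccontr)
    assume "\<not> ?thesis"
    then have "\<psi> U x = 0" if "U \<in> \<U>" for U using p(2)[rule_format, OF that x] that by force
    then have "{U. U \<in> \<U> \<and> \<psi> U x \<noteq> 0} = {}" by simp
    then show False using p(5)[rule_format, OF x] by simp
  qed
  then have "lf_cover X \<U> \<psi>" using p(1,2,4) unfolding lf_cover_def by simp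
  moreover have "x \<in> U" if "U \<in> \<U>" "x \<in> topspace X" "0 < \<psi> U x" for U x
  proof -
    have "x \<in> {x \<in> topspace X. \<psi> U x \<noteq> 0}" using that by simp
    also have "\<dots> \<subseteq> X closure_of {x \<in> topspace X. \<psi> U x \<noteq> 0}" by (rule closure_of_subset) simp
    also have "\<dots> \<subseteq> U" using p(3) that(1) by simp
    finally show ?thesis .
  qed
  ultimately show ?thesis by (rule that)
qed

text \<open>Index sets of type \<open>'a set set\<close> suffice, because a locally finite family can be indexed by the
  supports of its members.\<close>

definition normal_entourage :: "'a topology \<Rightarrow> ('a \<times> 'a) set \<Rightarrow> bool" where
  "normal_entourage X E \<longleftrightarrow> (\<exists>(I :: 'a set set) g. lf_cover X I g \<and>
     (\<forall>i\<in>I. \<forall>x\<in>topspace X. \<forall>y\<in>topspace X. 0 < g i x \<longrightarrow> 0 < g i y \<longrightarrow> (x, y) \<in> E))"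

lemma normal_entourageI:
  assumes g: "lf_cover X I g"
    and E: "\<And>i x y. i \<in> I \<Longrightarrow> x \<in> topspace X \<Longrightarrow> y \<in> topspace X \<Longrightarrow> 0 < g i x \<Longrightarrow> 0 < g i y \<Longrightarrow> (x, y) \<in> E"
  shows "normal_entourage X E"
proof -
  let ?c = "\<lambda>i. {x \<in> topspace X. 0 < g i x}"
  obtain h where h: "lf_cover X (?c ` I) h" "\<And>U x. U \<in> ?c ` I \<Longrightarrow> x \<in> topspace X \<Longrightarrow> 0 < h U x \<longleftrightarrow> x \<in> U"
    using lf_cover_reindex[OF g] by blast
  have "(x, y) \<in> E" if U: "U \<in> ?c ` I" "x \<in> topspace X" "y \<in> topspace X" "0 < h U x" "0 < h U y" for U x y
  proof -
    obtain i where i: "i \<in> I" "U = ?c i" using U(1) by blast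
    have "x \<in> ?c i" "y \<in> ?c i" using h(2)[OF U(1)] U(2-) i(2) by auto
    then show ?thesis using E[OF i(1) U(2,3)] by simp
  qed
  with h(1) show ?thesis unfolding normal_entourage_def by blast
qed

lemma normal_entourageE:
  fixes X :: "'a topology"
  assumes "normal_entourage X E"
  obtains I :: "'a set set" and g where "lf_cover X I g"
    "\<forall>i\<in>I. \<forall>x\<in>topspace X. \<forall>y\<in>topspace X. 0 < g i x \<longrightarrow> 0 < g i y \<longrightarrow> (x, y) \<in> E"
  using assms unfolding normal_entourage_def by blast

lemma normal_entourage_refl: "normal_entourage X E \<Longrightarrow> x \<in> topspace X \<Longrightarrow> (x, x) \<in> E"
  by (erule normal_entourageE) (meson lf_coverD(3))

lemma normal_entourage_UNIV: "normal_entourage X UNIV"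
proof (rule normal_entourageI)
  show "lf_cover X {()} (\<lambda>_ _. 1)" by (auto simp: lf_cover_def)
qed simp

lemma normal_entourage_pullback:
  fixes Y :: "'b topology"
  assumes f: "continuous_map X Y f" and E: "normal_entourage Y E"
  shows "normal_entourage X {(x, y). (f x, f y) \<in> E}"
proof -
  obtain I :: "'b set set" and g where g: "lf_cover Y I g"
    "\<forall>i\<in>I. \<forall>x\<in>topspace Y. \<forall>y\<in>topspace Y. 0 < g i x \<longrightarrow> 0 < g i y \<longrightarrow> (x, y) \<in> E"
    by (rule normal_entourageE[OF E])
  have fX: "f x \<in> topspace Y" if "x \<in> topspace X" for x using f that by (auto simp: continuous_map_def)
  show ?thesis
  proof (rule normal_entourageI)
    show "lf_cover X I (\<lambda>i x. g i (f x))"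
      unfolding lf_cover_def
    proof (intro conjI ballI)
      show "continuous_map X euclideanreal (\<lambda>x. g i (f x))" if "i \<in> I" for i
        using continuous_map_compose[OF f lf_coverD(1)[OF g(1) that]] by (simp add: o_def)
      show "0 \<le> g i (f x)" if "i \<in> I" "x \<in> topspace X" for i x using lf_coverD(2)[OF g(1) that(1) fX[OF that(2)]] .
      fix x assume x: "x \<in> topspace X"
      show "\<exists>i\<in>I. 0 < g i (f x)" by (rule lf_coverD(3)[OF g(1) fX[OF x]])
      obtain W where W: "openin Y W" "f x \<in> W" "finite {i\<in>I. \<exists>y\<in>W. g i y \<noteq> 0}"
        using lf_coverD(4)[OF g(1) fX[OF x]] by blast
      have "{i\<in>I. \<exists>y\<in>{x \<in> topspace X. f x \<in> W}. g i (f y) \<noteq> 0} \<subseteq> {i\<in>I. \<exists>y\<in>W. g i y \<noteq> 0}" by auto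
      from finite_subset[OF this W(3)]
      show "\<exists>W. openin X W \<and> x \<in> W \<and> finite {i\<in>I. \<exists>y\<in>W. g i (f y) \<noteq> 0}"
        using openin_continuous_map_preimage[OF f W(1)] x W(2) by (intro exI[of _ "{x \<in> topspace X. f x \<in> W}"]) simp
    qed
  qed (use g(2) fX in auto)
qed

lemma normal_entourage_Int:
  fixes X :: "'a topology"
  assumes "normal_entourage X E" "normal_entourage X E'"
  shows "normal_entourage X (E \<inter> E')"
proof -
  obtain I :: "'a set set" and g where g: "lf_cover X I g"
    "\<forall>i\<in>I. \<forall>x\<in>topspace X. \<forall>y\<in>topspace X. 0 < g i x \<longrightarrow> 0 < g i y \<longrightarrow> (x, y) \<in> E"
    by (rule normal_entourageE[OF assms(1)])
  obtain J :: "'a set set" and h where h: "lf_cover X J h"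
    "\<forall>i\<in>J. \<forall>x\<in>topspace X. \<forall>y\<in>topspace X. 0 < h i x \<longrightarrow> 0 < h i y \<longrightarrow> (x, y) \<in> E'"
    by (rule normal_entourageE[OF assms(2)])
  let ?k = "\<lambda>(i, j) x. g i x * h j x"
  show ?thesis
  proof (rule normal_entourageI)
    show "lf_cover X (I \<times> J) ?k"
      unfolding lf_cover_def
    proof (intro conjI ballI)
      show "continuous_map X euclideanreal (?k ij)" if "ij \<in> I \<times> J" for ij
        using that lf_coverD(1)[OF g(1)] lf_coverD(1)[OF h(1)] by (auto intro: continuous_map_real_mult)
      show "0 \<le> ?k ij x" if "ij \<in> I \<times> J" "x \<in> topspace X" for ij x
        using that lf_coverD(2)[OF g(1)] lf_coverD(2)[OF h(1)] by auto
      fix x assume x: "x \<in> topspace X"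
      obtain i j where "i \<in> I" "0 < g i x" "j \<in> J" "0 < h j x"
        using lf_coverD(3)[OF g(1) x] lf_coverD(3)[OF h(1) x] by blast
      then show "\<exists>ij\<in>I \<times> J. 0 < ?k ij x" by (intro bexI[of _ "(i, j)"]) auto
      obtain V W where V: "openin X V" "x \<in> V" "finite {i\<in>I. \<exists>y\<in>V. g i y \<noteq> 0}"
        and W: "openin X W" "x \<in> W" "finite {i\<in>J. \<exists>y\<in>W. h i y \<noteq> 0}"
        using lf_coverD(4)[OF g(1) x] lf_coverD(4)[OF h(1) x] by blast
      have "{ij\<in>I \<times> J. \<exists>y\<in>V \<inter> W. ?k ij y \<noteq> 0} \<subseteq> {i\<in>I. \<exists>y\<in>V. g i y \<noteq> 0} \<times> {i\<in>J. \<exists>y\<in>W. h i y \<noteq> 0}" by auto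
      from finite_subset[OF this finite_cartesian_product[OF V(3) W(3)]]
      show "\<exists>W. openin X W \<and> x \<in> W \<and> finite {ij\<in>I \<times> J. \<exists>y\<in>W. ?k ij y \<noteq> 0}"
        using V(1,2) W(1,2) by (intro exI[of _ "V \<inter> W"] conjI openin_Int) auto
    qed
    fix ij x y assume "ij \<in> I \<times> J" "x \<in> topspace X" "y \<in> topspace X" "0 < ?k ij x" "0 < ?k ij y"
    moreover obtain i j where ij: "ij = (i, j)" by (cases ij)
    ultimately have *: "i \<in> I" "j \<in> J" "x \<in> topspace X" "y \<in> topspace X" "0 < g i x * h j x" "0 < g i y * h j y" by auto
    then have "0 \<le> g i x" "0 \<le> h j x" "0 \<le> g i y" "0 \<le> h j y" using lf_coverD(2)[OF g(1)] lf_coverD(2)[OF h(1)] by auto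
    with * have "0 < g i x" "0 < h j x" "0 < g i y" "0 < h j y" by (auto simp: zero_less_mult_iff)
    with * show "(x, y) \<in> E \<inter> E'" using g(2) h(2) by blast
  qed
qed

text \<open>The functions \<open>G F\<close> are positive on the open stars of the barycentres of the nerve: those with
  \<open>G F x > 0\<close> form a chain of simplices \<open>F\<close>, so the star of \<open>x\<close> lies in the set given by any
  vertex of the smallest one.\<close>

lemma lf_cover_star:
  assumes g: "lf_cover X I g"
  obtains E where "normal_entourage X E" "sym E"
    "\<And>x. x \<in> topspace X \<Longrightarrow> \<exists>i\<in>I. 0 < g i x \<and> (\<forall>y. (x, y) \<in> E \<longrightarrow> y \<in> topspace X \<and> 0 < g i y)"
proof -
  define S where "S = {F. finite F \<and> F \<noteq> {} \<and> F \<subseteq> I}"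
  \<comment> \<open>Positive exactly where each value with index in \<open>F\<close> exceeds every
    value with index outside \<open>F\<close>, and 0. Two sets with this property at the same point
    are nested.\<close>
  define G where "G F x = (\<Prod>i\<in>F. max 0 (g i x - lsup (I - F) g x))" for F x
  have fin: "finite {i\<in>I. g i x \<noteq> 0}" if "x \<in> topspace X" for x by (rule lf_cover_finite[OF g that])
  have finJ: "finite {i\<in>I - F. g i x \<noteq> 0}" if "x \<in> topspace X" for x F
    using fin[OF that] by (auto elim: rev_finite_subset)
  have Gpos: "0 < G F x \<longleftrightarrow> (\<forall>i\<in>F. lsup (I - F) g x < g i x)" if "F \<in> S" for F x
  proof
    assume "0 < G F x"
    show "\<forall>i\<in>F. lsup (I - F) g x < g i x"
    proof (rule ccontr)
      assume "\<not> ?thesis"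
      then obtain i where "i \<in> F" "g i x \<le> lsup (I - F) g x" by (auto simp: not_less)
      then have "\<exists>i\<in>F. max 0 (g i x - lsup (I - F) g x) = 0" by (intro bexI[of _ i]) simp_all
      then have "G F x = 0" using that unfolding G_def S_def by (intro prod_zero) auto
      then show False using \<open>0 < G F x\<close> by simp
    qed
  qed (auto simp: G_def intro!: prod_pos)
  have Gnn: "0 \<le> G F x" for F x by (auto simp: G_def intro!: prod_nonneg)
  have Gg: "0 < g i x" if "F \<in> S" "0 < G F x" "i \<in> F" "x \<in> topspace X" for F x i
    using Gpos[OF that(1), of x] that lsup_nonneg[of "I - F" g x, OF finJ[OF that(4)]] by fastforce
  have chain: "F \<subseteq> F' \<or> F' \<subseteq> F" if F: "F \<in> S" "F' \<in> S" "0 < G F x" "0 < G F' x" "x \<in> topspace X" for F F' x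
  proof (rule ccontr)
    assume "\<not> ?thesis"
    then obtain i j where ij: "i \<in> F" "i \<notin> F'" "j \<in> F'" "j \<notin> F" by blast
    then have "i \<in> I - F'" "j \<in> I - F" using F by (auto simp: S_def)
    then have "g i x \<le> lsup (I - F') g x" "g j x \<le> lsup (I - F) g x" using lsup_ge finJ[OF F(5)] by metis+
    moreover have "lsup (I - F) g x < g i x" "lsup (I - F') g x < g j x" using F Gpos ij by auto
    ultimately show False by linarith
  qed
  have cover: "\<exists>F\<in>S. 0 < G F x" if x: "x \<in> topspace X" for x
  proof
    \<comment> \<open>Outside the support of the family at \<open>x\<close> all values are 0, so
      positivity on the support suffices.\<close>
    let ?F = "{i\<in>I. g i x \<noteq> 0}"
    show F: "?F \<in> S" using fin[OF x] lf_coverD(3)[OF g x] by (auto simp: S_def)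
    have "lsup (I - ?F) g x = lsup {} g x" by (rule lsup_eq) auto
    then have z: "lsup (I - ?F) g x = 0" by (simp add: lsup_def)
    have "\<forall>i\<in>?F. 0 < g i x" using lf_coverD(2)[OF g _ x] by (auto simp: less_le)
    then show "0 < G ?F x" by (simp add: Gpos[OF F] z)
  qed
  have lfG: "lf_cover X S G"
    unfolding lf_cover_def
  proof (intro conjI ballI Gnn cover)
    fix F assume "F \<in> S"
    then show "continuous_map X euclideanreal (G F)"
      unfolding G_def
      by (intro continuous_map_prod continuous_map_real_max continuous_map_diff continuous_map_lsup[OF g] lf_coverD(1)[OF g])
        (auto simp: S_def)
  next
    fix x assume "x \<in> topspace X"
    then obtain W where W: "openin X W" "x \<in> W" "finite {i\<in>I. \<exists>y\<in>W. g i y \<noteq> 0}" using lf_coverD(4)[OF g] by blast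
    have "{F\<in>S. \<exists>y\<in>W. G F y \<noteq> 0} \<subseteq> Pow {i\<in>I. \<exists>y\<in>W. g i y \<noteq> 0}"
    proof
      fix F assume "F \<in> {F\<in>S. \<exists>y\<in>W. G F y \<noteq> 0}"
      then obtain y where y: "F \<in> S" "y \<in> W" "G F y \<noteq> 0" by blast
      have "0 < G F y" using y(3) Gnn[of F y] by simp
      then have "\<forall>i\<in>F. 0 < g i y" using Gg[OF y(1)] y(2) openin_subset[OF W(1)] by blast
      then show "F \<in> Pow {i\<in>I. \<exists>y\<in>W. g i y \<noteq> 0}" using y by (force simp: S_def)
    qed
    from finite_subset[OF this finite_Pow_iff[THEN iffD2, OF W(3)]]
    show "\<exists>W. openin X W \<and> x \<in> W \<and> finite {F\<in>S. \<exists>y\<in>W. G F y \<noteq> 0}" using W(1,2) by blast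
  qed
  define E where "E = {(x, y). x \<in> topspace X \<and> y \<in> topspace X \<and> (\<exists>F\<in>S. 0 < G F x \<and> 0 < G F y)}"
  show ?thesis
  proof
    show "normal_entourage X E" by (rule normal_entourageI[OF lfG]) (auto simp: E_def)
    show "sym E" by (auto simp: sym_def E_def)
    fix x assume x: "x \<in> topspace X"
    obtain F where F: "F \<in> S \<and> 0 < G F x" and min: "\<And>F'. F' \<in> S \<and> 0 < G F' x \<Longrightarrow> card F \<le> card F'"
      using ex_has_least_nat[of "\<lambda>F. F \<in> S \<and> 0 < G F x" _ card] cover[OF x] by metis
    then obtain i where i: "i \<in> F" by (auto simp: S_def)
    have sub: "F \<subseteq> F'" if F': "F' \<in> S" "0 < G F' x" for F'
    proof -
      have "F' \<subseteq> F \<Longrightarrow> F' = F" using min F' F by (intro card_seteq) (auto simp: S_def)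
      then show ?thesis using chain[OF _ F'(1) _ F'(2) x] F by blast
    qed
    show "\<exists>i\<in>I. 0 < g i x \<and> (\<forall>y. (x, y) \<in> E \<longrightarrow> y \<in> topspace X \<and> 0 < g i y)"
    proof (intro bexI conjI allI impI)
      show "i \<in> I" using i F by (auto simp: S_def)
      show "0 < g i x" using Gg F i x by blast
      fix y assume "(x, y) \<in> E"
      then obtain F' where F': "F' \<in> S" "0 < G F' x" "0 < G F' y" and y: "y \<in> topspace X" by (auto simp: E_def)
      show "y \<in> topspace X" by fact
      have "i \<in> F'" using sub[OF F'(1,2)] i by blast
      then show "0 < g i y" using Gg[OF F'(1,3) _ y] by blast
    qed
  qed
qed

text \<open>By symmetry \<open>x\<close> and \<open>z\<close> both lie in the star of the middle
  point \<open>y\<close>, and this star lies in a single member of the covering that defines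
  \<open>E\<close>.\<close>

lemma normal_entourage_sqrt:
  fixes X :: "'a topology"
  assumes "normal_entourage X E"
  obtains D where "normal_entourage X D" "sym D"
    "\<forall>x y z. (x, y) \<in> D \<longrightarrow> (y, z) \<in> D \<longrightarrow> y \<in> topspace X \<longrightarrow> (x, z) \<in> E"
proof -
  obtain I :: "'a set set" and g where g: "lf_cover X I g"
    "\<forall>i\<in>I. \<forall>x\<in>topspace X. \<forall>y\<in>topspace X. 0 < g i x \<longrightarrow> 0 < g i y \<longrightarrow> (x, y) \<in> E"
    by (rule normal_entourageE[OF assms])
  obtain D where D: "normal_entourage X D" "sym D"
    "\<And>x. x \<in> topspace X \<Longrightarrow> \<exists>i\<in>I. 0 < g i x \<and> (\<forall>y. (x, y) \<in> D \<longrightarrow> y \<in> topspace X \<and> 0 < g i y)"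
    using lf_cover_star[OF g(1)] by blast
  show ?thesis
  proof (rule that[OF D(1,2)]; intro allI impI)
    fix x y z assume xy: "(x, y) \<in> D" "(y, z) \<in> D" "y \<in> topspace X"
    have "(y, x) \<in> D" using xy(1) D(2) by (rule symD[rotated])
    obtain i where "i \<in> I" "\<And>w. (y, w) \<in> D \<Longrightarrow> w \<in> topspace X \<and> 0 < g i w" using D(3)[OF xy(3)] by blast
    then show "(x, z) \<in> E" using g(2) \<open>(y, x) \<in> D\<close> xy(2) by blast
  qed
qed

text \<open>Pairwise closeness does not by itself put a tuple into one member of a covering. With
  \<open>D\<close> from \<open>lf_cover_star\<close> it does, because the whole tuple lies in the
  star of its first entry. The other direction takes the sets of positivity as covering.\<close>

lemma locally_zero_iff:
  fixes X :: "'a topology"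
  shows "(\<exists>\<U>. normal_covering X \<U> \<and> (\<forall>xs\<in>tuples X n. (\<exists>U\<in>\<U>. set xs \<subseteq> U) \<longrightarrow> \<phi> xs = 0)) \<longleftrightarrow>
   (\<exists>E. normal_entourage X E \<and> (\<forall>xs\<in>tuples X n. set xs \<times> set xs \<subseteq> E \<longrightarrow> \<phi> xs = 0))"
proof
  assume "\<exists>\<U>. normal_covering X \<U> \<and> (\<forall>xs\<in>tuples X n. (\<exists>U\<in>\<U>. set xs \<subseteq> U) \<longrightarrow> \<phi> xs = 0)"
  then obtain \<U> where U: "normal_covering X \<U>" "\<And>xs. xs \<in> tuples X n \<Longrightarrow> \<exists>U\<in>\<U>. set xs \<subseteq> U \<Longrightarrow> \<phi> xs = 0" by blast
  obtain g where g: "lf_cover X \<U> g" "\<And>U x. U \<in> \<U> \<Longrightarrow> x \<in> topspace X \<Longrightarrow> 0 < g U x \<Longrightarrow> x \<in> U"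
    using lf_cover_normal_covering[OF U(1)] by blast
  obtain D where D: "normal_entourage X D" "sym D"
    "\<And>x. x \<in> topspace X \<Longrightarrow> \<exists>i\<in>\<U>. 0 < g i x \<and> (\<forall>y. (x, y) \<in> D \<longrightarrow> y \<in> topspace X \<and> 0 < g i y)"
    using lf_cover_star[OF g(1)] by blast
  have "\<phi> xs = 0" if xs: "xs \<in> tuples X n" "set xs \<times> set xs \<subseteq> D" for xs
  proof (rule U(2)[OF xs(1)])
    have "xs \<noteq> []" "set xs \<subseteq> topspace X" using xs(1) by (auto simp: tuples_def)
    then have h: "hd xs \<in> topspace X" "hd xs \<in> set xs" by (auto simp: subset_iff)
    obtain i where i: "i \<in> \<U>" "\<And>y. (hd xs, y) \<in> D \<Longrightarrow> y \<in> topspace X \<and> 0 < g i y" using D(3)[OF h(1)] by blast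
    have "set xs \<subseteq> i" using i g(2)[OF i(1)] xs(2) h(2) by blast
    then show "\<exists>U\<in>\<U>. set xs \<subseteq> U" using i(1) by blast
  qed
  then show "\<exists>E. normal_entourage X E \<and> (\<forall>xs\<in>tuples X n. set xs \<times> set xs \<subseteq> E \<longrightarrow> \<phi> xs = 0)" using D(1) by blast
next
  assume "\<exists>E. normal_entourage X E \<and> (\<forall>xs\<in>tuples X n. set xs \<times> set xs \<subseteq> E \<longrightarrow> \<phi> xs = 0)"
  then obtain E where E: "normal_entourage X E" "\<And>xs. xs \<in> tuples X n \<Longrightarrow> set xs \<times> set xs \<subseteq> E \<Longrightarrow> \<phi> xs = 0" by blast
  obtain I :: "'a set set" and g where g: "lf_cover X I g"
    "\<forall>i\<in>I. \<forall>x\<in>topspace X. \<forall>y\<in>topspace X. 0 < g i x \<longrightarrow> 0 < g i y \<longrightarrow> (x, y) \<in> E"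
    by (rule normal_entourageE[OF E(1)])
  let ?U = "(\<lambda>i. {x \<in> topspace X. 0 < g i x}) ` I"
  have "\<phi> xs = 0" if Us: "xs \<in> tuples X n" "U \<in> ?U" "set xs \<subseteq> U" for xs U
  proof (rule E(2)[OF Us(1)])
    obtain i where i: "i \<in> I" "U = {x \<in> topspace X. 0 < g i x}" using Us(2) by blast
    show "set xs \<times> set xs \<subseteq> E" using g(2) i(1) Us(3) i(2) by blast
  qed
  then show "\<exists>\<U>. normal_covering X \<U> \<and> (\<forall>xs\<in>tuples X n. (\<exists>U\<in>\<U>. set xs \<subseteq> U) \<longrightarrow> \<phi> xs = 0)"
    using normal_covering_lf_cover[OF g(1)] by blast
qed

section \<open>Polyhedra and resolutions\<close>

lemma open_covering_pullback:
  assumes f: "continuous_map X Y f" and V: "open_covering Y \<V>"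
  shows "open_covering X ((\<lambda>V. {x \<in> topspace X. f x \<in> V}) ` \<V>)"
  unfolding open_covering_def
proof (intro conjI ballI)
  fix U assume "U \<in> (\<lambda>V. {x \<in> topspace X. f x \<in> V}) ` \<V>"
  then show "openin X U" using V openin_continuous_map_preimage[OF f] by (auto simp: open_covering_def)
next
  have "f x \<in> \<Union>\<V>" if "x \<in> topspace X" for x
    using V that f by (auto simp: open_covering_def continuous_map_def)
  then show "\<Union>((\<lambda>V. {x \<in> topspace X. f x \<in> V}) ` \<V>) = topspace X" by blast
qed

lemma homeomorphic_copy:
  assumes "inj_on j (topspace Q)"
  obtains P where "homeomorphic_maps Q P j (inv_into (topspace Q) j)"
proof
  let ?k = "inv_into (topspace Q) j"
  let ?P = "pullback_topology (j ` topspace Q) ?k Q"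
  have tP: "topspace ?P = j ` topspace Q"
    using assms by (auto simp: topspace_pullback_topology)
  have "continuous_map ?P Q ?k"
    using continuous_map_pullback[of Q Q "\<lambda>x. x" "j ` topspace Q" ?k] by (simp add: o_def)
  moreover have "continuous_map Q ?P j"
  proof (rule continuous_map_pullback')
    show "continuous_map Q Q (?k \<circ> j)"
      by (rule continuous_map_eq[of _ _ "\<lambda>x. x"]) (use assms in auto)
  qed auto
  ultimately show "homeomorphic_maps Q ?P j ?k"
    using assms by (auto simp: homeomorphic_maps_def tP)
qed

lemma resolution_transfer:
  fixes P :: "'u topology"
  assumes res: "resolution TYPE('u) \<Lambda> leq Y p X q" and P: "polyhedral_space P" and jk: "homeomorphic_maps Q P j k"
    and V: "open_covering Q \<V>"
  shows "continuous_map X Q h \<Longrightarrow> \<exists>l\<in>\<Lambda>. \<exists>h'. continuous_map (Y l) Q h' \<and> near X \<V> (h' \<circ> q l) h"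
    and "\<exists>\<V>'. open_covering Q \<V>' \<and> (\<forall>l\<in>\<Lambda>. \<forall>h h'. continuous_map (Y l) Q h \<and> continuous_map (Y l) Q h' \<and>
              near X \<V>' (h \<circ> q l) (h' \<circ> q l) \<longrightarrow> (\<exists>m\<in>\<Lambda>. leq l m \<and> near (Y m) \<V> (h \<circ> p l m) (h' \<circ> p l m)))"
proof -
  have j: "continuous_map Q P j" and k: "continuous_map P Q k" and kj: "\<And>x. x \<in> topspace Q \<Longrightarrow> k (j x) = x"
    using jk by (auto simp: homeomorphic_maps_def)
  have sys: "inverse_system_of_spaces \<Lambda> leq Y p" "maps_to_system \<Lambda> leq Y p X q" using res by (auto simp: resolution_def)
  let ?VP = "(\<lambda>V. {x \<in> topspace P. k x \<in> V}) ` \<V>"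
  have VP: "open_covering P ?VP" by (rule open_covering_pullback[OF k V])
  show "\<exists>l\<in>\<Lambda>. \<exists>h'. continuous_map (Y l) Q h' \<and> near X \<V> (h' \<circ> q l) h" if h: "continuous_map X Q h"
  proof -
    have "continuous_map X P (j \<circ> h)" using continuous_map_compose[OF h j] .
    then obtain l h' where l: "l \<in> \<Lambda>" "continuous_map (Y l) P h'" "near X ?VP (h' \<circ> q l) (j \<circ> h)"
      using res P VP unfolding resolution_def by blast
    have "near X \<V> ((k \<circ> h') \<circ> q l) h"
      unfolding near_def
    proof
      fix x assume x: "x \<in> topspace X"
      then have hx: "h x \<in> topspace Q" using h by (auto simp: continuous_map_def)
      obtain V where "V \<in> \<V>" "k (h' (q l x)) \<in> V" "k (j (h x)) \<in> V" using l(3) x by (auto simp: near_def)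
      then show "\<exists>V\<in>\<V>. ((k \<circ> h') \<circ> q l) x \<in> V \<and> h x \<in> V" using kj[OF hx] by auto
    qed
    then show ?thesis using l continuous_map_compose[OF l(2) k] by blast
  qed
  obtain \<V>' where V': "open_covering P \<V>'" "\<And>l h h'. \<lbrakk>l\<in>\<Lambda>; continuous_map (Y l) P h; continuous_map (Y l) P h';
      near X \<V>' (h \<circ> q l) (h' \<circ> q l)\<rbrakk> \<Longrightarrow> \<exists>m\<in>\<Lambda>. leq l m \<and> near (Y m) ?VP (h \<circ> p l m) (h' \<circ> p l m)"
    using res P VP unfolding resolution_def by meson
  let ?VQ = "(\<lambda>V. {x \<in> topspace Q. j x \<in> V}) ` \<V>'"
  have "open_covering Q ?VQ" by (rule open_covering_pullback[OF j V'(1)])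
  moreover have "\<exists>m\<in>\<Lambda>. leq l m \<and> near (Y m) \<V> (h \<circ> p l m) (h' \<circ> p l m)"
    if l: "l \<in> \<Lambda>" and h: "continuous_map (Y l) Q h" "continuous_map (Y l) Q h'" and n: "near X ?VQ (h \<circ> q l) (h' \<circ> q l)" for l h h'
  proof -
    have "near X \<V>' ((j \<circ> h) \<circ> q l) ((j \<circ> h') \<circ> q l)" using n by (fastforce simp: near_def)
    then obtain m where m: "m \<in> \<Lambda>" "leq l m" "near (Y m) ?VP ((j \<circ> h) \<circ> p l m) ((j \<circ> h') \<circ> p l m)"
      using V'(2)[OF l continuous_map_compose[OF h(1) j] continuous_map_compose[OF h(2) j]] by blast
    have "near (Y m) \<V> (h \<circ> p l m) (h' \<circ> p l m)"
      unfolding near_def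
    proof
      fix y assume y: "y \<in> topspace (Y m)"
      have "continuous_map (Y m) (Y l) (p l m)" using sys(1) l m by (auto simp: inverse_system_of_spaces_def)
      then have "p l m y \<in> topspace (Y l)" using y by (auto simp: continuous_map_def)
      then have t: "h (p l m y) \<in> topspace Q" "h' (p l m y) \<in> topspace Q" using h by (auto simp: continuous_map_def)
      obtain V where "V \<in> \<V>" "k (j (h (p l m y))) \<in> V" "k (j (h' (p l m y))) \<in> V" using m(3) y by (auto simp: near_def)
      then show "\<exists>V\<in>\<V>. (h \<circ> p l m) y \<in> V \<and> (h' \<circ> p l m) y \<in> V" using kj t by auto
    qed
    then show ?thesis using m by blast
  qed
  ultimately show "\<exists>\<V>'. open_covering Q \<V>' \<and> (\<forall>l\<in>\<Lambda>. \<forall>h h'. continuous_map (Y l) Q h \<and> continuous_map (Y l) Q h' \<and>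
              near X \<V>' (h \<circ> q l) (h' \<circ> q l) \<longrightarrow> (\<exists>m\<in>\<Lambda>. leq l m \<and> near (Y m) \<V> (h \<circ> p l m) (h' \<circ> p l m)))"
    by blast
qed

section \<open>Maps into and out of realizations\<close>

lemma closed_simplexD:
  assumes "t \<in> closed_simplex \<sigma>"
  shows "0 \<le> t v" "v \<notin> \<sigma> \<Longrightarrow> t v = 0" "sum t \<sigma> = 1"
  using assms by (auto simp: closed_simplex_def)

lemma continuous_map_from_realization:
  assumes "\<And>\<sigma>. \<sigma> \<in> K \<Longrightarrow> continuous_map (top_of_set (closed_simplex \<sigma>)) Z g"
  shows "continuous_map (realization K) Z g"
  unfolding continuous_map_def
proof (intro conjI allI impI)
  show "g \<in> topspace (realization K) \<rightarrow> topspace Z"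
    using assms by (fastforce simp: topspace_realization continuous_map_def)
  fix U assume U: "openin Z U"
  let ?W = "{t \<in> topspace (realization K). g t \<in> U}"
  have "openin (top_of_set (closed_simplex \<sigma>)) (closed_simplex \<sigma> \<inter> ?W)" if "\<sigma> \<in> K" for \<sigma>
  proof -
    have "closed_simplex \<sigma> \<inter> ?W = {t \<in> topspace (top_of_set (closed_simplex \<sigma>)). g t \<in> U}"
      using that by (auto simp: topspace_realization)
    then show ?thesis using openin_continuous_map_preimage[OF assms[OF that] U] by simp
  qed
  then show "openin (realization K) ?W"
    by (auto simp: openin_realization realization_open_def topspace_realization)
qed

lemma continuous_map_simplex_coordinate: "continuous_map (top_of_set (closed_simplex \<sigma>)) euclideanreal (\<lambda>t. t v)"
  by (intro continuous_map_from_subtopology) (simp add: euclidean_product_topology)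

text \<open>The weak topology is finer in general than that of the coordinates. The two agree on a
  single closed simplex, so it is enough that the map stays locally in one.\<close>

lemma continuous_map_into_realization:
  assumes c: "\<And>v. continuous_map Y euclideanreal (\<lambda>y. f y v)"
    and loc: "\<And>y. y \<in> topspace Y \<Longrightarrow> \<exists>W \<sigma>. openin Y W \<and> y \<in> W \<and> \<sigma> \<in> K \<and> f ` W \<subseteq> closed_simplex \<sigma>"
  shows "continuous_map Y (realization K) f"
proof (rule continuous_map_locally)
  fix y assume "y \<in> topspace Y"
  then obtain W \<sigma> where W: "openin Y W" "y \<in> W" "\<sigma> \<in> K" "f ` W \<subseteq> closed_simplex \<sigma>" using loc by blast
  have "continuous_map Y euclidean f"
    using c by (simp add: continuous_map_componentwise_UNIV flip: euclidean_product_topology)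
  then have "continuous_map (subtopology Y W) (top_of_set (closed_simplex \<sigma>)) f"
    using W(4) by (intro continuous_map_into_subtopology continuous_map_from_subtopology) auto
  moreover have "continuous_map (top_of_set (closed_simplex \<sigma>)) (realization K) (\<lambda>t. t)"
    unfolding continuous_map_def
  proof (intro conjI allI impI)
    show "(\<lambda>t. t) \<in> topspace (top_of_set (closed_simplex \<sigma>)) \<rightarrow> topspace (realization K)"
      using W(3) by (auto simp: topspace_realization)
    fix U assume "openin (realization K) U"
    then have "openin (top_of_set (closed_simplex \<sigma>)) (closed_simplex \<sigma> \<inter> U)"
      using W(3) by (auto simp: openin_realization realization_open_def)
    then show "openin (top_of_set (closed_simplex \<sigma>)) {t \<in> topspace (top_of_set (closed_simplex \<sigma>)). t \<in> U}"
      by (simp add: Int_def)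
  qed
  ultimately have "continuous_map (subtopology Y W) (realization K) ((\<lambda>t. t) \<circ> f)" by (rule continuous_map_compose)
  then show "\<exists>W. openin Y W \<and> y \<in> W \<and> continuous_map (subtopology Y W) (realization K) f"
    using W by (auto simp: o_def)
qed

text \<open>The full simplex on all elements of \<open>'v\<close>. It replaces the nerves of
  coverings: a locally finite family maps a neighbourhood of each point into one finite face, as the
  CW topology requires.\<close>

definition full_complex :: "'v set set" where
  "full_complex = {\<sigma>. finite \<sigma> \<and> \<sigma> \<noteq> {}}"

lemma abstract_complex_full: "abstract_complex full_complex"
  by (auto simp: abstract_complex_def full_complex_def intro: finite_subset)

lemma realization_finite_support:
  assumes "K \<subseteq> full_complex" "t \<in> topspace (realization K)"
  shows "finite {v. t v \<noteq> 0}"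
proof -
  obtain \<sigma> where "\<sigma> \<in> K" "t \<in> closed_simplex \<sigma>" using assms(2) by (auto simp: topspace_realization)
  then have "{v. t v \<noteq> 0} \<subseteq> \<sigma>" "finite \<sigma>"
    using closed_simplexD(2)[of t \<sigma>] assms(1) by (auto simp: full_complex_def)
  then show ?thesis by (rule finite_subset)
qed

text \<open>A function of finite support is a finite list of pairs of a vertex and a real number. As
  \<open>'u\<close> is infinite it contains its own square, so pairs and then lists can be coded
  inside \<open>'u\<close>.\<close>

lemma inj_finite_support:
  fixes r :: "real \<Rightarrow> 'u"
  assumes r: "inj r"
  obtains j :: "('u \<Rightarrow> real) \<Rightarrow> 'u" where "inj_on j {t. finite {v. t v \<noteq> 0}}"
proof -
  have inf: "infinite (UNIV :: 'u set)"
    using r infinite_UNIV_char_0[where 'a = real] finite_imageD[OF _ r] by (metis finite_subset top_greatest)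
  have "\<exists>f. bij_betw f ((UNIV :: 'u set) \<times> (UNIV :: 'u set)) (UNIV :: 'u set)"
    unfolding card_of_ordIso by (rule card_of_Times_same_infinite[OF inf])
  then obtain pr :: "'u \<times> 'u \<Rightarrow> 'u" where pr: "inj pr" by (auto simp: bij_betw_def)
  have pr_eq: "pr (a, b) = pr (c, d) \<longleftrightarrow> a = c \<and> b = d" for a b c d using inj_eq[OF pr] by simp
  define enc where "enc = (\<lambda>xs :: 'u list. foldr (\<lambda>x y. pr (x, y)) xs (r 0))"
  have enc: "enc xs = enc ys \<Longrightarrow> xs = ys" if "length xs = length ys" for xs ys
    using that by (induction xs ys rule: list_induct2) (auto simp: enc_def pr_eq)
  \<comment> \<open>\<open>enc\<close> separates only lists of equal length, so the length is
    recorded as well.\<close>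
  define code where "code xs = pr (r (real (length xs)), enc xs)" for xs
  have code: "code xs = code ys \<Longrightarrow> xs = ys" for xs ys
    using enc[of xs ys] inj_eq[OF r] by (auto simp: code_def pr_eq)
  define vs where "vs t = (SOME xs. set xs = {v. t v \<noteq> 0})" for t :: "'u \<Rightarrow> real"
  have vs: "set (vs t) = {v. t v \<noteq> 0}" if "finite {v. t v \<noteq> 0}" for t
    unfolding vs_def by (rule someI_ex) (use finite_list[OF that] in blast)
  define L where "L t = map (\<lambda>v. pr (v, r (t v))) (vs t)" for t
  have L: "t = t'" if e: "L t = L t'" and f: "finite {v. t v \<noteq> 0}" "finite {v. t' v \<noteq> 0}" for t t'
  proof -
    have s: "set (L u) = {pr (v, r (u v)) | v. u v \<noteq> 0}" if "finite {v. u v \<noteq> 0}" for u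
      using vs[OF that] by (auto simp: L_def)
    have *: "t v = t' v" if "t v \<noteq> 0" "set (L t) = set (L t')" "finite {v. t v \<noteq> 0}" "finite {v. t' v \<noteq> 0}" for t t' v
    proof -
      have "pr (v, r (t v)) \<in> set (L t')" using that s[OF that(3)] by blast
      then show ?thesis using s[OF that(4)] by (auto simp: pr_eq inj_eq[OF r])
    qed
    show ?thesis
    proof
      fix v show "t v = t' v" using *[of t v t'] *[of t' v t] e f by (metis)
    qed
  qed
  have "inj_on (\<lambda>t. code (L t)) {t. finite {v. t v \<noteq> 0}}"
    using code L by (intro inj_onI) blast
  then show ?thesis by (rule that)
qed

text \<open>The test polyhedra live on \<open>'u\<close>, but a realization lives on
  \<open>'u \<Rightarrow> real\<close>. Its points have finite support, so it has a homeomorphic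
  copy on \<open>'u\<close>, and both conditions are carried over along the homeomorphism.\<close>

lemma resolution_realization:
  fixes K :: "'u set set" and r :: "real \<Rightarrow> 'u"
  assumes res: "resolution TYPE('u) \<Lambda> leq Y p X q" and r: "inj r" and K: "abstract_complex K"
    and V: "open_covering (realization K) \<V>"
  shows "continuous_map X (realization K) h \<Longrightarrow> \<exists>l\<in>\<Lambda>. \<exists>h'. continuous_map (Y l) (realization K) h' \<and> near X \<V> (h' \<circ> q l) h"
    and "\<exists>\<V>'. open_covering (realization K) \<V>' \<and> (\<forall>l\<in>\<Lambda>. \<forall>h h'. continuous_map (Y l) (realization K) h \<and> continuous_map (Y l) (realization K) h' \<and>
              near X \<V>' (h \<circ> q l) (h' \<circ> q l) \<longrightarrow> (\<exists>m\<in>\<Lambda>. leq l m \<and> near (Y m) \<V> (h \<circ> p l m) (h' \<circ> p l m)))"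
proof -
  have Kf: "K \<subseteq> full_complex" using K by (auto simp: abstract_complex_def full_complex_def)
  obtain j :: "('u \<Rightarrow> real) \<Rightarrow> 'u" where j: "inj_on j {t. finite {v. t v \<noteq> 0}}" by (rule inj_finite_support[OF r])
  have "inj_on j (topspace (realization K))"
    by (rule inj_on_subset[OF j]) (use realization_finite_support[OF Kf] in blast)
  then obtain P where P: "homeomorphic_maps (realization K) P j (inv_into (topspace (realization K)) j)"
    by (rule homeomorphic_copy)
  then have "polyhedral_space P"
    unfolding polyhedral_space_def using K homeomorphic_maps_imp_homeomorphic_space homeomorphic_space_sym by blast
  note T = resolution_transfer[OF res this P V]
  show "continuous_map X (realization K) h \<Longrightarrow> \<exists>l\<in>\<Lambda>. \<exists>h'. continuous_map (Y l) (realization K) h' \<and> near X \<V> (h' \<circ> q l) h"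
    by (rule T(1))
  show "\<exists>\<V>'. open_covering (realization K) \<V>' \<and> (\<forall>l\<in>\<Lambda>. \<forall>h h'. continuous_map (Y l) (realization K) h \<and> continuous_map (Y l) (realization K) h' \<and>
              near X \<V>' (h \<circ> q l) (h' \<circ> q l) \<longrightarrow> (\<exists>m\<in>\<Lambda>. leq l m \<and> near (Y m) \<V> (h \<circ> p l m) (h' \<circ> p l m)))"
    by (rule T(2))
qed

lemma closed_simplex_lsup:
  assumes t: "t \<in> closed_simplex \<sigma>"
  shows "lsup (J :: 'v set) (\<lambda>v t. t v) t = lsup (J \<inter> \<sigma>) (\<lambda>v t. t v) t"
  by (rule lsup_eq) (use closed_simplexD(2)[OF t] in auto)

text \<open>Continuity is checked on each closed simplex, where only the finitely many vertices in
  \<open>J \<inter> \<sigma>\<close> contribute.\<close>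

lemma continuous_map_realization_lsup:
  assumes "K \<subseteq> full_complex"
  shows "continuous_map (realization K) euclideanreal (lsup J (\<lambda>v t. t v))"
proof (rule continuous_map_from_realization)
  fix \<sigma> assume "\<sigma> \<in> K"
  then have "finite \<sigma>" using assms by (auto simp: full_complex_def)
  then have "continuous_map (top_of_set (closed_simplex \<sigma>)) euclideanreal (lsup (J \<inter> \<sigma>) (\<lambda>v t. t v))"
    by (intro continuous_map_lsup_finite continuous_map_simplex_coordinate) auto
  then show "continuous_map (top_of_set (closed_simplex \<sigma>)) euclideanreal (lsup J (\<lambda>v t. t v))"
    by (rule continuous_map_eq) (simp add: closed_simplex_lsup[of _ \<sigma> J])
qed

text \<open>The barycentric coordinates are not locally finite in the CW topology, but their
  truncations at half of the largest coordinate are.\<close>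

lemma normal_entourage_open_stars:
  fixes K :: "'v set set"
  assumes K: "K \<subseteq> full_complex"
  shows "normal_entourage (realization K) {(s, t). \<exists>v. 0 < s v \<and> 0 < t v}"
proof (rule normal_entourageI)
  let ?Q = "realization K" and ?c = "\<lambda>(v :: 'v) (t :: 'v \<Rightarrow> real). t v"
  let ?M = "lsup UNIV ?c"
  have fin: "finite {v \<in> J. t v \<noteq> 0}" if "t \<in> topspace ?Q" for t J
    using realization_finite_support[OF K that] by (auto elim: rev_finite_subset)
  have nn: "0 \<le> t v" if "t \<in> topspace ?Q" for t v
    using that closed_simplexD(1) by (auto simp: topspace_realization)
  have pos: "\<exists>v. 0 < t v" if t: "t \<in> topspace ?Q" for t
  proof (rule ccontr)
    assume "\<not> ?thesis"
    then have "\<not> 0 < t v" for v by blast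
    then have "t v = 0" for v using nn[OF t, of v] by (simp add: order.antisym not_less)
    moreover obtain \<sigma> where "t \<in> closed_simplex \<sigma>" using t by (auto simp: topspace_realization)
    ultimately show False using closed_simplexD(3)[of t \<sigma>] by simp
  qed
  have M: "continuous_map ?Q euclideanreal (lsup J ?c)" for J by (rule continuous_map_realization_lsup[OF K])
  have coord: "continuous_map ?Q euclideanreal (\<lambda>t. t v)" for v
    by (rule continuous_map_from_realization) (rule continuous_map_simplex_coordinate)
  have Mge: "t v \<le> ?M t" if "t \<in> topspace ?Q" for t v using lsup_ge[of UNIV ?c t v] fin[OF that, of UNIV] by simp
  have Mpos: "0 < ?M t" if t: "t \<in> topspace ?Q" for t
  proof -
    obtain v where "0 < t v" using pos[OF t] ..
    then show ?thesis using Mge[OF t, of v] by linarith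
  qed
  let ?f = "\<lambda>v t. max 0 (2 * t v - ?M t)"
  show "lf_cover ?Q UNIV ?f"
    unfolding lf_cover_def
  proof (intro conjI ballI)
    show "continuous_map ?Q euclideanreal (?f v)" for v
      by (intro continuous_map_real_max continuous_map_diff continuous_map_real_mult_left coord M) simp
    show "0 \<le> ?f v t" for v t by simp
    fix t assume t: "t \<in> topspace ?Q"
    obtain v where "t v = ?M t" using lsup_attained[of UNIV ?c t] fin[OF t, of UNIV] Mpos[OF t] by auto
    then show "\<exists>v\<in>UNIV. 0 < ?f v t" using Mpos[OF t] by (intro bexI[of _ v]) auto
    let ?F = "{v. t v \<noteq> 0}"
    \<comment> \<open>On this neighbourhood every vertex outside the support of \<open>t\<close> has
      a coordinate below half of the maximum, so its truncation vanishes. The support of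
      \<open>t\<close> is finite.\<close>
    let ?W = "{s \<in> topspace ?Q. ?M s - 2 * lsup (- ?F) ?c s \<in> {0<..}}"
    have "continuous_map ?Q euclideanreal (\<lambda>s. ?M s - 2 * lsup (- ?F) ?c s)"
      by (intro continuous_map_diff continuous_map_real_mult_left M)
    then have "openin ?Q ?W" by (rule openin_continuous_map_preimage) simp
    moreover have "lsup (- ?F) ?c t = lsup {} ?c t" by (rule lsup_eq) auto
    then have "t \<in> ?W" using Mpos[OF t] t by (simp add: lsup_def)
    moreover have "{v \<in> UNIV. \<exists>s\<in>?W. ?f v s \<noteq> 0} \<subseteq> ?F"
    proof
      fix v assume "v \<in> {v \<in> UNIV. \<exists>s\<in>?W. ?f v s \<noteq> 0}"
      then obtain s where s: "s \<in> topspace ?Q" "2 * lsup (- ?F) ?c s < ?M s" "?f v s \<noteq> 0" by auto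
      show "v \<in> ?F"
      proof (rule ccontr)
        assume "v \<notin> ?F"
        then have "s v \<le> lsup (- ?F) ?c s" using lsup_ge[of "- ?F" ?c s v, OF fin[OF s(1)]] by simp
        then show False using s(2,3) by simp
      qed
    qed
    then have "finite {v \<in> UNIV. \<exists>s\<in>?W. ?f v s \<noteq> 0}"
      by (rule finite_subset) (use fin[OF t, of UNIV] in simp)
    ultimately show "\<exists>W. openin ?Q W \<and> t \<in> W \<and> finite {v \<in> UNIV. \<exists>s\<in>W. ?f v s \<noteq> 0}" by blast
  qed
  fix v s t assume st: "s \<in> topspace ?Q" "t \<in> topspace ?Q" "0 < ?f v s" "0 < ?f v t"
  have "0 < ?M s" "0 < ?M t" using Mpos[OF st(1)] Mpos[OF st(2)] .
  moreover have "?M s < 2 * s v" "?M t < 2 * t v" using st(3,4) by (simp_all add: less_max_iff_disj)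
  ultimately have "0 < s v" "0 < t v" by linarith+
  then show "(s, t) \<in> {(s, t). \<exists>v. 0 < s v \<and> 0 < t v}" by blast
qed

text \<open>A member that is positive somewhere is named by a point \<open>x i\<close> where it is
  positive and by its number among the finitely many members that are nonzero there. This is why
  \<open>'a \<times> real\<close> has to embed into \<open>'u\<close>; members that vanish
  everywhere are dropped.\<close>

lemma lf_cover_index_inj:
  fixes e :: "'a \<times> real \<Rightarrow> 'u" and X :: "'a topology"
  assumes e: "inj e" and g: "lf_cover X I g"
  obtains J :: "'u set" and \<pi> where "lf_cover X J (\<lambda>v. g (\<pi> v))" "\<And>v. v \<in> J \<Longrightarrow> \<pi> v \<in> I"
proof -
  define I' where "I' = {i \<in> I. \<exists>x\<in>topspace X. 0 < g i x}"
  define x where "x i = (SOME x. x \<in> topspace X \<and> 0 < g i x)" for i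
  have x: "x i \<in> topspace X \<and> 0 < g i (x i)" if "i \<in> I'" for i
    unfolding x_def by (rule someI_ex) (use that in \<open>auto simp: I'_def\<close>)
  have "\<exists>f :: _ \<Rightarrow> nat. inj_on f {i \<in> I. g i y \<noteq> 0}" if "y \<in> topspace X" for y
    using finite_imp_inj_to_nat_seg[OF lf_cover_finite[OF g that]] by blast
  then have "\<forall>y\<in>topspace X. \<exists>f :: _ \<Rightarrow> nat. inj_on f {i \<in> I. g i y \<noteq> 0}" by blast
  from bchoice[OF this] obtain f where f': "\<forall>y\<in>topspace X. inj_on (f y :: _ \<Rightarrow> nat) {i \<in> I. g i y \<noteq> 0}" ..
  note f = f'[rule_format]
  define u where "u i = e (x i, real (f (x i) i))" for i
  have u: "inj_on u I'"
  proof (rule inj_onI)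
    fix i j assume ij: "i \<in> I'" "j \<in> I'" "u i = u j"
    then have xx: "x i = x j" "f (x i) i = f (x i) j" using inj_eq[OF e] by (auto simp: u_def)
    have "i \<in> {i \<in> I. g i (x i) \<noteq> 0}" "j \<in> {j \<in> I. g j (x j) \<noteq> 0}" using x ij by (force simp: I'_def)+
    then show "i = j" using inj_onD[OF f[of "x i"] xx(2)] x[OF ij(1)] xx(1) by simp
  qed
  show ?thesis
  proof
    show "inv_into I' u v \<in> I" if "v \<in> u ` I'" for v using inv_into_into[OF that] by (simp add: I'_def)
    show "lf_cover X (u ` I') (\<lambda>v. g (inv_into I' u v))"
      unfolding lf_cover_def
    proof (intro conjI ballI)
      fix v assume "v \<in> u ` I'"
      then have "inv_into I' u v \<in> I" using inv_into_into[of v u I'] by (simp add: I'_def)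
      then show "continuous_map X euclideanreal (g (inv_into I' u v))" "\<And>y. y \<in> topspace X \<Longrightarrow> 0 \<le> g (inv_into I' u v) y"
        by (rule lf_coverD(1)[OF g], rule lf_coverD(2)[OF g])
    next
      fix y assume y: "y \<in> topspace X"
      then obtain i where i: "i \<in> I" "0 < g i y" using lf_coverD(3)[OF g] by blast
      then have "i \<in> I'" using y by (auto simp: I'_def)
      then show "\<exists>v\<in>u ` I'. 0 < g (inv_into I' u v) y" using i u by (intro bexI[of _ "u i"]) auto
      obtain W where W: "openin X W" "y \<in> W" "finite {i\<in>I. \<exists>y\<in>W. g i y \<noteq> 0}" using lf_coverD(4)[OF g y] by blast
      have "{v \<in> u ` I'. \<exists>y\<in>W. g (inv_into I' u v) y \<noteq> 0} \<subseteq> u ` {i\<in>I. \<exists>y\<in>W. g i y \<noteq> 0}"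
      proof
        fix v assume "v \<in> {v \<in> u ` I'. \<exists>y\<in>W. g (inv_into I' u v) y \<noteq> 0}"
        then obtain i where i: "i \<in> I'" "v = u i" "\<exists>y\<in>W. g (inv_into I' u (u i)) y \<noteq> 0" by blast
        have "i \<in> {i\<in>I. \<exists>y\<in>W. g i y \<noteq> 0}" using i(1,3) unfolding inv_into_f_f[OF u i(1)] by (simp add: I'_def)
        then show "v \<in> u ` {i\<in>I. \<exists>y\<in>W. g i y \<noteq> 0}" using i(2) by blast
      qed
      from finite_subset[OF this finite_imageI[OF W(3)]]
      show "\<exists>W. openin X W \<and> y \<in> W \<and> finite {v \<in> u ` I'. \<exists>y\<in>W. g (inv_into I' u v) y \<noteq> 0}"
        using W(1,2) by blast
    qed
  qed
qed

text \<open>The normalized functions serve as barycentric coordinates. Near each point only finitely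
  many of them are nonzero, so the map stays in one closed simplex.\<close>

lemma canonical_map:
  fixes g :: "'u \<Rightarrow> 'a \<Rightarrow> real"
  assumes g: "lf_cover X J g"
  obtains h where "continuous_map X (realization full_complex) h"
    "\<And>x v. x \<in> topspace X \<Longrightarrow> 0 < h x v \<Longrightarrow> v \<in> J \<and> 0 < g v x"
proof
  let ?S = "lsum J g"
  define h where "h x v = (if v \<in> J then g v x / ?S x else 0)" for x v
  have fin: "finite {v\<in>J. g v x \<noteq> 0}" if "x \<in> topspace X" for x by (rule lf_cover_finite[OF g that])
  have Spos: "0 < ?S x" if x: "x \<in> topspace X" for x
  proof -
    obtain i where i: "i \<in> J" "0 < g i x" using lf_coverD(3)[OF g x] by blast
    have "0 < g i x" by fact
    also have "g i x \<le> ?S x" unfolding lsum_def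
      using i lf_coverD(2)[OF g _ x] fin[OF x] by (intro member_le_sum) auto
    finally show ?thesis .
  qed
  show "v \<in> J \<and> 0 < g v x" if "x \<in> topspace X" "0 < h x v" for x v
    using that Spos[OF that(1)] by (auto simp: h_def zero_less_divide_iff split: if_splits)
  show "continuous_map X (realization full_complex) h"
  proof (rule continuous_map_into_realization)
    show "continuous_map X euclideanreal (\<lambda>x. h x v)" for v
    proof (cases "v \<in> J")
      case True
      have "continuous_map X euclideanreal (\<lambda>x. g v x / ?S x)"
        using Spos by (intro continuous_map_real_divide lf_coverD(1)[OF g True] continuous_map_lsum[OF g]) fastforce+
      then show ?thesis using True by (simp add: h_def)
    qed (simp add: h_def)
    fix x assume x: "x \<in> topspace X"
    then obtain W where W: "openin X W" "x \<in> W" "finite {i\<in>J. \<exists>y\<in>W. g i y \<noteq> 0}" using lf_coverD(4)[OF g] by blast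
    let ?\<sigma> = "{i\<in>J. \<exists>y\<in>W. g i y \<noteq> 0}"
    have "?\<sigma> \<noteq> {}" using lf_coverD(3)[OF g x] W(2) by fastforce
    then have "?\<sigma> \<in> full_complex" using W(3) by (simp add: full_complex_def)
    moreover have "h y \<in> closed_simplex ?\<sigma>" if y: "y \<in> W" for y
    proof -
      have yX: "y \<in> topspace X" using y openin_subset[OF W(1)] by blast
      have "sum (h y) ?\<sigma> = (\<Sum>i\<in>?\<sigma>. g i y) / ?S y" by (simp add: h_def sum_divide_distrib)
      also have "(\<Sum>i\<in>?\<sigma>. g i y) = ?S y" by (rule lsum_eq[symmetric]) (use W(3) y in auto)
      finally have "sum (h y) ?\<sigma> = 1" using Spos[OF yX] by simp
      moreover have "0 \<le> h y v" for v using lf_coverD(2)[OF g _ yX] Spos[OF yX] by (simp add: h_def)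
      moreover have "h y v = 0" if "v \<notin> ?\<sigma>" for v using that y by (auto simp: h_def)
      ultimately show ?thesis by (auto simp: closed_simplex_def)
    qed
    ultimately show "\<exists>W \<sigma>. openin X W \<and> x \<in> W \<and> \<sigma> \<in> full_complex \<and> h ` W \<subseteq> closed_simplex \<sigma>" using W(1,2) by blast
  qed
qed

section \<open>Consequences of (R1) and (R2) for entourages\<close>

lemma open_covering_lf_cover:
  "lf_cover X I g \<Longrightarrow> open_covering X ((\<lambda>i. {x \<in> topspace X. 0 < g i x}) ` I)"
  using normal_covering_lf_cover by (auto simp: normal_covering_def)

text \<open>(R1) approximates the canonical map \<open>h\<close> of a family defining
  \<open>E\<close> by some \<open>h' \<circ> q l\<close>. If \<open>h' (q l x)\<close> and
  \<open>h' (q l x')\<close> are close, then \<open>h x\<close> and \<open>h x'\<close> are positive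
  at a common vertex \<open>v\<close>, so \<open>x\<close> and \<open>x'\<close> lie in the member
  of the family that belongs to \<open>v\<close>.\<close>

lemma resolution_entourage:
  fixes e :: "'a \<times> real \<Rightarrow> 'u" and X :: "'a topology"
  assumes res: "resolution TYPE('u) \<Lambda> leq Y p X q" and e: "inj e" and E: "normal_entourage X E"
  obtains l E' where "l \<in> \<Lambda>" "normal_entourage (Y l) E'"
    "\<And>x x'. x \<in> topspace X \<Longrightarrow> x' \<in> topspace X \<Longrightarrow> (q l x, q l x') \<in> E' \<Longrightarrow> (x, x') \<in> E"
proof -
  obtain I :: "'a set set" and g where g: "lf_cover X I g"
    "\<forall>i\<in>I. \<forall>x\<in>topspace X. \<forall>y\<in>topspace X. 0 < g i x \<longrightarrow> 0 < g i y \<longrightarrow> (x, y) \<in> E"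
    by (rule normal_entourageE[OF E])
  obtain J :: "'u set" and \<pi> where J: "lf_cover X J (\<lambda>v. g (\<pi> v))" "\<And>v. v \<in> J \<Longrightarrow> \<pi> v \<in> I"
    using lf_cover_index_inj[OF e g(1)] by blast
  let ?Q = "realization (full_complex :: 'u set set)"
  obtain h where h: "continuous_map X ?Q h" "\<And>x v. x \<in> topspace X \<Longrightarrow> 0 < h x v \<Longrightarrow> v \<in> J \<and> 0 < g (\<pi> v) x"
    using canonical_map[OF J(1)] by blast
  obtain D1 where D1: "normal_entourage ?Q D1" "sym D1"
    "\<forall>x y z. (x, y) \<in> D1 \<longrightarrow> (y, z) \<in> D1 \<longrightarrow> y \<in> topspace ?Q \<longrightarrow> (x, z) \<in> {(s, t). \<exists>v. 0 < s v \<and> 0 < t v}"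
    by (rule normal_entourage_sqrt[OF normal_entourage_open_stars[OF order_refl, where ?'v = 'u]])
  obtain D2 where D2: "normal_entourage ?Q D2" "sym D2"
    "\<forall>x y z. (x, y) \<in> D2 \<longrightarrow> (y, z) \<in> D2 \<longrightarrow> y \<in> topspace ?Q \<longrightarrow> (x, z) \<in> D1"
    by (rule normal_entourage_sqrt[OF D1(1)])
  obtain M :: "('u \<Rightarrow> real) set set" and f where f: "lf_cover ?Q M f"
    "\<forall>i\<in>M. \<forall>x\<in>topspace ?Q. \<forall>y\<in>topspace ?Q. 0 < f i x \<longrightarrow> 0 < f i y \<longrightarrow> (x, y) \<in> D2"
    by (rule normal_entourageE[OF D2(1)])
  let ?V = "(\<lambda>i. {x \<in> topspace ?Q. 0 < f i x}) ` M"
  have nearD: "(s, t) \<in> D2 \<and> (t, s) \<in> D2" if "V \<in> ?V" "s \<in> V" "t \<in> V" for V s t using that f(2) by auto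
  have r: "inj (\<lambda>x. e (undefined, x))" using e by (auto simp: inj_def)
  obtain l h' where l: "l \<in> \<Lambda>" "continuous_map (Y l) ?Q h'" "near X ?V (h' \<circ> q l) h"
    using resolution_realization(1)[OF res r abstract_complex_full open_covering_lf_cover[OF f(1)] h(1)] by blast
  have ql: "continuous_map X (Y l) (q l)" using res l(1) by (auto simp: resolution_def maps_to_system_def)
  show ?thesis
  proof (rule that[OF l(1) normal_entourage_pullback[OF l(2) D2(1)]])
    fix x x' assume x: "x \<in> topspace X" "x' \<in> topspace X" "(q l x, q l x') \<in> {(x, y). (h' x, h' y) \<in> D2}"
    have t: "h x \<in> topspace ?Q" "h x' \<in> topspace ?Q" "h' (q l x) \<in> topspace ?Q" "h' (q l x') \<in> topspace ?Q"
      using h(1) l(2) ql x(1,2) by (auto simp: continuous_map_def Pi_iff)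
    have n: "(h' (q l z), h z) \<in> D2 \<and> (h z, h' (q l z)) \<in> D2" if z: "z \<in> topspace X" for z
    proof -
      obtain V where "V \<in> ?V" "h' (q l z) \<in> V" "h z \<in> V" using l(3) z unfolding near_def o_def by blast
      then show ?thesis by (rule nearD)
    qed
    have "(h x, h' (q l x)) \<in> D2" "(h' (q l x'), h x') \<in> D2" using n[OF x(1)] n[OF x(2)] by simp_all
    moreover have "(h' (q l x), h' (q l x')) \<in> D2" using x(3) by simp
    \<comment> \<open>From \<open>h x\<close> to \<open>h x'\<close> there are three steps in
      \<open>D2\<close>; a trivial fourth makes the two successive square roots fit.\<close>
    moreover have "(h x', h x') \<in> D2" by (rule normal_entourage_refl[OF D2(1) t(2)])
    ultimately have "(h x, h' (q l x')) \<in> D1" "(h' (q l x'), h x') \<in> D1"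
      using D2(3)[rule_format, OF _ _ t(3)] D2(3)[rule_format, OF _ _ t(2)] by blast+
    then have "(h x, h x') \<in> {(s, t). \<exists>v. 0 < s v \<and> 0 < t v}" by (rule D1(3)[rule_format, OF _ _ t(4)])
    then obtain v where "0 < h x v" "0 < h x' v" by blast
    then show "(x, x') \<in> E" using h(2) x(1,2) J(2) g(2) by blast
  qed
qed

text \<open>(R2) is applied to two maps into the edge with vertices \<open>a\<close> and
  \<open>b\<close>: \<open>h\<close> has \<open>s\<close> as its coordinate at \<open>a\<close>, and
  \<open>h1\<close> is constant at the vertex \<open>a\<close>. They agree on the image of
  \<open>X\<close>, hence are near on a late term, and this forces \<open>s\<close> to be positive
  there.\<close>

lemma resolution_dense:
  fixes r :: "real \<Rightarrow> 'u" and Y :: "'l \<Rightarrow> 'b topology"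
  assumes res: "resolution TYPE('u) \<Lambda> leq Y p X q" and r: "inj r" and l: "l \<in> \<Lambda>" and E: "normal_entourage (Y l) E"
  obtains m where "m \<in> \<Lambda>" "leq l m" "\<And>y. y \<in> topspace (Y m) \<Longrightarrow> \<exists>x\<in>topspace X. (q l x, p l m y) \<in> E"
proof -
  obtain I :: "'b set set" and g where g: "lf_cover (Y l) I g"
    "\<forall>i\<in>I. \<forall>x\<in>topspace (Y l). \<forall>y\<in>topspace (Y l). 0 < g i x \<longrightarrow> 0 < g i y \<longrightarrow> (x, y) \<in> E"
    by (rule normal_entourageE[OF E])
  have ql: "q l x \<in> topspace (Y l)" if "x \<in> topspace X" for x
    using res l that by (fastforce simp: resolution_def maps_to_system_def continuous_map_def)
  define J where "J = {i\<in>I. \<exists>x\<in>topspace X. 0 < g i (q l x)}"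
  \<comment> \<open>The share of the members that meet the image of \<open>X\<close>: it is 1 on
    that image, and a point where it is positive lies in a common member with some point of the
    image.\<close>
  define s where "s y = lsum J g y / lsum I g y" for y
  let ?Q = "realization (full_complex :: 'u set set)"
  define a where "a = r 0"
  define b where "b = r 1"
  have ab: "a \<noteq> b" using inj_eq[OF r, of 0 1] by (simp add: a_def b_def)
  define h where "h y v = (if v = a then s y else if v = b then 1 - s y else 0)" for y v
  define h1 where "h1 y v = (if v = a then 1 else 0 :: real)" for y :: 'b and v
  have fin: "finite {i\<in>I. g i y \<noteq> 0}" if "y \<in> topspace (Y l)" for y by (rule lf_cover_finite[OF g(1) that])
  have Ipos: "0 < lsum I g y" and Jle: "0 \<le> lsum J g y" "lsum J g y \<le> lsum I g y" if y: "y \<in> topspace (Y l)" for y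
  proof -
    obtain i where i: "i \<in> I" "0 < g i y" using lf_coverD(3)[OF g(1) y] by blast
    have "0 < g i y" by fact
    also have "g i y \<le> lsum I g y" unfolding lsum_def
      using i lf_coverD(2)[OF g(1) _ y] fin[OF y] by (intro member_le_sum) auto
    finally show "0 < lsum I g y" .
    show "0 \<le> lsum J g y" unfolding lsum_def using lf_coverD(2)[OF g(1) _ y] by (intro sum_nonneg) (auto simp: J_def)
    show "lsum J g y \<le> lsum I g y" unfolding lsum_def
      using lf_coverD(2)[OF g(1) _ y] fin[OF y] by (intro sum_mono2) (auto simp: J_def)
  qed
  have s01: "0 \<le> s y" "s y \<le> 1" if "y \<in> topspace (Y l)" for y using Ipos[OF that] Jle[OF that] by (auto simp: s_def)
  have sc: "continuous_map (Y l) euclideanreal s"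
    unfolding s_def[abs_def] using Ipos
    by (intro continuous_map_real_divide continuous_map_lsum[OF g(1)]) (fastforce simp: J_def)+
  have ab_full: "{a, b} \<in> full_complex" by (simp add: full_complex_def)
  have hcont: "continuous_map (Y l) ?Q h"
  proof (rule continuous_map_into_realization)
    show "continuous_map (Y l) euclideanreal (\<lambda>y. h y v)" for v
      using sc ab by (cases "v = a"; cases "v = b") (auto simp: h_def intro: continuous_map_diff)
    have "h y \<in> closed_simplex {a, b}" if "y \<in> topspace (Y l)" for y
      using s01[OF that] ab by (auto simp: h_def closed_simplex_def)
    then show "\<exists>W \<sigma>. openin (Y l) W \<and> y \<in> W \<and> \<sigma> \<in> full_complex \<and> h ` W \<subseteq> closed_simplex \<sigma>" if "y \<in> topspace (Y l)" for y
      using that ab_full by (intro exI[of _ "topspace (Y l)"] exI[of _ "{a, b}"]) auto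
  qed
  have h1s: "h1 y \<in> closed_simplex {a, b}" for y using ab by (auto simp: h1_def closed_simplex_def)
  have h1cont: "continuous_map (Y l) ?Q h1"
  proof (rule continuous_map_into_realization)
    show "continuous_map (Y l) euclideanreal (\<lambda>y. h1 y v)" for v by (simp add: h1_def)
    show "\<exists>W \<sigma>. openin (Y l) W \<and> y \<in> W \<and> \<sigma> \<in> full_complex \<and> h1 ` W \<subseteq> closed_simplex \<sigma>" if "y \<in> topspace (Y l)" for y
      using that ab_full h1s by (intro exI[of _ "topspace (Y l)"] exI[of _ "{a, b}"]) auto
  qed
  \<comment> \<open>The constant map has coordinate 1 at \<open>a\<close> and avoids
    \<open>?B\<close>, so a map near to it takes its values in \<open>?A\<close>.\<close>
  let ?A = "{t \<in> topspace ?Q. t a \<in> {0<..}}" and ?B = "{t \<in> topspace ?Q. t a \<in> {..<1}}"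
  have ca: "continuous_map ?Q euclideanreal (\<lambda>t. t a)"
    by (rule continuous_map_from_realization) (rule continuous_map_simplex_coordinate)
  have "openin ?Q ?A" "openin ?Q ?B" by (rule openin_continuous_map_preimage[OF ca]; simp)+
  then have "open_covering ?Q {?A, ?B}" by (auto simp: open_covering_def)
  from resolution_realization(2)[OF res r abstract_complex_full this]
  obtain V where V': "open_covering ?Q V \<and> (\<forall>l\<in>\<Lambda>. \<forall>h h'. continuous_map (Y l) ?Q h \<and> continuous_map (Y l) ?Q h' \<and>
      near X V (h \<circ> q l) (h' \<circ> q l) \<longrightarrow> (\<exists>m\<in>\<Lambda>. leq l m \<and> near (Y m) {?A, ?B} (h \<circ> p l m) (h' \<circ> p l m)))" ..
  note V = V'[THEN conjunct1] V'[THEN conjunct2, rule_format]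
  have eq: "h (q l x) = h1 (q l x)" if x: "x \<in> topspace X" for x
  proof -
    have "{i. i \<in> J \<and> g i (q l x) \<noteq> 0} = {i. i \<in> I \<and> g i (q l x) \<noteq> 0}"
      using lf_coverD(2)[OF g(1) _ ql[OF x]] x by (force simp: J_def less_le)
    then have "s (q l x) = 1" using Ipos[OF ql[OF x]] by (simp add: s_def lsum_def)
    then show ?thesis by (auto simp: h_def h1_def)
  qed
  have "near X V (h \<circ> q l) (h1 \<circ> q l)"
    unfolding near_def
  proof
    fix x assume x: "x \<in> topspace X"
    have "h (q l x) \<in> topspace ?Q" using hcont ql[OF x] by (auto simp: continuous_map_def)
    then show "\<exists>V\<in>V. (h \<circ> q l) x \<in> V \<and> (h1 \<circ> q l) x \<in> V" using V(1) eq[OF x] by (auto simp: open_covering_def)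
  qed
  then obtain m where m: "m \<in> \<Lambda>" "leq l m" "near (Y m) {?A, ?B} (h \<circ> p l m) (h1 \<circ> p l m)"
    using V(2)[OF l] hcont h1cont by blast
  show ?thesis
  proof (rule that[OF m(1,2)])
    fix y assume y: "y \<in> topspace (Y m)"
    have "continuous_map (Y m) (Y l) (p l m)" using res l m by (auto simp: resolution_def inverse_system_of_spaces_def)
    then have py: "p l m y \<in> topspace (Y l)" using y by (auto simp: continuous_map_def)
    have "0 < h (p l m y) a" using m(3) y by (auto simp: near_def h1_def)
    then have "0 < s (p l m y)" by (simp add: h_def)
    then have "lsum J g (p l m y) \<noteq> 0" by (auto simp: s_def)
    then have "{i. i \<in> J \<and> g i (p l m y) \<noteq> 0} \<noteq> {}" unfolding lsum_def by (rule contrapos_nn) simp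
    then obtain i where i: "i \<in> J" "g i (p l m y) \<noteq> 0" by blast
    then obtain x where x: "x \<in> topspace X" "0 < g i (q l x)" "i \<in> I" by (auto simp: J_def)
    have "0 < g i (p l m y)" using i(2) lf_coverD(2)[OF g(1) x(3) py] by simp
    then have "(q l x, p l m y) \<in> E" using g(2) x ql[OF x(1)] py by blast
    then show "\<exists>x\<in>topspace X. (q l x, p l m y) \<in> E" using x(1) by blast
  qed
qed

section \<open>Continuity of normal cohomology\<close>

text \<open>The prism operator: the alternating sum over \<open>i\<close> of the values of
  \<open>\<phi>\<close> on the tuples that run through f x_0, ..., f x_i, g x_i, ..., g x_n.\<close>

fun prism :: "('a \<Rightarrow> 'b) \<Rightarrow> ('a \<Rightarrow> 'b) \<Rightarrow> ('b list \<Rightarrow> 'w::ab_group_add) \<Rightarrow> 'a list \<Rightarrow> 'w" where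
  "prism f g \<phi> [] = 0"
| "prism f g \<phi> (x # xs) = \<phi> (f x # g x # map g xs) - prism f g (\<lambda>ys. \<phi> (f x # ys)) xs"

lemma prism_diff: "prism f g (\<lambda>u. \<phi> u - \<psi> u) xs = prism f g \<phi> xs - prism f g \<psi> xs"
  by (induction xs arbitrary: \<phi> \<psi>) auto

lemma alt_sum_map: "alt_sum (\<lambda>u. \<phi> (map f u)) xs = alt_sum \<phi> (map f xs)"
  by (induction xs arbitrary: \<phi>) auto

text \<open>An identity about arbitrary functions on lists, with no topology involved. This is why a
  discontinuous map back to \<open>X\<close> can be used.\<close>

lemma prism_homotopy: "alt_sum (prism f g \<phi>) xs + prism f g (alt_sum \<phi>) xs = \<phi> (map g xs) - \<phi> (map f xs)"
proof (induction xs arbitrary: \<phi>)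
  case (Cons x xs)
  let ?\<phi> = "\<lambda>ys. \<phi> (f x # ys)"
  have "alt_sum (prism f g \<phi>) (x # xs) = prism f g \<phi> xs -
      (alt_sum (\<lambda>u. ?\<phi> (g x # map g u)) xs - alt_sum (prism f g ?\<phi>) xs)"
    by (simp add: alt_sum_diff)
  moreover have "prism f g (alt_sum \<phi>) (x # xs) = \<phi> (g x # map g xs) - (?\<phi> (map g xs) - alt_sum (\<lambda>u. ?\<phi> (g x # u)) (map g xs))
      - (prism f g \<phi> xs - prism f g (alt_sum ?\<phi>) xs)"
    by (simp add: prism_diff)
  moreover have "alt_sum (\<lambda>u. ?\<phi> (g x # map g u)) xs = alt_sum (\<lambda>u. ?\<phi> (g x # u)) (map g xs)"
    by (rule alt_sum_map[of "\<lambda>u. ?\<phi> (g x # u)"])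
  moreover have "alt_sum (prism f g ?\<phi>) xs + prism f g (alt_sum ?\<phi>) xs = ?\<phi> (map g xs) - ?\<phi> (map f xs)" by (rule Cons.IH)
  ultimately show ?case by (simp add: algebra_simps)
qed simp

text \<open>The prism over \<open>xs\<close> evaluates \<open>\<phi>\<close> only on tuples of
  values of \<open>f\<close> and \<open>g\<close> at entries of \<open>xs\<close>, one longer than
  \<open>xs\<close>. So a cocycle condition valid on small tuples removes one term of the homotopy
  formula.\<close>

lemma prism_eq_0:
  assumes "\<And>ys. length ys = Suc (length xs) \<Longrightarrow> set ys \<subseteq> f ` set xs \<union> g ` set xs \<Longrightarrow> \<phi> ys = 0"
  shows "prism f g \<phi> xs = 0"
  using assms
proof (induction xs arbitrary: \<phi>)
  case (Cons x xs)
  have "prism f g (\<lambda>ys. \<phi> (f x # ys)) xs = 0" by (rule Cons.IH) (rule Cons.prems, auto)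
  moreover have "\<phi> (f x # g x # map g xs) = 0" by (rule Cons.prems) auto
  ultimately show ?case by simp
qed simp

text \<open>Cochains of all degrees at once, as functions on all lists.  The bound on the length excludes the
  augmentation.\<close>

definition ext_coboundary :: "'a topology \<Rightarrow> ('a list \<Rightarrow> int) \<Rightarrow> 'a list \<Rightarrow> int" where
  "ext_coboundary X \<phi> xs = (if set xs \<subseteq> topspace X \<and> 2 \<le> length xs then alt_sum \<phi> xs else 0)"

definition ext_pullback :: "'a topology \<Rightarrow> ('a \<Rightarrow> 'b) \<Rightarrow> ('b list \<Rightarrow> int) \<Rightarrow> 'a list \<Rightarrow> int" where
  "ext_pullback X f \<phi> xs = (if set xs \<subseteq> topspace X then \<phi> (map f xs) else 0)"

text \<open>The degree enters only through the tuples tested. A function on all lists can thus stand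
  for a cochain of any degree, and in negative degrees everything is null.\<close>

definition null_cochains :: "'a topology \<Rightarrow> int \<Rightarrow> ('a list \<Rightarrow> int) set" where
  "null_cochains X n = {\<phi>. \<exists>E. normal_entourage X E \<and> (\<forall>xs\<in>tuples X n. set xs \<times> set xs \<subseteq> E \<longrightarrow> \<phi> xs = 0)}"

lemma null_cochainsI:
  "normal_entourage X E \<Longrightarrow> (\<And>xs. xs \<in> tuples X n \<Longrightarrow> set xs \<times> set xs \<subseteq> E \<Longrightarrow> \<phi> xs = 0) \<Longrightarrow> \<phi> \<in> null_cochains X n"
  by (auto simp: null_cochains_def)

lemma tuples_nonneg: "xs \<in> tuples X n \<Longrightarrow> 0 \<le> n"
  by (cases xs) (auto simp: tuples_def)

lemma null_cochains_negative: "n < 0 \<Longrightarrow> \<phi> \<in> null_cochains X n"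
  by (rule null_cochainsI[OF normal_entourage_UNIV]) (use tuples_nonneg in fastforce)

lemma additive_ext_coboundary: "Modules.additive (ext_coboundary X)"
  by unfold_locales (auto simp: ext_coboundary_def fun_eq_iff plus_fun_def alt_sum_add)

lemma additive_ext_pullback: "Modules.additive (ext_pullback X f)"
  by unfold_locales (auto simp: ext_pullback_def fun_eq_iff)

lemma add_subgroup_null_cochains: "add_subgroup (null_cochains X n)"
  unfolding add_subgroup_def
proof (intro conjI ballI)
  show "0 \<in> null_cochains X n" by (rule null_cochainsI[OF normal_entourage_UNIV]) simp
  fix \<phi> \<psi> assume "\<phi> \<in> null_cochains X n" "\<psi> \<in> null_cochains X n"
  then obtain E D where E: "normal_entourage X E" "\<forall>xs\<in>tuples X n. set xs \<times> set xs \<subseteq> E \<longrightarrow> \<phi> xs = 0"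
    and D: "normal_entourage X D" "\<forall>xs\<in>tuples X n. set xs \<times> set xs \<subseteq> D \<longrightarrow> \<psi> xs = 0"
    unfolding null_cochains_def by blast
  show "\<phi> - \<psi> \<in> null_cochains X n"
    by (rule null_cochainsI[OF normal_entourage_Int[OF E(1) D(1)]]) (use E(2) D(2) in simp)
qed

lemma omit_tuple: "set xs \<subseteq> A \<Longrightarrow> set (omit i xs) \<subseteq> A"
  using set_omit[of i xs] by blast

lemma omit_in_tuples:
  assumes xs: "xs \<in> tuples X (n + 1)" and l: "2 \<le> length xs" and i: "i < length xs"
  shows "omit i xs \<in> tuples X n"
proof -
  have lo: "length (omit i xs) = length xs - 1" by (rule length_omit[OF i])
  then have "0 < length (omit i xs)" using l by linarith
  then have "omit i xs \<noteq> []" by (rule length_greater_0_conv[THEN iffD1])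
  moreover have "int (length (omit i xs)) = n + 1" using xs l unfolding lo by (simp add: tuples_def of_nat_diff)
  moreover have "set (omit i xs) \<subseteq> topspace X" using xs by (intro omit_tuple) (simp add: tuples_def)
  ultimately show ?thesis by (simp only: tuples_def mem_Collect_eq simp_thms)
qed

lemma ext_coboundary_null_cochains:
  assumes "\<phi> \<in> null_cochains X n"
  shows "ext_coboundary X \<phi> \<in> null_cochains X (n + 1)"
proof -
  obtain E where E: "normal_entourage X E" "\<forall>xs\<in>tuples X n. set xs \<times> set xs \<subseteq> E \<longrightarrow> \<phi> xs = 0"
    using assms unfolding null_cochains_def by blast
  show ?thesis
  proof (rule null_cochainsI[OF E(1)])
    fix xs assume xs: "xs \<in> tuples X (n + 1)" "set xs \<times> set xs \<subseteq> E"
    show "ext_coboundary X \<phi> xs = 0"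
    proof (cases "2 \<le> length xs")
      case True
      have "alt_sum \<phi> xs = alt_sum (\<lambda>u. 0) xs"
      proof (rule alt_sum_cong)
        fix i assume i: "i < length xs"
        have "omit i xs \<in> tuples X n"
          by (rule omit_in_tuples[OF xs(1) True i])
        moreover have "set (omit i xs) \<times> set (omit i xs) \<subseteq> E" using xs(2) set_omit[of i xs] by blast
        ultimately show "\<phi> (omit i xs) = 0" using E(2) by blast
      qed
      then show ?thesis by (simp add: ext_coboundary_def alt_sum_zero)
    qed (simp add: ext_coboundary_def)
  qed
qed

lemma ext_pullback_null_cochains:
  assumes f: "continuous_map X Y f" and "\<phi> \<in> null_cochains Y n"
  shows "ext_pullback X f \<phi> \<in> null_cochains X n"
proof -
  obtain E where E: "normal_entourage Y E" "\<forall>xs\<in>tuples Y n. set xs \<times> set xs \<subseteq> E \<longrightarrow> \<phi> xs = 0"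
    using assms unfolding null_cochains_def by blast
  show ?thesis
  proof (rule null_cochainsI[OF normal_entourage_pullback[OF f E(1)]])
    fix xs assume xs: "xs \<in> tuples X n" "set xs \<times> set xs \<subseteq> {(x, y). (f x, f y) \<in> E}"
    have "map f xs \<in> tuples Y n" using xs(1) f by (auto simp: tuples_def continuous_map_def)
    moreover have "set (map f xs) \<times> set (map f xs) \<subseteq> E" using xs(2) by auto
    ultimately show "ext_pullback X f \<phi> xs = 0" using E(2) by (simp add: ext_pullback_def)
  qed
qed

lemma ext_coboundary_ext_coboundary: "ext_coboundary X (ext_coboundary X \<phi>) = 0"
proof
  fix xs
  show "ext_coboundary X (ext_coboundary X \<phi>) xs = 0 xs"
  proof (cases "set xs \<subseteq> topspace X \<and> 2 \<le> length xs")
    case True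
    \<comment> \<open>Pairs are special: their faces have length one, where the coboundary is cut
      off to 0 and differs in general from \<open>alt_sum \<phi>\<close>.\<close>
    have "alt_sum (ext_coboundary X \<phi>) xs = (if length xs = 2 then alt_sum (\<lambda>u. 0) xs else alt_sum (alt_sum \<phi>) xs)"
      using True omit_tuple[of xs "topspace X"] by (auto intro!: alt_sum_cong simp: ext_coboundary_def)
    then show ?thesis by (simp add: ext_coboundary_def alt_sum_alt alt_sum_zero)
  qed (auto simp: ext_coboundary_def)
qed

lemma ext_pullback_ext_coboundary:
  assumes f: "f ` topspace X \<subseteq> topspace Y"
  shows "ext_pullback X f (ext_coboundary Y \<phi>) = ext_coboundary X (ext_pullback X f \<phi>)"
proof
  fix xs
  show "ext_pullback X f (ext_coboundary Y \<phi>) xs = ext_coboundary X (ext_pullback X f \<phi>) xs"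
  proof (cases "set xs \<subseteq> topspace X \<and> 2 \<le> length xs")
    case True
    have "alt_sum (ext_pullback X f \<phi>) xs = alt_sum (\<lambda>u. \<phi> (map f u)) xs"
      using True omit_tuple[of xs "topspace X"] by (auto intro!: alt_sum_cong simp: ext_pullback_def)
    moreover have "f ` set xs \<subseteq> topspace Y" using True f by blast
    ultimately show ?thesis using True by (simp add: ext_pullback_def ext_coboundary_def alt_sum_map)
  qed (auto simp: ext_coboundary_def ext_pullback_def)
qed

lemma ext_pullback_ext_pullback:
  assumes "f ` topspace X \<subseteq> topspace Y" "\<And>x. x \<in> topspace X \<Longrightarrow> g (f x) = h x"
  shows "ext_pullback X f (ext_pullback Y g \<phi>) = ext_pullback X h \<phi>"
proof
  fix xs
  have "set xs \<subseteq> topspace X \<Longrightarrow> f ` set xs \<subseteq> topspace Y" using assms(1) by blast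
  moreover have "set xs \<subseteq> topspace X \<Longrightarrow> map g (map f xs) = map h xs" using assms(2) by auto
  ultimately show "ext_pullback X f (ext_pullback Y g \<phi>) xs = ext_pullback X h \<phi> xs" by (auto simp add: ext_pullback_def simp del: map_map)
qed

section \<open>Agreement with the quotient complexes of normal cochains\<close>

lemma comm_group_cochain_group: "comm_group (cochain_group X n)"
  unfolding cochain_group_def by (rule comm_group_product_group) (rule abelian_integer_group)

lemma cochain_group_simps:
  "carrier (cochain_group X n) = extensional (tuples X n)"
  "\<phi> \<otimes>\<^bsub>cochain_group X n\<^esub> \<psi> = (\<lambda>xs\<in>tuples X n. \<phi> xs + \<psi> xs)"
  "\<one>\<^bsub>cochain_group X n\<^esub> = (\<lambda>xs\<in>tuples X n. 0)"
  by (auto simp: cochain_group_def PiE_def)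

lemma locally_zero_eq: "locally_zero_cochains X n = extensional (tuples X n) \<inter> null_cochains X n"
  unfolding locally_zero_cochains_def null_cochains_def locally_zero_iff[symmetric] cochain_group_simps by blast

lemma restrict_locally_zero: "restrict \<phi> (tuples X n) \<in> locally_zero_cochains X n \<longleftrightarrow> \<phi> \<in> null_cochains X n"
  by (simp add: locally_zero_eq null_cochains_def)

lemma restrict_mult: "restrict (\<phi> + \<psi>) (tuples X n) = restrict \<phi> (tuples X n) \<otimes>\<^bsub>cochain_group X n\<^esub> restrict \<psi> (tuples X n)"
  by (auto simp: cochain_group_simps)

lemma subgroup_locally_zero: "subgroup (locally_zero_cochains X n) (cochain_group X n)"
proof -
  interpret G: comm_group "cochain_group X n" by (rule comm_group_cochain_group)
  have r: "\<phi> \<in> locally_zero_cochains X n \<Longrightarrow> restrict \<phi> (tuples X n) = \<phi>" for \<phi>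
    by (auto simp: locally_zero_eq extensional_restrict)
  show ?thesis
  proof (rule G.subgroupI)
    show "locally_zero_cochains X n \<subseteq> carrier (cochain_group X n)" by (simp add: locally_zero_cochains_def)
    have "restrict 0 (tuples X n) \<in> locally_zero_cochains X n"
      unfolding restrict_locally_zero by (rule add_subgroup_zero[OF add_subgroup_null_cochains])
    then show "locally_zero_cochains X n \<noteq> {}" by blast
  next
    fix \<phi> assume "\<phi> \<in> locally_zero_cochains X n"
    then have p: "\<phi> \<in> extensional (tuples X n)" "\<phi> \<in> null_cochains X n" by (auto simp: locally_zero_eq)
    have "restrict (- \<phi>) (tuples X n) \<otimes>\<^bsub>cochain_group X n\<^esub> \<phi> = \<one>\<^bsub>cochain_group X n\<^esub>"
      by (auto simp: cochain_group_simps fun_eq_iff)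
    then have "inv\<^bsub>cochain_group X n\<^esub> \<phi> = restrict (- \<phi>) (tuples X n)"
      by (rule G.inv_equality) (use p in \<open>auto simp: cochain_group_simps\<close>)
    then show "inv\<^bsub>cochain_group X n\<^esub> \<phi> \<in> locally_zero_cochains X n"
      using add_subgroup_uminus[OF add_subgroup_null_cochains p(2)] by (simp add: restrict_locally_zero)
  next
    fix \<phi> \<psi> assume z: "\<phi> \<in> locally_zero_cochains X n" "\<psi> \<in> locally_zero_cochains X n"
    then have "\<phi> + \<psi> \<in> null_cochains X n"
      by (auto simp: locally_zero_eq intro: add_subgroup_add[OF add_subgroup_null_cochains])
    then have "restrict (\<phi> + \<psi>) (tuples X n) \<in> locally_zero_cochains X n" by (simp add: restrict_locally_zero)
    then show "\<phi> \<otimes>\<^bsub>cochain_group X n\<^esub> \<psi> \<in> locally_zero_cochains X n"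
      using z by (simp add: restrict_mult r)
  qed
qed

lemma normal_locally_zero: "locally_zero_cochains X n \<lhd> cochain_group X n"
  using comm_group.normal_iff_subgroup[OF comm_group_cochain_group] subgroup_locally_zero by blast

definition cochain_class :: "'a topology \<Rightarrow> int \<Rightarrow> ('a list \<Rightarrow> int) \<Rightarrow> ('a list \<Rightarrow> int) set" where
  "cochain_class X n \<phi> = locally_zero_cochains X n #>\<^bsub>cochain_group X n\<^esub> restrict \<phi> (tuples X n)"

lemma presents_normal_cochains: "presents (cochain_class X n) (grp (normal_cochains X) n) (null_cochains X n)"
proof -
  interpret N: normal "locally_zero_cochains X n" "cochain_group X n" by (rule normal_locally_zero)
  have car: "restrict \<phi> (tuples X n) \<in> carrier (cochain_group X n)" for \<phi> by (simp add: cochain_group_simps)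
  show ?thesis
    unfolding presents_def
  proof (intro conjI allI)
    show "comm_group (grp (normal_cochains X) n)"
      by (simp add: normal_cochains_def comm_group.abelian_FactGroup[OF comm_group_cochain_group subgroup_locally_zero])
    have "range (cochain_class X n) = (\<lambda>\<phi>. locally_zero_cochains X n #>\<^bsub>cochain_group X n\<^esub> \<phi>) ` carrier (cochain_group X n)"
    proof
      show "(\<lambda>\<phi>. locally_zero_cochains X n #>\<^bsub>cochain_group X n\<^esub> \<phi>) ` carrier (cochain_group X n) \<subseteq> range (cochain_class X n)"
      proof clarify
        fix \<phi> assume "\<phi> \<in> carrier (cochain_group X n)"
        then have "restrict \<phi> (tuples X n) = \<phi>" by (simp add: cochain_group_simps extensional_restrict)
        then show "locally_zero_cochains X n #>\<^bsub>cochain_group X n\<^esub> \<phi> \<in> range (cochain_class X n)"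
          by (intro range_eqI[of _ _ \<phi>]) (simp add: cochain_class_def)
      qed
    qed (use car in \<open>auto simp: cochain_class_def\<close>)
    then show "range (cochain_class X n) = carrier (grp (normal_cochains X) n)"
      by (simp add: normal_cochains_def carrier_FactGroup)
    show "cochain_class X n (\<phi> + \<psi>) = cochain_class X n \<phi> \<otimes>\<^bsub>grp (normal_cochains X) n\<^esub> cochain_class X n \<psi>" for \<phi> \<psi>
      by (simp add: cochain_class_def normal_cochains_def restrict_mult N.rcos_sum[OF car car])
    show "cochain_class X n \<phi> = \<one>\<^bsub>grp (normal_cochains X) n\<^esub> \<longleftrightarrow> \<phi> \<in> null_cochains X n" for \<phi>
    proof -
      have "locally_zero_cochains X n #>\<^bsub>cochain_group X n\<^esub> restrict \<phi> (tuples X n) = locally_zero_cochains X n \<longleftrightarrow>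
          restrict \<phi> (tuples X n) \<in> locally_zero_cochains X n"
        using N.coset_join1[OF _ car subgroup_locally_zero] N.coset_join2[OF car subgroup_locally_zero] by (rule iffI)
      then show ?thesis by (simp add: cochain_class_def normal_cochains_def restrict_locally_zero)
    qed
  qed
qed

text \<open>Evaluates an induced homomorphism, described by products with images of cosets, on a
  representative: \<open>h\<close> of an element of \<open>N\<close> is absorbed by
  \<open>M\<close>.\<close>

lemma set_mult_image_coset:
  assumes N: "N \<lhd> G" and M: "M \<lhd> H" and h: "h \<in> hom G H" and hN: "h ` N \<subseteq> M" and a: "a \<in> carrier G"
  shows "M <#>\<^bsub>H\<^esub> h ` (N #>\<^bsub>G\<^esub> a) = M #>\<^bsub>H\<^esub> h a"
proof -
  interpret N: normal N G by fact
  interpret M: normal M H by fact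
  have ha: "h a \<in> carrier H" using h a by (auto simp: hom_def)
  show ?thesis
  proof
    show "M <#>\<^bsub>H\<^esub> h ` (N #>\<^bsub>G\<^esub> a) \<subseteq> M #>\<^bsub>H\<^esub> h a"
    proof
      fix z assume "z \<in> M <#>\<^bsub>H\<^esub> h ` (N #>\<^bsub>G\<^esub> a)"
      then obtain m n where m: "m \<in> M" "n \<in> N" "z = m \<otimes>\<^bsub>H\<^esub> h (n \<otimes>\<^bsub>G\<^esub> a)" by (auto simp: set_mult_def r_coset_def)
      have "z = (m \<otimes>\<^bsub>H\<^esub> h n) \<otimes>\<^bsub>H\<^esub> h a"
        using m hN ha N.mem_carrier[OF m(2)] M.mem_carrier a hom_mult[OF h N.mem_carrier[OF m(2)] a]
        by (simp add: M.m_assoc image_subset_iff)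
      moreover have "m \<otimes>\<^bsub>H\<^esub> h n \<in> M" using m hN by (intro subgroup.m_closed[OF M.subgroup_axioms]) auto
      ultimately show "z \<in> M #>\<^bsub>H\<^esub> h a" by (auto simp: r_coset_def)
    qed
    have "a \<in> N #>\<^bsub>G\<^esub> a" using N.rcos_self[OF a] N.subgroup_axioms by blast
    then show "M #>\<^bsub>H\<^esub> h a \<subseteq> M <#>\<^bsub>H\<^esub> h ` (N #>\<^bsub>G\<^esub> a)" unfolding set_mult_def r_coset_def[of H] by blast
  qed
qed

lemma coboundary_restrict: "coboundary X n (restrict \<phi> (tuples X n)) = restrict (ext_coboundary X \<phi>) (tuples X (n + 1))"
proof -
  have "(if n < 0 then 0 else \<Sum>i<length xs. (- 1) ^ i * restrict \<phi> (tuples X n) (omit i xs)) = ext_coboundary X \<phi> xs"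
    if xs: "xs \<in> tuples X (n + 1)" for xs
  proof (cases "n < 0")
    \<comment> \<open>Here \<open>n\<close> is -1 and \<open>xs\<close> is a singleton, on which
      both sides are cut off to 0.\<close>
    case True
    then show ?thesis using xs by (auto simp: tuples_def ext_coboundary_def)
  next
    case False
    then have l: "2 \<le> length xs" using xs by (auto simp: tuples_def)
    have "(- 1) ^ i * restrict \<phi> (tuples X n) (omit i xs) = sign_pow (int i) (\<phi> (omit i xs))" if i: "i < length xs" for i
    proof -
      have "omit i xs \<in> tuples X n"
        by (rule omit_in_tuples[OF xs l i])
      then show ?thesis by (cases "even i") (auto simp: sign_pow_def)
    qed
    then have "(\<Sum>i<length xs. (- 1) ^ i * restrict \<phi> (tuples X n) (omit i xs)) = alt_sum \<phi> xs"
      unfolding alt_sum_eq_sum by (intro sum.cong) auto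
    then show ?thesis using False l xs by (simp add: ext_coboundary_def tuples_def)
  qed
  then show ?thesis by (auto simp: coboundary_def)
qed

lemma coboundary_hom: "coboundary X n \<in> hom (cochain_group X n) (cochain_group X (n + 1))"
proof (rule homI)
  fix \<phi> \<psi> assume "\<phi> \<in> carrier (cochain_group X n)" "\<psi> \<in> carrier (cochain_group X n)"
  then have r: "restrict \<phi> (tuples X n) = \<phi>" "restrict \<psi> (tuples X n) = \<psi>" by (simp_all add: cochain_group_simps extensional_restrict)
  have "coboundary X n (restrict (\<phi> + \<psi>) (tuples X n)) =
      coboundary X n (restrict \<phi> (tuples X n)) \<otimes>\<^bsub>cochain_group X (n + 1)\<^esub> coboundary X n (restrict \<psi> (tuples X n))"
    unfolding coboundary_restrict additive.add[OF additive_ext_coboundary] by (rule restrict_mult)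
  then show "coboundary X n (\<phi> \<otimes>\<^bsub>cochain_group X n\<^esub> \<psi>) = coboundary X n \<phi> \<otimes>\<^bsub>cochain_group X (n + 1)\<^esub> coboundary X n \<psi>"
    by (simp add: restrict_mult r)
qed (simp add: coboundary_def cochain_group_simps)

lemma diff_normal_cochains: "diff (normal_cochains X) n (cochain_class X n \<phi>) = cochain_class X (n + 1) (ext_coboundary X \<phi>)"
proof -
  have "coboundary X n ` locally_zero_cochains X n \<subseteq> locally_zero_cochains X (n + 1)"
  proof
    fix \<psi> assume "\<psi> \<in> coboundary X n ` locally_zero_cochains X n"
    then obtain \<phi> where p: "\<phi> \<in> extensional (tuples X n)" "\<phi> \<in> null_cochains X n" "\<psi> = coboundary X n \<phi>" by (auto simp: locally_zero_eq)
    then have "\<psi> = restrict (ext_coboundary X \<phi>) (tuples X (n + 1))" using coboundary_restrict[of X n \<phi>] by (simp add: extensional_restrict)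
    then show "\<psi> \<in> locally_zero_cochains X (n + 1)" using ext_coboundary_null_cochains[OF p(2)] by (simp add: restrict_locally_zero)
  qed
  from set_mult_image_coset[OF normal_locally_zero normal_locally_zero coboundary_hom this]
  show ?thesis by (simp add: normal_cochains_def cochain_class_def cochain_group_simps coboundary_restrict)
qed

lemma normal_cochain_map_class:
  assumes f: "continuous_map X Y f"
  shows "normal_cochain_map X f n (cochain_class Y n \<phi>) = cochain_class X n (ext_pullback X f \<phi>)"
proof -
  let ?h = "\<lambda>\<phi>. \<lambda>xs\<in>tuples X n. \<phi> (map f xs)"
  have m: "map f xs \<in> tuples Y n" if "xs \<in> tuples X n" for xs using that f by (auto simp: tuples_def continuous_map_def)
  have hr: "?h (restrict \<phi> (tuples Y n)) = restrict (ext_pullback X f \<phi>) (tuples X n)" for \<phi>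
    using m by (auto simp: fun_eq_iff ext_pullback_def tuples_def restrict_def)
  have "?h \<in> hom (cochain_group Y n) (cochain_group X n)"
  proof (rule homI)
    fix \<phi> \<psi> show "?h (\<phi> \<otimes>\<^bsub>cochain_group Y n\<^esub> \<psi>) = ?h \<phi> \<otimes>\<^bsub>cochain_group X n\<^esub> ?h \<psi>"
      using m by (auto simp: cochain_group_simps fun_eq_iff)
  qed (simp add: cochain_group_simps)
  moreover have "?h ` locally_zero_cochains Y n \<subseteq> locally_zero_cochains X n"
  proof
    fix \<psi> assume "\<psi> \<in> ?h ` locally_zero_cochains Y n"
    then obtain \<phi> where p: "\<phi> \<in> extensional (tuples Y n)" "\<phi> \<in> null_cochains Y n" "\<psi> = ?h \<phi>" by (auto simp: locally_zero_eq)
    then have "\<psi> = restrict (ext_pullback X f \<phi>) (tuples X n)" using hr[of \<phi>] by (simp add: extensional_restrict)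
    then show "\<psi> \<in> locally_zero_cochains X n" using ext_pullback_null_cochains[OF f p(2)] by (simp add: restrict_locally_zero)
  qed
  ultimately have "locally_zero_cochains X n <#>\<^bsub>cochain_group X n\<^esub> ?h ` (locally_zero_cochains Y n #>\<^bsub>cochain_group Y n\<^esub> restrict \<phi> (tuples Y n))
     = locally_zero_cochains X n #>\<^bsub>cochain_group X n\<^esub> ?h (restrict \<phi> (tuples Y n))"
    by (rule set_mult_image_coset[OF normal_locally_zero normal_locally_zero]) (simp add: cochain_group_simps)
  then show ?thesis unfolding normal_cochain_map_def cochain_class_def hr .
qed

section \<open>Comparison of the space with late terms of the system\<close>

lemma normal_entourage_cube:
  assumes "normal_entourage X E"
  obtains D where "normal_entourage X D" "sym D"
    "\<forall>w x y z. x \<in> topspace X \<longrightarrow> y \<in> topspace X \<longrightarrow> z \<in> topspace X \<longrightarrow>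
       (w, x) \<in> D \<longrightarrow> (x, y) \<in> D \<longrightarrow> (y, z) \<in> D \<longrightarrow> (w, z) \<in> E"
proof -
  obtain D1 where D1: "normal_entourage X D1" "sym D1"
    "\<forall>x y z. (x, y) \<in> D1 \<longrightarrow> (y, z) \<in> D1 \<longrightarrow> y \<in> topspace X \<longrightarrow> (x, z) \<in> E"
    by (rule normal_entourage_sqrt[OF assms])
  obtain D where D: "normal_entourage X D" "sym D"
    "\<forall>x y z. (x, y) \<in> D \<longrightarrow> (y, z) \<in> D \<longrightarrow> y \<in> topspace X \<longrightarrow> (x, z) \<in> D1"
    by (rule normal_entourage_sqrt[OF D1(1)])
  show ?thesis
  proof (rule that[OF D(1,2)]; intro allI impI)
    fix w x y z
    assume t: "x \<in> topspace X" "y \<in> topspace X" "z \<in> topspace X" and d: "(w, x) \<in> D" "(x, y) \<in> D" "(y, z) \<in> D"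
    have "(w, y) \<in> D1" using D(3) d t by blast
    \<comment> \<open>The third step is padded by the trivial step at \<open>z\<close>, since two
      square roots provide room for four steps.\<close>
    moreover have "(y, z) \<in> D1" using D(3) d t normal_entourage_refl[OF D(1) t(3)] by blast
    ultimately show "(w, z) \<in> E" using D1(3) t by blast
  qed
qed

lemma Times_subset_images:
  assumes "\<And>x y. x \<in> A \<Longrightarrow> y \<in> A \<Longrightarrow> (f x, f y) \<in> E \<and> (g x, g y) \<in> E \<and> (g x, f y) \<in> E \<and> (f x, g y) \<in> E"
    and S: "S \<subseteq> f ` A \<union> g ` A"
  shows "S \<times> S \<subseteq> E"
proof -
  have "(f ` A \<union> g ` A) \<times> (f ` A \<union> g ` A) \<subseteq> E" using assms(1) by auto
  then show ?thesis using S by blast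
qed

locale space_resolution =
  fixes \<Lambda> :: "'l set" and leq :: "'l \<Rightarrow> 'l \<Rightarrow> bool" and Y :: "'l \<Rightarrow> 'b topology"
    and p :: "'l \<Rightarrow> 'l \<Rightarrow> 'b \<Rightarrow> 'b" and X :: "'a topology" and q :: "'l \<Rightarrow> 'a \<Rightarrow> 'b" and e :: "'a \<times> real \<Rightarrow> 'u"
  assumes e: "inj e" and res: "resolution TYPE('u) \<Lambda> leq Y p X q"
begin

lemma dir: "directed_set \<Lambda> leq"
  using res by (simp add: resolution_def inverse_system_of_spaces_def)

lemma p_cont: "\<lbrakk>l \<in> \<Lambda>; m \<in> \<Lambda>; leq l m\<rbrakk> \<Longrightarrow> continuous_map (Y m) (Y l) (p l m)"
  using res by (simp add: resolution_def inverse_system_of_spaces_def)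

lemma p_img: "\<lbrakk>l \<in> \<Lambda>; m \<in> \<Lambda>; leq l m; y \<in> topspace (Y m)\<rbrakk> \<Longrightarrow> p l m y \<in> topspace (Y l)"
  using p_cont by (auto simp: continuous_map_def)

lemma p_p: "\<lbrakk>k \<in> \<Lambda>; l \<in> \<Lambda>; m \<in> \<Lambda>; leq k l; leq l m; y \<in> topspace (Y m)\<rbrakk> \<Longrightarrow> p k l (p l m y) = p k m y"
  using res by (simp add: resolution_def inverse_system_of_spaces_def)

lemma q_cont: "l \<in> \<Lambda> \<Longrightarrow> continuous_map X (Y l) (q l)"
  using res by (simp add: resolution_def maps_to_system_def)

lemma q_img: "\<lbrakk>l \<in> \<Lambda>; x \<in> topspace X\<rbrakk> \<Longrightarrow> q l x \<in> topspace (Y l)"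
  using q_cont by (auto simp: continuous_map_def)

lemma p_q: "\<lbrakk>l \<in> \<Lambda>; m \<in> \<Lambda>; leq l m; x \<in> topspace X\<rbrakk> \<Longrightarrow> p l m (q m x) = q l x"
  using res by (simp add: resolution_def maps_to_system_def)

lemma leq_trans: "\<lbrakk>k \<in> \<Lambda>; l \<in> \<Lambda>; m \<in> \<Lambda>; leq k l; leq l m\<rbrakk> \<Longrightarrow> leq k m"
  using dir unfolding directed_set_def by (meson transp_onD)

text \<open>A late term of the system lies near the image of \<open>X\<close>, which yields a (discontinuous) map
  \<open>r\<close> back to \<open>X\<close> that is nevertheless uniformly controlled.\<close>

lemma back_map:
  assumes l: "l \<in> \<Lambda>" and E: "normal_entourage (Y l) E"
  obtains m r D where "m \<in> \<Lambda>" "leq l m" "normal_entourage (Y l) D"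
    "\<forall>y\<in>topspace (Y m). r y \<in> topspace X"
    "\<forall>x\<in>topspace (Y l). \<forall>y\<in>topspace (Y l). (x, y) \<in> D \<longrightarrow> (x, y) \<in> E"
    "\<forall>y\<in>topspace (Y m). \<forall>y'\<in>topspace (Y m). (p l m y, p l m y') \<in> D \<longrightarrow>
       (q l (r y), q l (r y')) \<in> E \<and> (q l (r y), p l m y') \<in> E \<and> (p l m y, q l (r y')) \<in> E"
proof -
  have r: "inj (\<lambda>x. e (undefined, x))" using e by (auto simp: inj_def)
  obtain D where D: "normal_entourage (Y l) D" "sym D"
    "\<forall>w x y z. x \<in> topspace (Y l) \<longrightarrow> y \<in> topspace (Y l) \<longrightarrow> z \<in> topspace (Y l) \<longrightarrow>
       (w, x) \<in> D \<longrightarrow> (x, y) \<in> D \<longrightarrow> (y, z) \<in> D \<longrightarrow> (w, z) \<in> E"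
    by (rule normal_entourage_cube[OF E])
  note D3 = D(3)[rule_format] and refl = normal_entourage_refl[OF D(1)] and sym = symD[OF D(2)]
  obtain m where m: "m \<in> \<Lambda>" "leq l m" and dense: "\<And>y. y \<in> topspace (Y m) \<Longrightarrow> \<exists>x\<in>topspace X. (q l x, p l m y) \<in> D"
    by (rule resolution_dense[OF res r l D(1)]) blast
  define r where "r y = (SOME x. x \<in> topspace X \<and> (q l x, p l m y) \<in> D)" for y
  have r: "r y \<in> topspace X \<and> (q l (r y), p l m y) \<in> D" if "y \<in> topspace (Y m)" for y
    unfolding r_def by (rule someI_ex) (use dense[OF that] in blast)
  show ?thesis
  proof (rule that[OF m D(1)]; intro ballI impI)
    show "r y \<in> topspace X" if "y \<in> topspace (Y m)" for y using r[OF that] by simp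
    show "(x, y) \<in> E" if "x \<in> topspace (Y l)" "y \<in> topspace (Y l)" "(x, y) \<in> D" for x y
      using D3[of x y y x] that refl by blast
    fix y y' assume y: "y \<in> topspace (Y m)" "y' \<in> topspace (Y m)" and d: "(p l m y, p l m y') \<in> D"
    have t: "p l m y \<in> topspace (Y l)" "p l m y' \<in> topspace (Y l)" "q l (r y) \<in> topspace (Y l)" "q l (r y') \<in> topspace (Y l)"
      using p_img[OF l m] q_img[OF l] y r by auto
    have a: "(q l (r y), p l m y) \<in> D" and b: "(p l m y', q l (r y')) \<in> D" using r[OF y(1)] r[OF y(2)] sym by blast+
    show "(q l (r y), q l (r y')) \<in> E \<and> (q l (r y), p l m y') \<in> E \<and> (p l m y, q l (r y')) \<in> E"
      using D3[OF t(1) t(2) t(4) a d b] D3[OF t(1) t(2) t(2) a d refl[OF t(2)]] D3[OF t(1) t(2) t(4) refl[OF t(1)] d b] by blast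
  qed
qed

text \<open>\<open>\<psi>\<close> is \<open>\<phi>\<close> pulled back along the map
  \<open>r\<close> of \<open>back_map\<close>. Since \<open>r\<close> takes small tuples to small
  ones, \<open>\<psi>\<close> is again a cocycle modulo null cochains. The composite of
  \<open>q m\<close> and \<open>r\<close> is close to the identity of \<open>X\<close>, and the
  prism between the two provides \<open>\<omega>\<close>.\<close>

lemma cohomology_surj:
  assumes "ext_coboundary X \<phi> \<in> null_cochains X (n + 1)"
  shows "\<exists>l\<in>\<Lambda>. \<exists>\<psi> \<omega>. ext_coboundary (Y l) \<psi> \<in> null_cochains (Y l) (n + 1) \<and> \<phi> - (ext_pullback X (q l) \<psi> - ext_coboundary X \<omega>) \<in> null_cochains X n"
proof (cases "n < 0")
  case True
  obtain l where l: "l \<in> \<Lambda>" using dir by (auto simp: directed_set_def)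
  have "ext_coboundary (Y l) 0 = 0" by (rule additive.zero[OF additive_ext_coboundary])
  then have "ext_coboundary (Y l) 0 \<in> null_cochains (Y l) (n + 1)" using add_subgroup_zero[OF add_subgroup_null_cochains] by simp
  then show ?thesis using l null_cochains_negative[OF True] by blast
next
  case False
  obtain E where E: "normal_entourage X E" "\<forall>xs\<in>tuples X (n + 1). set xs \<times> set xs \<subseteq> E \<longrightarrow> ext_coboundary X \<phi> xs = 0"
    using assms unfolding null_cochains_def by blast
  have alt0: "alt_sum \<phi> xs = 0" if "set xs \<subseteq> topspace X" "int (length xs) = n + 2" "set xs \<times> set xs \<subseteq> E" for xs
  proof -
    have "2 \<le> length xs" "xs \<noteq> []" using that(2) False by auto
    then have "xs \<in> tuples X (n + 1)" using that by (auto simp: tuples_def)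
    then show ?thesis using E(2) that \<open>2 \<le> length xs\<close> by (auto simp: ext_coboundary_def)
  qed
  obtain l E1 where l: "l \<in> \<Lambda>" and E1: "normal_entourage (Y l) E1"
    and E1E: "\<And>x x'. x \<in> topspace X \<Longrightarrow> x' \<in> topspace X \<Longrightarrow> (q l x, q l x') \<in> E1 \<Longrightarrow> (x, x') \<in> E"
    by (rule resolution_entourage[OF res e E(1)]) blast
  obtain m r D where m: "m \<in> \<Lambda>" "leq l m" and D: "normal_entourage (Y l) D" and r: "\<forall>y\<in>topspace (Y m). r y \<in> topspace X"
    and DE: "\<forall>x\<in>topspace (Y l). \<forall>y\<in>topspace (Y l). (x, y) \<in> D \<longrightarrow> (x, y) \<in> E1"
    and rE: "\<forall>y\<in>topspace (Y m). \<forall>y'\<in>topspace (Y m). (p l m y, p l m y') \<in> D \<longrightarrow>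
       (q l (r y), q l (r y')) \<in> E1 \<and> (q l (r y), p l m y') \<in> E1 \<and> (p l m y, q l (r y')) \<in> E1"
    by (rule back_map[OF l E1])
  define \<psi> where "\<psi> = ext_pullback (Y m) r \<phi>"
  have "ext_coboundary (Y m) \<psi> \<in> null_cochains (Y m) (n + 1)"
  proof (rule null_cochainsI[OF normal_entourage_pullback[OF p_cont[OF l m] D]])
    fix ys assume ys: "ys \<in> tuples (Y m) (n + 1)" "set ys \<times> set ys \<subseteq> {(x, y). (p l m x, p l m y) \<in> D}"
    then have sy: "set ys \<subseteq> topspace (Y m)" "int (length ys) = n + 2" by (auto simp: tuples_def)
    have "ext_coboundary (Y m) \<psi> = ext_pullback (Y m) r (ext_coboundary X \<phi>)"
      unfolding \<psi>_def by (rule ext_pullback_ext_coboundary[symmetric]) (use r in auto)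
    moreover have "alt_sum \<phi> (map r ys) = 0"
    proof (rule alt0)
      show "set (map r ys) \<subseteq> topspace X" using sy r by auto
      show "set (map r ys) \<times> set (map r ys) \<subseteq> E"
      proof clarsimp
        fix y y' assume y: "y \<in> set ys" "y' \<in> set ys"
        then show "(r y, r y') \<in> E" using sy ys(2) rE r by (intro E1E) blast+
      qed
    qed (use sy in simp)
    ultimately show "ext_coboundary (Y m) \<psi> ys = 0" by (simp add: ext_pullback_def ext_coboundary_def)
  qed
  moreover have "\<phi> - (ext_pullback X (q m) \<psi> - ext_coboundary X (prism (\<lambda>x. x) (\<lambda>x. r (q m x)) \<phi>)) \<in> null_cochains X n"
  proof (rule null_cochainsI[OF normal_entourage_pullback[OF q_cont[OF l] D]])
    let ?g = "\<lambda>x. r (q m x)"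
    fix xs assume xs: "xs \<in> tuples X n" "set xs \<times> set xs \<subseteq> {(x, y). (q l x, q l y) \<in> D}"
    then have sx: "set xs \<subseteq> topspace X" "int (length xs) = n + 1" "xs \<noteq> []" by (auto simp: tuples_def)
    have gX: "?g x \<in> topspace X" if "x \<in> set xs" for x using that sx(1) r q_img[OF m(1)] by blast
    have pr: "prism (\<lambda>x. x) ?g (alt_sum \<phi>) xs = 0"
    proof (rule prism_eq_0, rule alt0)
      fix ys assume ys: "length ys = Suc (length xs)" "set ys \<subseteq> (\<lambda>x. x) ` set xs \<union> ?g ` set xs"
      show "set ys \<subseteq> topspace X" using ys(2) sx(1) gX by blast
      show "int (length ys) = n + 2" using ys(1) sx(2) by simp
      have close: "(x, x') \<in> E \<and> (?g x, ?g x') \<in> E \<and> (?g x, x') \<in> E \<and> (x, ?g x') \<in> E" if x: "x \<in> set xs" "x' \<in> set xs" for x x'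
      proof -
        have xX: "x \<in> topspace X" "x' \<in> topspace X" using x sx(1) by auto
        have d: "(q l x, q l x') \<in> D" using x xs(2) by blast
        have pq: "p l m (q m x) = q l x" "p l m (q m x') = q l x'" using p_q[OF l m] xX by auto
        have "(q l x, q l x') \<in> E1" using DE d q_img[OF l] xX by blast
        moreover have "(q l (?g x), q l (?g x')) \<in> E1 \<and> (q l (?g x), q l x') \<in> E1 \<and> (q l x, q l (?g x')) \<in> E1"
          using rE[rule_format, OF q_img[OF m(1) xX(1)] q_img[OF m(1) xX(2)]] d by (simp add: pq)
        ultimately show ?thesis using E1E xX gX x by simp
      qed
      show "set ys \<times> set ys \<subseteq> E" by (rule Times_subset_images[OF close ys(2)])
    qed
    have "alt_sum (prism (\<lambda>x. x) ?g \<phi>) xs = \<phi> (map ?g xs) - \<phi> xs"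
      using prism_homotopy[of "\<lambda>x. x" ?g \<phi> xs] pr by simp
    \<comment> \<open>On singletons the cut-off of the coboundary is harmless because the prism over
      the empty list is 0.\<close>
    moreover have "alt_sum (prism (\<lambda>x. x) ?g \<phi>) xs = ext_coboundary X (prism (\<lambda>x. x) ?g \<phi>) xs"
    proof (cases "2 \<le> length xs")
      case False
      then obtain x where "xs = [x]" using sx(3) by (cases xs; cases "tl xs") auto
      then show ?thesis by (simp add: ext_coboundary_def)
    qed (simp add: ext_coboundary_def sx)
    moreover have "ext_pullback X (q m) \<psi> xs = \<phi> (map ?g xs)"
      using sx(1) q_img[OF m(1)] by (auto simp: \<psi>_def ext_pullback_def o_def)
    ultimately show "(\<phi> - (ext_pullback X (q m) \<psi> - ext_coboundary X (prism (\<lambda>x. x) ?g \<phi>))) xs = 0" by simp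
  qed
  ultimately show ?thesis using m(1) by blast
qed

text \<open>On a late term \<open>Y m\<close> the map \<open>p l m\<close> is close to the composite
  of \<open>r\<close> and \<open>q l\<close>. The prism compares the two pullbacks of
  \<open>\<phi>\<close>, and the pullback along the composite is the coboundary of
  \<open>\<omega>\<close> pulled back along \<open>r\<close>, because \<open>\<omega>\<close> bounds
  on small tuples of \<open>X\<close>.\<close>

lemma cohomology_inj:
  assumes l: "l \<in> \<Lambda>" and \<phi>: "ext_coboundary (Y l) \<phi> \<in> null_cochains (Y l) (n + 1)" and \<omega>: "ext_pullback X (q l) \<phi> - ext_coboundary X \<omega> \<in> null_cochains X n"
  shows "\<exists>m\<in>\<Lambda>. leq l m \<and> (\<exists>\<psi>. ext_pullback (Y m) (p l m) \<phi> - ext_coboundary (Y m) \<psi> \<in> null_cochains (Y m) n)"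
proof (cases "n < 0")
  case True
  have "leq l l" using dir l by (auto simp: directed_set_def dest: reflp_onD)
  then show ?thesis using l null_cochains_negative[OF True] by blast
next
  case False
  obtain E where E: "normal_entourage (Y l) E" "\<forall>xs\<in>tuples (Y l) (n + 1). set xs \<times> set xs \<subseteq> E \<longrightarrow> ext_coboundary (Y l) \<phi> xs = 0"
    using \<phi> unfolding null_cochains_def by blast
  have alt0: "alt_sum \<phi> xs = 0" if "set xs \<subseteq> topspace (Y l)" "int (length xs) = n + 2" "set xs \<times> set xs \<subseteq> E" for xs
  proof -
    have "2 \<le> length xs" "xs \<noteq> []" using that(2) False by auto
    then have "xs \<in> tuples (Y l) (n + 1)" using that by (auto simp: tuples_def)
    then show ?thesis using E(2) that \<open>2 \<le> length xs\<close> by (auto simp: ext_coboundary_def)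
  qed
  obtain F where F: "normal_entourage X F" "\<forall>xs\<in>tuples X n. set xs \<times> set xs \<subseteq> F \<longrightarrow> (ext_pullback X (q l) \<phi> - ext_coboundary X \<omega>) xs = 0"
    using \<omega> unfolding null_cochains_def by blast
  obtain l1 F1 where l1: "l1 \<in> \<Lambda>" and F1: "normal_entourage (Y l1) F1"
    and F1F: "\<And>x x'. x \<in> topspace X \<Longrightarrow> x' \<in> topspace X \<Longrightarrow> (q l1 x, q l1 x') \<in> F1 \<Longrightarrow> (x, x') \<in> F"
    by (rule resolution_entourage[OF res e F(1)]) blast
  obtain k where k: "k \<in> \<Lambda>" "leq l k" "leq l1 k" using dir l l1 unfolding directed_set_def by blast
  \<comment> \<open>The first factor controls where \<open>\<phi>\<close> is a cocycle on
    \<open>Y l\<close>. The second controls where \<open>\<omega>\<close> bounds on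
    \<open>X\<close>, a condition detected only on the term \<open>l1\<close>; hence the passage to
    \<open>k\<close> above both.\<close>
  let ?E1 = "{(x, y). (p l k x, p l k y) \<in> E} \<inter> {(x, y). (p l1 k x, p l1 k y) \<in> F1}"
  have E1: "normal_entourage (Y k) ?E1"
    using k l l1 by (intro normal_entourage_Int normal_entourage_pullback[OF p_cont] E(1) F1)
  obtain m r D where m: "m \<in> \<Lambda>" "leq k m" and D: "normal_entourage (Y k) D" and r: "\<forall>y\<in>topspace (Y m). r y \<in> topspace X"
    and DE: "\<forall>x\<in>topspace (Y k). \<forall>y\<in>topspace (Y k). (x, y) \<in> D \<longrightarrow> (x, y) \<in> ?E1"
    and rE: "\<forall>y\<in>topspace (Y m). \<forall>y'\<in>topspace (Y m). (p k m y, p k m y') \<in> D \<longrightarrow>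
       (q k (r y), q k (r y')) \<in> ?E1 \<and> (q k (r y), p k m y') \<in> ?E1 \<and> (p k m y, q k (r y')) \<in> ?E1"
    by (rule back_map[OF k(1) E1])
  have lm: "leq l m" by (rule leq_trans[OF l k(1) m(1) k(2) m(2)])
  let ?f = "p l m" and ?g = "\<lambda>y. q l (r y)"
  have "ext_pullback (Y m) ?f \<phi> - ext_coboundary (Y m) (ext_pullback (Y m) r \<omega> - prism ?f ?g \<phi>) \<in> null_cochains (Y m) n"
  proof (rule null_cochainsI[OF normal_entourage_pullback[OF p_cont[OF k(1) m] D]])
    fix ys assume ys: "ys \<in> tuples (Y m) n" "set ys \<times> set ys \<subseteq> {(x, y). (p k m x, p k m y) \<in> D}"
    then have sy: "set ys \<subseteq> topspace (Y m)" "int (length ys) = n + 1" "ys \<noteq> []" by (auto simp: tuples_def)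
    have rX: "r y \<in> topspace X" if "y \<in> set ys" for y using that sy(1) r by blast
    have close: "(r y, r y') \<in> F \<and> (?f y, ?f y') \<in> E \<and> (?g y, ?g y') \<in> E \<and> (?g y, ?f y') \<in> E \<and> (?f y, ?g y') \<in> E"
      if y: "y \<in> set ys" "y' \<in> set ys" for y y'
    proof -
      have yY: "y \<in> topspace (Y m)" "y' \<in> topspace (Y m)" using y sy(1) by auto
      have d: "(p k m y, p k m y') \<in> D" using y ys(2) by blast
      have pp: "p l k (p k m y) = ?f y" "p l k (p k m y') = ?f y'"
        using p_p[OF l k(1) m(1) k(2) m(2)] yY by auto
      have pq: "p l k (q k (r y)) = ?g y" "p l k (q k (r y')) = ?g y'" "p l1 k (q k (r y)) = q l1 (r y)" "p l1 k (q k (r y')) = q l1 (r y')"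
        using p_q[OF l k(1,2)] p_q[OF l1 k(1,3)] rX y by auto
      have "(p k m y, p k m y') \<in> ?E1" using DE d p_img[OF k(1) m] yY by blast
      moreover have "(q k (r y), q k (r y')) \<in> ?E1 \<and> (q k (r y), p k m y') \<in> ?E1 \<and> (p k m y, q k (r y')) \<in> ?E1"
        using rE yY d by blast
      ultimately show ?thesis using F1F rX y by (auto simp: pp pq)
    qed
    have pr: "prism ?f ?g (alt_sum \<phi>) ys = 0"
    proof (rule prism_eq_0, rule alt0)
      fix zs assume zs: "length zs = Suc (length ys)" "set zs \<subseteq> ?f ` set ys \<union> ?g ` set ys"
      show "set zs \<subseteq> topspace (Y l)" using zs(2) sy(1) rX q_img[OF l] p_img[OF l m(1) lm] by blast
      show "int (length zs) = n + 2" using zs(1) sy(2) by simp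
      show "set zs \<times> set zs \<subseteq> E" by (rule Times_subset_images[OF close[THEN conjunct2] zs(2)])
    qed
    then have h: "alt_sum (prism ?f ?g \<phi>) ys = \<phi> (map ?g ys) - \<phi> (map ?f ys)"
      using prism_homotopy[of ?f ?g \<phi> ys] by simp
    have ry: "map r ys \<in> tuples X n" using sy rX by (auto simp: tuples_def)
    have "set (map r ys) \<times> set (map r ys) \<subseteq> F" using close by auto
    then have "(ext_pullback X (q l) \<phi> - ext_coboundary X \<omega>) (map r ys) = 0" using F(2) ry by blast
    then have "ext_pullback X (q l) \<phi> (map r ys) = ext_coboundary X \<omega> (map r ys)" by simp
    moreover have "ext_pullback X (q l) \<phi> (map r ys) = \<phi> (map ?g ys)" using rX by (auto simp: ext_pullback_def o_def)
    \<comment> \<open>Pullback along any function, continuous or not, commutes with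
      coboundaries.\<close>
    moreover have "ext_coboundary X \<omega> (map r ys) = ext_coboundary (Y m) (ext_pullback (Y m) r \<omega>) ys"
      using fun_cong[OF ext_pullback_ext_coboundary[of r "Y m" X \<omega>], of ys] r sy(1) by (auto simp: ext_pullback_def)
    ultimately have g: "\<phi> (map ?g ys) = ext_coboundary (Y m) (ext_pullback (Y m) r \<omega>) ys" by simp
    have "alt_sum (prism ?f ?g \<phi>) ys = ext_coboundary (Y m) (prism ?f ?g \<phi>) ys"
    proof (cases "2 \<le> length ys")
      case False
      then obtain y where "ys = [y]" using sy(3) by (cases ys; cases "tl ys") auto
      then show ?thesis by (simp add: ext_coboundary_def)
    qed (simp add: ext_coboundary_def sy)
    then show "(ext_pullback (Y m) ?f \<phi> - ext_coboundary (Y m) (ext_pullback (Y m) r \<omega> - prism ?f ?g \<phi>)) ys = 0"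
      using h g sy(1) by (simp add: additive.diff[OF additive_ext_coboundary] ext_pullback_def)
  qed
  then show ?thesis using m(1) lm by blast
qed

end

theorem theorem2:
  fixes X :: "'a topology"
    and G :: "'g monoid" and \<iota> :: "'g \<Rightarrow> 'i"
    and I0 :: "'i monoid" and \<beta> :: "'i \<Rightarrow> 'j" and I1 :: "'j monoid"
    and \<Lambda> :: "'l set" and leq :: "'l \<Rightarrow> 'l \<Rightarrow> bool"
    and Y :: "'l \<Rightarrow> 'b topology" and p :: "'l \<Rightarrow> 'l \<Rightarrow> 'b \<Rightarrow> 'b"
    and q :: "'l \<Rightarrow> 'a \<Rightarrow> 'b"
    and e :: "'a \<times> real \<Rightarrow> 'u"
  assumes "inj e"
    and "injective_resolution TYPE('u) G \<iota> I0 \<beta> I1"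
    and "polyhedral_resolution TYPE('u) \<Lambda> leq Y p X q"
  shows "\<forall>n :: int. normal_homology I0 I1 \<beta> X n \<cong> resolution_homology I0 I1 \<beta> \<Lambda> leq Y p n"
proof
  fix n :: int
  have "resolution TYPE('u) \<Lambda> leq Y p X q" using assms(3) by (simp add: polyhedral_resolution_def)
  then interpret R: space_resolution \<Lambda> leq Y p X q e using assms(1) by unfold_locales
  \<comment> \<open>The integers embed into \<open>'u\<close> through the real coordinate; this is
    the test group that gives divisibility.\<close>
  have f: "inj (\<lambda>k :: int. e (undefined, real_of_int k))" by (rule injI) (auto dest: injD[OF assms(1)])
  have div: "divisible I0" "divisible I1"
    using assms(2) injective_group_divisible[OF f] by (auto simp: injective_resolution_def)
  have \<beta>: "\<beta> \<in> hom I0 I1" using assms(2) by (auto simp: injective_resolution_def epi_def)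
  \<comment> \<open>The ungraded groups are the integer-valued functions on all lists of points,
    both for \<open>X\<close> and for the terms; null cochains supply the grading.\<close>
  interpret S: presented_cochain_system \<Lambda> leq "ext_coboundary X" "\<lambda>l. ext_coboundary (Y l)" "\<lambda>l m. ext_pullback (Y m) (p l m)" "\<lambda>l. ext_pullback X (q l)"
    "null_cochains X" "\<lambda>l. null_cochains (Y l)" I0 \<beta> I1 "\<lambda>l. normal_cochains (Y l)" "\<lambda>l. cochain_class (Y l)"
    "\<lambda>l m. normal_cochain_map (Y m) (p l m)"
  proof
    fix k l m :: 'l and n :: int and y :: "'b list \<Rightarrow> int"
    show "ext_pullback (Y m) (p l m) (ext_coboundary (Y l) y) = ext_coboundary (Y m) (ext_pullback (Y m) (p l m) y)" if "l \<in> \<Lambda>" "m \<in> \<Lambda>" "leq l m"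
      by (rule ext_pullback_ext_coboundary) (use R.p_img that in auto)
    show "ext_pullback X (q l) (ext_coboundary (Y l) y) = ext_coboundary X (ext_pullback X (q l) y)" if "l \<in> \<Lambda>"
      by (rule ext_pullback_ext_coboundary) (use R.q_img that in auto)
    show "ext_pullback (Y m) (p l m) (ext_pullback (Y l) (p k l) y) = ext_pullback (Y m) (p k m) y" if "k \<in> \<Lambda>" "l \<in> \<Lambda>" "m \<in> \<Lambda>" "leq k l" "leq l m"
      by (rule ext_pullback_ext_pullback) (use R.p_img R.p_p that in auto)
    show "ext_pullback X (q m) (ext_pullback (Y m) (p l m) y) = ext_pullback X (q l) y" if "l \<in> \<Lambda>" "m \<in> \<Lambda>" "leq l m"
      by (rule ext_pullback_ext_pullback) (use R.q_img R.p_q that in auto)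
    show "\<exists>l\<in>\<Lambda>. \<exists>y x'. ext_coboundary (Y l) y \<in> null_cochains (Y l) (n + 1) \<and> x - (ext_pullback X (q l) y - ext_coboundary X x') \<in> null_cochains X n"
      if "ext_coboundary X x \<in> null_cochains X (n + 1)" for x
      by (rule R.cohomology_surj[OF that])
    show "diff (normal_cochains (Y l)) n (cochain_class (Y l) n y) = cochain_class (Y l) (n + 1) (ext_coboundary (Y l) y)"
      by (rule diff_normal_cochains)
    show "normal_cochain_map (Y m) (p l m) n (cochain_class (Y l) n y) = cochain_class (Y m) n (ext_pullback (Y m) (p l m) y)"
      if "l \<in> \<Lambda>" "m \<in> \<Lambda>" "leq l m"
      by (rule normal_cochain_map_class[OF R.p_cont[OF that]])
  qed (auto simp: additive.add[OF additive_ext_coboundary] additive.add[OF additive_ext_pullback] ext_coboundary_ext_coboundary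
      intro: R.dir add_subgroup_null_cochains ext_coboundary_null_cochains ext_pullback_null_cochains[OF R.p_cont]
        ext_pullback_null_cochains[OF R.q_cont] R.cohomology_inj div \<beta> presents_normal_cochains)
  show "normal_homology I0 I1 \<beta> X n \<cong> resolution_homology I0 I1 \<beta> \<Lambda> leq Y p n"
    using S.homology_iso_total[where n = n, OF presents_normal_cochains[of X] diff_normal_cochains[of X]]
    unfolding normal_homology_def resolution_homology_def normal_chains_def normal_chain_map_def .
qed

end
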